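(* For every integer $k\ge0$, $|L_{16}(k)|=T_{16}(k)+\mathcal E_{16}(k)$, where $$T_{16}(k)=\frac{2048k^8}{1575}+\frac{2048k^7}{225}+\frac{1984k^6}{75}+\frac{9296k^5}{225}+\frac{958k^4}{25}+\frac{5138k^3}{225}+\frac{33851k^2}{3150}+\frac{137k}{30}+\frac{109}{125}$$ and $$\mathcal E_{16}(k)=\begin{cases}-\dfrac{64}{125},&k\equiv1\pmod5,\\[2mm]\dfrac{16}{125},&k\equiv0,2,3,4\pmod5.\end{cases}$$
   Context: Notation: $q=e^{2\pi i\tau}$, $\operatorname{Im}\tau>0$; $(x_1,\dots,x_s;q)_\infty=\prod_{i=1}^s\prod_{n\ge0}(1-x_iq^n)$. For $N\ge5$ put $m=\lfloor N/2\rfloor$. For an even integer $a_0\ge0$ and $\mathbf a=(a_1,\dots,a_m)\in\mathbb Z^m$, $$f^{(N)}_{\mathbf a}(\tau)=q^{\frac N{24}S_1-\frac1{2N}S_2}(q^N;q^N)_\infty^{a_0}\prod_{j=1}^m(q^j,q^{N-j};q^N)_\infty^{a_j},\quad S_1=a_0+2\sum_{j=1}^m a_j,\quad S_2=\sum_{j=1}^m j(N-j)a_j.$$ For an integer $k\ge0$, $L_N(k)$ is the set of all $\mathbf a\in\mathbb Z^m$ such that, with $a_0=2k$, $f^{(N)}_{\mathbf a}\in M_k(\Gamma_1(N))$, the space of holomorphic modular forms of weight $k$ on $\Gamma_1(N)=\{\begin{pmatrix}a&b\\c&d\end{pmatrix}\in\mathrm{SL}_2(\mathbb Z):a\equiv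 d\equiv1,\ c\equiv0\pmod N\}$. Here $N=16$, $m=8$. *)

theory Defs
  imports "HOL-Complex_Analysis.Complex_Analysis" "HOL-Number_Theory.Cong"
begin

definition upper_half_plane :: "complex set" where
  "upper_half_plane = {\<tau>. Im \<tau> > 0}"

definition SL2Z :: "(int ^ 2 ^ 2) set" where
  "SL2Z = {A. det A = 1}"

definition Gamma1 :: "nat \<Rightarrow> (int ^ 2 ^ 2) set" where
  "Gamma1 N = {A \<in> SL2Z. [A $ 1 $ 1 = 1] (mod int N) \<and> [A $ 2 $ 2 = 1] (mod int N) \<and>
                 [A $ 2 $ 1 = 0] (mod int N)}"

definition moebius :: "int ^ 2 ^ 2 \<Rightarrow> complex \<Rightarrow> complex" where
  "moebius A \<tau> = (of_int (A $ 1 $ 1) * \<tau> + of_int (A $ 1 $ 2)) /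
                  (of_int (A $ 2 $ 1) * \<tau> + of_int (A $ 2 $ 2))"

definition slash :: "nat \<Rightarrow> (complex \<Rightarrow> complex) \<Rightarrow> int ^ 2 ^ 2 \<Rightarrow> complex \<Rightarrow> complex" where
  "slash k f A \<tau> = f (moebius A \<tau>) / (of_int (A $ 2 $ 1) * \<tau> + of_int (A $ 2 $ 2)) ^ k"

text \<open>
  Holomorphy at all cusps of \<open>\<Gamma>\<^sub>1(N)\<close>: for every \<open>A \<in> SL\<^sub>2(\<int>)\<close>, the function \<open>f|\<^sub>kA\<close>,
  which has period \<open>N\<close> because the conjugate of \<open>\<Gamma>\<^sub>1(N)\<close> by \<open>A\<close> contains \<open>\<Gamma>(N)\<close>,
  is a function of \<open>exp(2\<pi>i\<tau>/N)\<close> that extends holomorphically to the origin.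
  A function is only looked at on the upper half plane; its values elsewhere are irrelevant.
\<close>

definition holomorphic_at_cusps :: "nat \<Rightarrow> nat \<Rightarrow> (complex \<Rightarrow> complex) \<Rightarrow> bool" where
  "holomorphic_at_cusps k N f \<longleftrightarrow>
     (\<forall>A\<in>SL2Z. \<exists>F. F holomorphic_on ball 0 1 \<and>
        (\<forall>\<tau>\<in>upper_half_plane.
           slash k f A \<tau> = F (exp (2 * of_real pi * \<i> * \<tau> / of_nat N))))"

definition modular_forms_Gamma1 :: "nat \<Rightarrow> nat \<Rightarrow> (complex \<Rightarrow> complex) set" where
  "modular_forms_Gamma1 k N =
     {f. f holomorphic_on upper_half_plane \<and>
         (\<forall>A\<in>Gamma1 N. \<forall>\<tau>\<in>upper_half_plane. slash k f A \<tau> = f \<tau>) \<and>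
         holomorphic_at_cusps k N f}"

definition qpoch :: "complex \<Rightarrow> complex \<Rightarrow> complex" where
  "qpoch x q = (\<Prod>n. 1 - x * q ^ n)"

text \<open>
  For rational (or real) \<open>r\<close>, the power \<open>q\<^sup>r\<close> means \<open>exp(2\<pi>ir\<tau>)\<close>, which is not the principal
  power of \<open>q\<close>.
\<close>

definition q_pow :: "real \<Rightarrow> complex \<Rightarrow> complex" where
  "q_pow r \<tau> = exp (2 * of_real pi * \<i> * of_real r * \<tau>)"

definition S1 :: "nat \<Rightarrow> nat \<Rightarrow> (nat \<Rightarrow> int) \<Rightarrow> int" where
  "S1 N a0 a = int a0 + 2 * (\<Sum>j=1..N div 2. a j)"

definition S2 :: "nat \<Rightarrow> (nat \<Rightarrow> int) \<Rightarrow> int" where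
  "S2 N a = (\<Sum>j=1..N div 2. int j * (int N - int j) * a j)"

definition theta_prod :: "nat \<Rightarrow> nat \<Rightarrow> (nat \<Rightarrow> int) \<Rightarrow> complex \<Rightarrow> complex" where
  "theta_prod N a0 a \<tau> =
     (let q = q_pow 1 \<tau> in
        q_pow (real N / 24 * of_int (S1 N a0 a) - 1 / (2 * real N) * of_int (S2 N a)) \<tau> *
        qpoch (q ^ N) (q ^ N) ^ a0 *
        (\<Prod>j=1..N div 2. (qpoch (q ^ j) (q ^ N) * qpoch (q ^ (N - j)) (q ^ N)) powi a j))"

text \<open>
  A vector in \<open>\<int>\<^sup>m\<close> with \<open>m = \<lfloor>N/2\<rfloor>\<close> is a function that is \<open>undefined\<close> outside
  \<open>{1..m}\<close>, so that distinct functions are distinct vectors and can be counted.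
\<close>

definition L :: "nat \<Rightarrow> nat \<Rightarrow> (nat \<Rightarrow> int) set" where
  "L N k = {a \<in> {1..N div 2} \<rightarrow>\<^sub>E UNIV. theta_prod N (2 * k) a \<in> modular_forms_Gamma1 k N}"

definition T16 :: "nat \<Rightarrow> real" where
  "T16 k = 2048 * real k ^ 8 / 1575 + 2048 * real k ^ 7 / 225 + 1984 * real k ^ 6 / 75
           + 9296 * real k ^ 5 / 225 + 958 * real k ^ 4 / 25 + 5138 * real k ^ 3 / 225
           + 33851 * real k ^ 2 / 3150 + 137 * real k / 30 + 109 / 125"

definition E16 :: "nat \<Rightarrow> real" where
  "E16 k = (if [k = 1] (mod 5) then - 64 / 125 else 16 / 125)"

end

theory Submission
  imports Defs
begin

text \<open>
  Each factor of the theta product is a Siegel function at \<open>16\<tau>\<close>. Siegel functions are permuted by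
  \<open>SL\<^sub>2(\<int>)\<close> up to twelfth roots of unity: for the inversion, both sides are elliptic with the same divisor,
  so Liouville's theorem makes their quotient constant, and the constancy of the product of the three functions of
  level 2 bounds that constant. Hence all cusp expansions are explicit. Periodicity at the cusps \<open>0\<close> and \<open>\<infinity>\<close>
  forces two congruences on the exponents; these make all multipliers trivial, so membership in \<open>M\<^sub>k\<close> amounts to
  them together with nonnegativity of the nine different orders at the cusps.

  The exponents are recovered linearly from the nine orders, which range over the nonnegative vectors of degree \<open>8k\<close>
  in a sublattice of index 20 in \<open>\<int>\<^sup>9\<close>. Splitting off seven lattice vectors of degree 4 writes their number
  as a sevenfold partial sum of a count of plane lattice points with \<open>|d| + |e| = n\<close> and \<open>e \<equiv> 2d\<close> modulo 5.
\<close>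

section \<open>The infinite q-Pochhammer symbol\<close>

text \<open>The multiplier of a Siegel function under a general matrix is never computed; only its
  twelfth power is known to be 1. This suffices because differentiating the law of
  \<open>siegel 0 v\<close> at \<open>v = 0\<close> gives \<eta>^2 the same multiplier, so the whole
  product picks up one root of unity to the power k + sum a_j. At the cusp 0 the order is (k + sum
  a_j) / 12, so its integrality is exactly what kills that power.

  The degree 8k is the number of zeros of a form of weight k on Gamma_1(16). The index 20 is 2 * 2 *
  5: two parities and a condition modulo 5, the source of the periodic term. With degree written as
  4c, each split-off vector is a factor 1 / (1 - x) of the generating function in x^c; as c = 2k,
  odd c must be carried along although only even c matters in the end. Seven such factors leave
  coefficients of linear growth, so the closed formula is checked through its seventh differences
  rather than found by summation.\<close>

lemma convergent_prod_qpoch: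
  fixes x q :: complex
  assumes "norm q < 1"
  shows "convergent_prod (\<lambda>n. 1 - x * q ^ n)"
proof -
  have "summable (\<lambda>n. norm (x * q ^ n))"
    using assms by (auto simp: norm_mult norm_power intro!: summable_mult summable_geometric)
  hence "abs_convergent_prod (\<lambda>n. 1 - x * q ^ n)"
    by (subst abs_convergent_prod_conv_summable) simp
  thus ?thesis
    by (rule abs_convergent_prod_imp_convergent_prod)
qed

lemma qpoch_LIMSEQ:
  assumes "norm q < 1"
  shows "(\<lambda>n. \<Prod>i<n. 1 - x * q ^ i) \<longlonglongrightarrow> qpoch x q"
  using convergent_prod_LIMSEQ[OF convergent_prod_qpoch[OF assms, of x]]
  by (subst filterlim_sequentially_Suc [symmetric]) (simp add: qpoch_def lessThan_Suc_atMost)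

lemma qpoch_eqI:
  assumes "norm q < 1" "(\<lambda>n. \<Prod>i<n. 1 - x * q ^ i) \<longlonglongrightarrow> y"
  shows "qpoch x q = y"
  using LIMSEQ_unique[OF qpoch_LIMSEQ[OF assms(1), of x] assms(2)] .

lemma qpoch_eq_0_iff:
  assumes "norm q < 1"
  shows "qpoch x q = 0 \<longleftrightarrow> (\<exists>n. x * q ^ n = 1)"
proof
  assume "qpoch x q = 0"
  show "\<exists>n. x * q ^ n = 1"
  proof (rule ccontr)
    assume "\<not> ?thesis"
    hence "prodinf (\<lambda>n. 1 - x * q ^ n) \<noteq> 0"
      by (intro prodinf_nonzero convergent_prod_qpoch assms) auto
    with \<open>qpoch x q = 0\<close> show False by (simp add: qpoch_def)
  qed
next
  assume "\<exists>n. x * q ^ n = 1"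
  then obtain n where n: "x * q ^ n = 1" by blast
  have "(\<lambda>m. \<Prod>i<m. 1 - x * q ^ i) \<longlonglongrightarrow> 0"
  proof (rule tendsto_eventually)
    show "\<forall>\<^sub>F m in sequentially. (\<Prod>i<m. 1 - x * q ^ i) = 0"
      using eventually_gt_at_top[of n] by eventually_elim (use n in \<open>auto intro!: prod_zero\<close>)
  qed
  thus "qpoch x q = 0" by (rule qpoch_eqI[OF assms])
qed

lemma qpoch_unfold:
  assumes "norm q < 1"
  shows "qpoch x q = (1 - x) * qpoch (x * q) q"
proof (rule qpoch_eqI[OF assms])
  have "(\<lambda>n. (1 - x) * (\<Prod>i<n. 1 - x * q * q ^ i)) \<longlonglongrightarrow> (1 - x) * qpoch (x * q) q"
    by (intro tendsto_intros qpoch_LIMSEQ assms)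
  also have "(\<lambda>n. (1 - x) * (\<Prod>i<n. 1 - x * q * q ^ i)) = (\<lambda>n. \<Prod>i<Suc n. 1 - x * q ^ i)"
    by (subst prod.lessThan_Suc_shift) (simp add: mult_ac)
  finally show "(\<lambda>n. \<Prod>i<n. 1 - x * q ^ i) \<longlonglongrightarrow> (1 - x) * qpoch (x * q) q"
    by (subst (asm) filterlim_sequentially_Suc)
qed

lemma qpoch_mult_minus:
  assumes "norm q < 1"
  shows "qpoch x q * qpoch (- x) q = qpoch (x ^ 2) (q ^ 2)"
proof -
  have "(\<lambda>n. (\<Prod>i<n. 1 - x * q ^ i) * (\<Prod>i<n. 1 - (- x) * q ^ i)) \<longlonglongrightarrow> qpoch x q * qpoch (- x) q"
    by (intro tendsto_intros qpoch_LIMSEQ assms)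
  also have "(\<lambda>n. (\<Prod>i<n. 1 - x * q ^ i) * (\<Prod>i<n. 1 - (- x) * q ^ i)) =
             (\<lambda>n. \<Prod>i<n. 1 - x ^ 2 * (q ^ 2) ^ i)"
    unfolding prod.distrib [symmetric]
    by (intro ext prod.cong) (auto simp: algebra_simps power2_eq_square power_mult_distrib)
  finally show ?thesis
    using assms by (intro qpoch_eqI [symmetric]) (auto simp: norm_power power_less_one_iff)
qed

lemma qpoch_split_even_odd:
  assumes "norm q < 1"
  shows "qpoch x q = qpoch x (q ^ 2) * qpoch (x * q) (q ^ 2)"
proof -
  have q2: "norm (q ^ 2) < 1" using assms by (auto simp: norm_power power_less_one_iff)
  have eq: "(\<Prod>i<n. 1 - x * (q ^ 2) ^ i) * (\<Prod>i<n. 1 - (x * q) * (q ^ 2) ^ i) = (\<Prod>i<2 * n. 1 - x * q ^ i)" for n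
    by (induction n) (auto simp: power_mult [symmetric] mult_ac)
  have "(\<lambda>n. \<Prod>i<2 * n. 1 - x * q ^ i) \<longlonglongrightarrow> qpoch x (q ^ 2) * qpoch (x * q) (q ^ 2)"
    unfolding eq [symmetric] by (intro tendsto_intros qpoch_LIMSEQ q2)
  moreover have "(\<lambda>n. \<Prod>i<2 * n. 1 - x * q ^ i) \<longlonglongrightarrow> qpoch x q"
    by (rule LIMSEQ_subseq_LIMSEQ[OF qpoch_LIMSEQ[OF assms], unfolded o_def])
       (auto simp: strict_mono_def)
  ultimately show ?thesis by (rule LIMSEQ_unique [symmetric])
qed

text \<open>Argument and base both vary, since the symbol is used as a function of z, of \<tau> and
  of the local parameter at a cusp. On a closed disc \<open>f\<close> is bounded and
  \<open>norm (g t)\<close> has a maximum below 1, which gives a geometric majorant.\<close>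

lemma holomorphic_on_qpoch:
  assumes "open A" "f holomorphic_on A" "g holomorphic_on A" "\<And>t. t \<in> A \<Longrightarrow> norm (g t) < 1"
  shows "(\<lambda>t. qpoch (f t) (g t)) holomorphic_on A"
proof (rule holomorphic_uniform_sequence[OF assms(1)])
  show "(\<lambda>t. \<Prod>i<n. 1 - f t * g t ^ i) holomorphic_on A" for n
    by (intro holomorphic_intros assms)
next
  fix x assume "x \<in> A"
  then obtain d where d: "d > 0" "cball x d \<subseteq> A"
    using assms(1) open_contains_cball by blast
  have cf: "continuous_on (cball x d) f" and cg: "continuous_on (cball x d) g"
    using assms(2,3) d(2) holomorphic_on_imp_continuous_on continuous_on_subset by blast+
  have "compact (f ` cball x d)" by (intro compact_continuous_image cf compact_cball)
  then obtain B where B: "\<And>t. t \<in> cball x d \<Longrightarrow> norm (f t) \<le> B"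
    using compact_imp_bounded[of "f ` cball x d"] unfolding bounded_iff by blast
  have "\<exists>t0\<in>cball x d. \<forall>t\<in>cball x d. norm (g t) \<le> norm (g t0)"
    using d(1) cg by (intro continuous_attains_sup) (auto intro!: continuous_on_norm)
  then obtain t0 where t0: "t0 \<in> cball x d" "\<And>t. t \<in> cball x d \<Longrightarrow> norm (g t) \<le> norm (g t0)"
    by blast
  have r: "norm (g t0) < 1" using t0(1) d(2) assms(4) by blast
  have "uniformly_convergent_on (cball x d) (\<lambda>N t. \<Prod>n<N. 1 - f t * g t ^ n)"
  proof (rule uniformly_convergent_on_prod')
    show "uniformly_convergent_on (cball x d) (\<lambda>N t. \<Sum>n<N. norm (1 - f t * g t ^ n - 1))"
    proof (rule Weierstrass_m_test')
      show "summable (\<lambda>n. B * norm (g t0) ^ n)"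
        using r by (intro summable_mult summable_geometric) auto
      show "norm (norm (1 - f t * g t ^ n - 1)) \<le> B * norm (g t0) ^ n" if "t \<in> cball x d" for n t
        using B[OF that] t0(2)[OF that] 
        by (auto simp: norm_mult norm_power intro!: mult_mono power_mono order.trans[OF norm_ge_zero B[OF that]])
    qed
  qed (auto intro!: continuous_intros cf cg)
  then obtain l where l: "uniform_limit (cball x d) (\<lambda>N t. \<Prod>n<N. 1 - f t * g t ^ n) l sequentially"
    by (auto simp: uniformly_convergent_on_def)
  have "l t = qpoch (f t) (g t)" if "t \<in> cball x d" for t
    using LIMSEQ_unique[OF tendsto_uniform_limitI[OF l that] qpoch_LIMSEQ] assms(4) d(2) that by blast
  hence "uniform_limit (cball x d) (\<lambda>N t. \<Prod>n<N. 1 - f t * g t ^ n) (\<lambda>t. qpoch (f t) (g t)) sequentially"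
    using l by (subst (asm) uniform_limit_cong'[where f = "\<lambda>N t. \<Prod>n<N. 1 - f t * g t ^ n" and i
        = "\<lambda>t. qpoch (f t) (g t)"]) auto
  with d show "\<exists>d>0. cball x d \<subseteq> A \<and>
      uniform_limit (cball x d) (\<lambda>N t. \<Prod>n<N. 1 - f t * g t ^ n) (\<lambda>t. qpoch (f t) (g t)) sequentially"
    by blast
qed

section \<open>Siegel functions\<close>

definition expi :: "complex \<Rightarrow> complex" where
  "expi z = exp (2 * of_real pi * \<i> * z)"

lemma expi_0 [simp]: "expi 0 = 1"
  by (simp add: expi_def)

lemma expi_nonzero [simp]: "expi z \<noteq> 0"
  by (simp add: expi_def)

lemma expi_add: "expi (a + b) = expi a * expi b"
  by (simp add: expi_def exp_add [symmetric] algebra_simps)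

lemma expi_minus: "expi (- a) = inverse (expi a)"
  by (simp add: expi_def exp_minus)

lemma expi_diff: "expi (a - b) = expi a / expi b"
  by (simp add: expi_def exp_diff [symmetric] algebra_simps)

lemma expi_power: "expi a ^ n = expi (of_nat n * a)"
  by (simp add: expi_def exp_of_nat_mult [symmetric] mult_ac)

lemma expi_power_int: "expi a powi n = expi (of_int n * a)"
  by (cases n) (auto simp: power_int_def expi_power expi_minus field_simps)

lemma norm_expi: "norm (expi z) = exp (- 2 * pi * Im z)"
  by (simp add: expi_def)

lemma expi_eq_1_iff: "expi z = 1 \<longleftrightarrow> (\<exists>n::int. z = of_int n)"
proof -
  have "expi z = 1 \<longleftrightarrow> (\<exists>n::int. Im (2 * of_real pi * \<i> * z) = of_int (2 * n) * pi \<and> Re (2 * of_real pi * \<i> * z) = 0)"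
    unfolding expi_def exp_eq_1 by auto
  also have "\<dots> \<longleftrightarrow> (\<exists>n::int. z = of_int n)"
    by (auto simp: complex_eq_iff)
  finally show ?thesis .
qed

lemma expi_of_int [simp]: "expi (of_int n) = 1"
  by (subst expi_eq_1_iff) auto

lemma expi_1 [simp]: "expi 1 = 1"
  using expi_of_int[of 1] by simp

lemma expi_half [simp]: "expi (1 / 2) = -1"
  by (simp add: expi_def exp_pi_i')

lemma expi_quarter [simp]: "expi (1 / 4) = \<i>"
  by (simp add: expi_def exp_Euler cos_of_real sin_of_real flip: of_real_mult of_real_divide)
     (simp add: cos_60 complex_eq_iff exp_Euler Re_exp Im_exp)

lemma holomorphic_on_expi [holomorphic_intros]:
  "f holomorphic_on A \<Longrightarrow> (\<lambda>z. expi (f z)) holomorphic_on A"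
  unfolding expi_def by (intro holomorphic_intros)

lemma norm_expi_less_1: "Im \<tau> > 0 \<Longrightarrow> norm (expi \<tau>) < 1"
  by (simp add: norm_expi)

text \<open>
  Up to constant factors, \<open>jtheta z \<tau>\<close> is \<open>\<theta>\<^sub>1(z, \<tau>) / \<eta>(\<tau>)\<close>, and \<open>siegel u v\<close> is the Siegel function
  \<open>g\<^sub>a\<close> with \<open>a = (u, v)\<close>.
\<close>

definition jtheta :: "complex \<Rightarrow> complex \<Rightarrow> complex" where
  "jtheta z \<tau> = expi (\<tau> / 12 - z / 2) * qpoch (expi z) (expi \<tau>) * qpoch (expi (\<tau> - z)) (expi \<tau>)"

text \<open>This is \<eta>(\<tau>)^2. Up to a constant it is the derivative of \<open>jtheta\<close>
  at z = 0, so its transformation law can be read off from that of the Siegel functions.\<close>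

definition eta_sq :: "complex \<Rightarrow> complex" where
  "eta_sq \<tau> = expi (\<tau> / 12) * qpoch (expi \<tau>) (expi \<tau>) ^ 2"

definition siegel :: "complex \<Rightarrow> complex \<Rightarrow> complex \<Rightarrow> complex" where
  "siegel u v \<tau> = expi (u * (u * \<tau> + v) / 2) * jtheta (u * \<tau> + v) \<tau>"

section \<open>Quasi-periodicity and zeros of the theta function\<close>

lemma jtheta_plus_1: "jtheta (z + 1) \<tau> = - jtheta z \<tau>"
proof -
  have "expi (\<tau> / 12 - (z + 1) / 2) = - expi (\<tau> / 12 - z / 2)"
    by (simp add: expi_diff expi_add add_divide_distrib)
  moreover have "expi (z + 1) = expi z" "expi (\<tau> - (z + 1)) = expi (\<tau> - z)"
    by (simp_all add: expi_add expi_diff)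
  ultimately show ?thesis by (simp add: jtheta_def)
qed

text \<open>The shift moves one factor from the first q-Pochhammer symbol to the second, and the
  quotient of these factors is \<open>- expi (- z)\<close>.\<close>

lemma jtheta_plus_tau:
  assumes "Im \<tau> > 0"
  shows "jtheta (z + \<tau>) \<tau> = - expi (- z - \<tau> / 2) * jtheta z \<tau>"
proof -
  note q = norm_expi_less_1[OF assms]
  have 1: "qpoch (expi (- z)) (expi \<tau>) = (1 - expi (- z)) * qpoch (expi (\<tau> - z)) (expi \<tau>)"
    by (subst qpoch_unfold[OF q]) (simp add: expi_add [symmetric])
  have 2: "qpoch (expi z) (expi \<tau>) = (1 - expi z) * qpoch (expi (z + \<tau>)) (expi \<tau>)"
    by (subst qpoch_unfold[OF q]) (simp add: expi_add [symmetric])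
  have 3: "1 - expi (- z) = - expi (- z) * (1 - expi z)"
    by (simp add: expi_minus field_simps)
  have 4: "expi (\<tau> / 12 - (z + \<tau>) / 2) * expi (- z) = expi (- z - \<tau> / 2) * expi (\<tau> / 12 - z / 2)"
    unfolding expi_add [symmetric] by (rule arg_cong[of _ _ expi]) (simp add: field_simps)
  have "jtheta (z + \<tau>) \<tau> = expi (\<tau> / 12 - (z + \<tau>) / 2) * qpoch (expi (z + \<tau>)) (expi \<tau>) * qpoch (expi (- z)) (expi \<tau>)"
    by (simp add: jtheta_def)
  also have "\<dots> = - (expi (\<tau> / 12 - (z + \<tau>) / 2) * expi (- z)) * (1 - expi z) *
      qpoch (expi (z + \<tau>)) (expi \<tau>) * qpoch (expi (\<tau> - z)) (expi \<tau>)"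
    unfolding 1 3 by simp
  also have "\<dots> = - expi (- z - \<tau> / 2) * jtheta z \<tau>"
    unfolding 4 jtheta_def 2 by simp
  finally show ?thesis .
qed

lemma jtheta_minus:
  assumes "Im \<tau> > 0"
  shows "jtheta (- z) \<tau> = - jtheta z \<tau>"
proof -
  note q = norm_expi_less_1[OF assms]
  have 1: "qpoch (expi (- z)) (expi \<tau>) = (1 - expi (- z)) * qpoch (expi (\<tau> - z)) (expi \<tau>)"
    by (subst qpoch_unfold[OF q]) (simp add: expi_add [symmetric])
  have 2: "qpoch (expi z) (expi \<tau>) = (1 - expi z) * qpoch (expi (\<tau> + z)) (expi \<tau>)"
    by (subst qpoch_unfold[OF q]) (simp add: expi_add [symmetric] add_ac)
  have 3: "1 - expi (- z) = - expi (- z) * (1 - expi z)"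
    by (simp add: expi_minus field_simps)
  have 4: "expi (\<tau> / 12 + z / 2) * expi (- z) = expi (\<tau> / 12 - z / 2)"
    by (simp add: expi_add [symmetric] field_simps)
  have "jtheta (- z) \<tau> = - (expi (\<tau> / 12 + z / 2) * expi (- z)) * (1 - expi z) *
      qpoch (expi (\<tau> + z)) (expi \<tau>) * qpoch (expi (\<tau> - z)) (expi \<tau>)"
    by (simp add: jtheta_def 1 3)
  also have "\<dots> = - jtheta z \<tau>"
    unfolding 4 jtheta_def 2 by simp
  finally show ?thesis .
qed

lemma jtheta_minus_tau:
  assumes "Im \<tau> > 0"
  shows "jtheta (z - \<tau>) \<tau> = - expi (z - \<tau> / 2) * jtheta z \<tau>"
proof -
  have "jtheta z \<tau> = - expi (- (z - \<tau>) - \<tau> / 2) * jtheta (z - \<tau>) \<tau>"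
    using jtheta_plus_tau[OF assms, of "z - \<tau>"] by simp
  hence "- expi (z - \<tau> / 2) * jtheta z \<tau> = 
    (expi (z - \<tau> / 2) * expi (- (z - \<tau>) - \<tau> / 2)) * jtheta (z - \<tau>) \<tau>"
    by simp
  also have "expi (z - \<tau> / 2) * expi (- (z - \<tau>) - \<tau> / 2) = 1"
    by (simp add: expi_add [symmetric] field_simps)
  finally show ?thesis by simp
qed

lemma jtheta_eq_0_iff:
  assumes "Im \<tau> > 0"
  shows "jtheta z \<tau> = 0 \<longleftrightarrow> (\<exists>m n :: int. z = of_int m + of_int n * \<tau>)"
proof -
  note q = norm_expi_less_1[OF assms]
  have "jtheta z \<tau> = 0 \<longleftrightarrow> (\<exists>n::nat. expi (z + of_nat n * \<tau>) = 1) \<or> (\<exists>n::nat. expi (\<tau> - z + of_nat n * \<tau>) = 1)"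
    by (simp add: jtheta_def qpoch_eq_0_iff[OF q] expi_power expi_add)
  also have "\<dots> \<longleftrightarrow> (\<exists>m n :: int. z = of_int m + of_int n * \<tau>)"
  proof safe
    fix n :: nat assume "expi (z + of_nat n * \<tau>) = 1"
    then obtain m :: int where "z + of_nat n * \<tau> = of_int m"
      by (auto simp: expi_eq_1_iff)
    hence "z = of_int m + of_int (- int n) * \<tau>" by (simp add: algebra_simps)
    thus "\<exists>m n :: int. z = of_int m + of_int n * \<tau>" by blast
  next
    fix n :: nat assume "expi (\<tau> - z + of_nat n * \<tau>) = 1"
    then obtain m :: int where "\<tau> - z + of_nat n * \<tau> = of_int m"
      by (auto simp: expi_eq_1_iff)
    hence "z = of_int (- m) + of_int (int n + 1) * \<tau>" by (simp add: algebra_simps)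
    thus "\<exists>m n :: int. z = of_int m + of_int n * \<tau>" by blast
  next
    fix m n :: int
    assume *: "\<nexists>k::nat. expi (\<tau> - (of_int m + of_int n * \<tau>) + of_nat k * \<tau>) = 1"
    show "\<exists>k::nat. expi (of_int m + of_int n * \<tau> + of_nat k * \<tau>) = 1"
    \<comment> \<open>Lattice points with n <= 0 are zeros of the first symbol, those with n > 0 of
      the second.\<close>
    proof (cases "n \<le> 0")
      case True
      hence "of_int m + of_int n * \<tau> + of_nat (nat (- n)) * \<tau> = of_int m"
        by simp
      thus ?thesis using expi_of_int by metis
    next
      case False
      hence "\<tau> - (of_int m + of_int n * \<tau>) + of_nat (nat (n - 1)) * \<tau> = of_int (- m)"
        by (simp add: algebra_simps)
      with * show ?thesis using expi_of_int by metis
    qed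
  qed
  finally show ?thesis .
qed

lemma holomorphic_on_jtheta:
  assumes "open A" "f holomorphic_on A" "g holomorphic_on A" "\<And>t. t \<in> A \<Longrightarrow> Im (g t) > 0"
  shows "(\<lambda>t. jtheta (f t) (g t)) holomorphic_on A"
  unfolding jtheta_def
  by (intro holomorphic_intros holomorphic_on_qpoch assms norm_expi_less_1) auto

lemma holomorphic_on_siegel:
  assumes "open A" "f holomorphic_on A" "\<And>t. t \<in> A \<Longrightarrow> Im (f t) > 0"
  shows "(\<lambda>t. siegel u v (f t)) holomorphic_on A"
  unfolding siegel_def
  by (intro holomorphic_intros holomorphic_on_jtheta assms) auto

lemma eta_sq_nonzero:
  assumes "Im \<tau> > 0"
  shows "eta_sq \<tau> \<noteq> 0"
proof -
  note q = norm_expi_less_1[OF assms]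
  have "expi \<tau> * expi \<tau> ^ n \<noteq> 1" for n
  proof
    assume "expi \<tau> * expi \<tau> ^ n = 1"
    hence "norm (expi \<tau> ^ Suc n) = 1" by simp
    hence "norm (expi \<tau>) ^ Suc n = 1" unfolding norm_power .
    moreover have "norm (expi \<tau>) ^ Suc n < 1" using q by (subst power_less_one_iff) auto
    ultimately show False by simp
  qed
  thus ?thesis by (auto simp: eta_sq_def qpoch_eq_0_iff[OF q])
qed

lemma jtheta_0 [simp]: "Im \<tau> > 0 \<Longrightarrow> jtheta 0 \<tau> = 0"
  using jtheta_minus[of \<tau> 0] by simp

text \<open>The zero at 0 comes from the single factor \<open>1 - expi z\<close>, and the remaining
  product equals \<open>eta_sq \<tau>\<close> there.\<close>

lemma jtheta_has_field_derivative_0: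
  assumes "Im \<tau> > 0"
  shows "((\<lambda>z. jtheta z \<tau>) has_field_derivative (- 2 * of_real pi * \<i> * eta_sq \<tau>)) (at 0)"
proof -
  note q = norm_expi_less_1[OF assms]
  define R where "R = (\<lambda>z. expi (\<tau> / 12 - z / 2) * qpoch (expi (z + \<tau>)) (expi \<tau>) * qpoch (expi (\<tau> - z)) (expi \<tau>))"
  have eq: "jtheta z \<tau> = (1 - expi z) * R z" for z
    unfolding jtheta_def R_def by (subst qpoch_unfold[OF q]) (simp add: expi_add [symmetric])
  have R0: "R 0 = eta_sq \<tau>" by (simp add: R_def eta_sq_def power2_eq_square)
  have "R holomorphic_on UNIV"
    unfolding R_def by (intro holomorphic_intros holomorphic_on_qpoch q) auto
  hence "(R has_field_derivative deriv R 0) (at 0)"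
    by (intro holomorphic_derivI[of _ UNIV]) auto
  hence "((\<lambda>z. (1 - expi z) * R z) has_field_derivative
      ((1 - expi 0) * deriv R 0 + (- 2 * of_real pi * \<i>) * R 0)) (at 0)"
    unfolding expi_def by (auto intro!: derivative_eq_intros)
  thus ?thesis by (simp add: eq R0)
qed

lemma siegel_minus:
  assumes "Im \<tau> > 0"
  shows "siegel (- u) (- v) \<tau> = - siegel u v \<tau>"
proof -
  have *: "- u * \<tau> + - v = - (u * \<tau> + v)" by simp
  show ?thesis unfolding siegel_def * by (simp only: jtheta_minus[OF assms] minus_mult_minus) simp
qed

lemma siegel_plus_1_right: "siegel u (v + 1) \<tau> = - expi (u / 2) * siegel u v \<tau>"
proof -
  have "expi (u * (u * \<tau> + (v + 1)) / 2) = expi (u / 2) * expi (u * (u * \<tau> + v) / 2)"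
    by (simp add: expi_add [symmetric] field_simps)
  thus ?thesis
    unfolding siegel_def using jtheta_plus_1[of "u * \<tau> + v"] by (simp add: add_ac)
qed

text \<open>The exponential prefactor of \<open>siegel\<close> absorbs the dependence on \<tau> of
  the quasi-periodicity factor, so that only a constant remains.\<close>

lemma siegel_plus_1_left:
  assumes "Im \<tau> > 0"
  shows "siegel (u + 1) v \<tau> = - expi (- v / 2) * siegel u v \<tau>"
proof -
  define z where "z = u * \<tau> + v"
  have z: "(u + 1) * \<tau> + v = z + \<tau>" by (simp add: z_def algebra_simps)
  have "(u + 1) * (z + \<tau>) / 2 + (- z - \<tau> / 2) = - v / 2 + u * z / 2"
    by (simp add: z_def field_simps)
  hence "expi ((u + 1) * (z + \<tau>) / 2) * expi (- z - \<tau> / 2) = expi (- v / 2) * expi (u * z / 2)"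
    by (metis expi_add)
  thus ?thesis
    unfolding siegel_def z z_def [symmetric] jtheta_plus_tau[OF assms] by simp
qed

lemma jtheta_plus_of_int_right: "jtheta z (\<tau> + of_int n) = expi (of_int n / 12) * jtheta z \<tau>"
proof -
  have "expi (\<tau> + of_int n) = expi \<tau>" "expi (\<tau> + of_int n - z) = expi (\<tau> - z)"
    by (simp_all add: expi_add expi_diff)
  moreover have "expi ((\<tau> + of_int n) / 12 - z / 2) = expi (of_int n / 12) * expi (\<tau> / 12 - z / 2)"
    unfolding expi_add [symmetric] by (rule arg_cong[of _ _ expi]) (simp add: field_simps)
  ultimately show ?thesis by (simp add: jtheta_def)
qed

lemma siegel_plus_of_int: "siegel u v (\<tau> + of_int n) = expi (of_int n / 12) * siegel u (v + of_int n * u) \<tau>"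
proof -
  have *: "u * (\<tau> + of_int n) + v = u * \<tau> + (v + of_int n * u)" by (simp add: algebra_simps)
  show ?thesis unfolding siegel_def * by (simp only: jtheta_plus_of_int_right mult_ac)
qed

section \<open>Inversion\<close>

text \<open>Quasi-periodicity carries the zero of \<open>\<psi>\<close> at 0 to every lattice point,
  where it cancels the simple zero of the theta function.\<close>

lemma quasi_periodic_eq_mult_jtheta:
  fixes \<psi> :: "complex \<Rightarrow> complex"
  assumes \<tau>: "Im \<tau> > 0" and holo: "\<psi> holomorphic_on UNIV"
    and per1: "\<And>z. \<psi> (z + 1) = - \<psi> z"
    and per\<tau>: "\<And>z. \<psi> (z + \<tau>) = - expi (- z - \<tau> / 2) * \<psi> z"
    and zero: "\<psi> 0 = 0"
  shows "\<exists>C. \<forall>z. \<psi> z = C * jtheta z \<tau>"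
proof -
  \<comment> \<open>The extension of \<open>\<psi> / jtheta\<close> to the lattice points is elliptic and entire.\<close>
  define \<Lambda> where "\<Lambda> = {z. \<exists>m n :: int. z = of_int m + of_int n * \<tau>}"
  define \<phi> where "\<phi> = (\<lambda>z. jtheta z \<tau>)"
  have \<phi>_0_iff: "\<phi> z = 0 \<longleftrightarrow> z \<in> \<Lambda>" for z
    by (simp add: \<phi>_def \<Lambda>_def jtheta_eq_0_iff[OF \<tau>])
  define d where "d = - 2 * of_real pi * \<i> * eta_sq \<tau>"
  have d: "d \<noteq> 0" "(\<phi> has_field_derivative d) (at 0)"
    using eta_sq_nonzero[OF \<tau>] jtheta_has_field_derivative_0[OF \<tau>] by (simp_all add: d_def \<phi>_def)
  \<comment> \<open>The limit of \<open>\<psi> / \<phi>\<close> at 0 as a quotient of derivatives;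
    by periodicity it is the right value at every lattice point.\<close>
  define c0 where "c0 = deriv \<psi> 0 / d"
  define h where "h = (\<lambda>z. if z \<in> \<Lambda> then c0 else \<psi> z / \<phi> z)"
  have \<Lambda>1: "z + 1 \<in> \<Lambda> \<longleftrightarrow> z \<in> \<Lambda>" for z
    unfolding \<phi>_0_iff [symmetric] by (simp add: \<phi>_def jtheta_plus_1)
  have \<Lambda>\<tau>: "z + \<tau> \<in> \<Lambda> \<longleftrightarrow> z \<in> \<Lambda>" for z
    unfolding \<phi>_0_iff [symmetric] by (simp add: \<phi>_def jtheta_plus_tau[OF \<tau>])
  have h1: "h (z + 1) = h z" for z
    by (simp add: h_def \<Lambda>1 per1 \<phi>_def jtheta_plus_1)
  have h\<tau>: "h (z + \<tau>) = h z" for z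
    by (simp add: h_def \<Lambda>\<tau> per\<tau> \<phi>_def jtheta_plus_tau[OF \<tau>])
  have hm: "h (z + of_int m) = h z" for z m
  proof (induction m rule: int_induct[of _ 0])
    case (step1 i) thus ?case using h1[of "z + of_int i"] by (simp add: add_ac)
  next
    case (step2 i) thus ?case using h1[of "z + of_int (i - 1)"] by (simp add: algebra_simps)
  qed auto
  have hn: "h (z + of_int n * \<tau>) = h z" for z n
  proof (induction n rule: int_induct[of _ 0])
    case (step1 i) thus ?case using h\<tau>[of "z + of_int i * \<tau>"] by (simp add: algebra_simps)
  next
    case (step2 i) thus ?case using h\<tau>[of "z + of_int (i - 1) * \<tau>"] by (simp add: algebra_simps)
  qed auto
  \<comment> \<open>\<open>t\<close> and \<open>s\<close> are real coordinates with respect to the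
    basis 1, \<tau>. The open parallelogram \<open>U\<close> below meets the lattice only in
    0.\<close>
  define s where "s = (\<lambda>z. Im z / Im \<tau>)"
  define t where "t = (\<lambda>z. Re z - s z * Re \<tau>)"
  have st: "z = of_real (t z) + of_real (s z) * \<tau>" for z
    using \<tau> by (simp add: complex_eq_iff s_def t_def)
  have s_lat: "s (z - of_int m - of_int n * \<tau>) = s z - of_int n" for z m n
    using \<tau> by (simp add: s_def field_simps)
  have t_lat: "t (z - of_int m - of_int n * \<tau>) = t z - of_int m" for z m n
    unfolding t_def s_lat by (simp add: algebra_simps)
  have cont_st: "continuous_on UNIV s" "continuous_on UNIV t"
    unfolding s_def t_def by (auto intro!: continuous_intros simp: \<tau> less_imp_neq[OF \<tau>, symmetric])
  define U where "U = {z. \<bar>s z\<bar> < 1 \<and> \<bar>t z\<bar> < 1}"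
  have "open U"
    unfolding U_def by (intro open_Collect_conj open_Collect_less continuous_intros cont_st)
  have U_\<Lambda>: "z = 0" if "z \<in> U" "z \<in> \<Lambda>" for z
  proof -
    from that obtain m n :: int where mn: "z = of_int m + of_int n * \<tau>" by (auto simp: \<Lambda>_def)
    have "s z = of_int n" "t z = of_int m" 
      using s_lat[of z m n] t_lat[of z m n] by (simp_all add: mn s_def t_def)
    with that(1) have "\<bar>real_of_int n\<bar> < 1" "\<bar>real_of_int m\<bar> < 1" by (auto simp: U_def)
    hence "n = 0" "m = 0" by linarith+
    thus "z = 0" by (simp add: mn)
  qed
  have "0 \<in> U" "0 \<in> \<Lambda>" by (auto simp: U_def s_def t_def \<Lambda>_def intro!: exI[of _ 0])
  have lim: "h \<midarrow>0\<rightarrow> h 0"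
  proof -
    have "(\<psi> has_field_derivative deriv \<psi> 0) (at 0)"
      using holo by (intro holomorphic_derivI[of _ UNIV]) auto
    hence "(\<lambda>z. \<psi> z / z) \<midarrow>0\<rightarrow> deriv \<psi> 0"
      using zero by (simp add: has_field_derivative_iff)
    moreover have "(\<lambda>z. \<phi> z / z) \<midarrow>0\<rightarrow> d"
      using d(2) \<open>0 \<in> \<Lambda>\<close> \<phi>_0_iff[of 0] by (simp add: has_field_derivative_iff)
    ultimately have "(\<lambda>z. (\<psi> z / z) / (\<phi> z / z)) \<midarrow>0\<rightarrow> c0"
      unfolding c0_def using d(1) by (intro tendsto_intros)
    moreover have "eventually (\<lambda>z. (\<psi> z / z) / (\<phi> z / z) = h z) (at 0)"
    proof -
      have "eventually (\<lambda>z. z \<in> U - {0}) (at 0)"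
        using \<open>open U\<close> \<open>0 \<in> U\<close> by (intro eventually_at_in_open) auto
      thus ?thesis
        by eventually_elim (use U_\<Lambda> in \<open>auto simp: h_def\<close>)
    qed
    ultimately have "h \<midarrow>0\<rightarrow> c0" by (rule Lim_transform_eventually)
    moreover have "h 0 = c0" using \<open>0 \<in> \<Lambda>\<close> by (simp add: h_def)
    ultimately show ?thesis by simp
  qed
  have hol_U: "h holomorphic_on U"
  proof (rule no_isolated_singularity'[where K = "{0}"])
    show "(h \<longlongrightarrow> h z) (at z within U)" if "z \<in> {0}" for z
      using lim that by (auto intro: tendsto_within_subset)
    have "(\<lambda>z. \<psi> z / \<phi> z) holomorphic_on (U - {0})"
      using U_\<Lambda> \<phi>_0_iff unfolding \<phi>_def
      by (intro holomorphic_intros holomorphic_on_jtheta holomorphic_on_subset[OF holo]) 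
         (auto simp: \<tau> \<open>open U\<close>)
    thus "h holomorphic_on (U - {0})"
      by (rule holomorphic_transform) (use U_\<Lambda> in \<open>auto simp: h_def\<close>)
  qed (use \<open>open U\<close> in auto)
  \<comment> \<open>Rounding the coordinates moves any point by a lattice vector into the closed
    parallelogram with coordinates at most 1/2, which lies in \<open>U\<close>.\<close>
  define red where "red = (\<lambda>z. z - of_int (round (t z)) - of_int (round (s z)) * \<tau>)"
  have red: "\<bar>s (red z)\<bar> \<le> 1 / 2" "\<bar>t (red z)\<bar> \<le> 1 / 2" for z
    using of_int_round_abs_le[of "s z"] of_int_round_abs_le[of "t z"]
    by (simp_all add: red_def s_lat t_lat abs_minus_commute)
  have hred: "h z = h (z - of_int m - of_int n * \<tau>)" for z m n
    using hm[of "z - of_int m - of_int n * \<tau>" m] hn[of "z - of_int n * \<tau>" n] by (simp add: algebra_simps)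
  have "h holomorphic_on UNIV"
  proof -
    have "h field_differentiable (at w)" for w
    proof -
      define l where "l = of_int (round (t w)) + of_int (round (s w)) * \<tau>"
      have "w - l \<in> U" using red[of w] by (auto simp: U_def red_def l_def algebra_simps)
      hence "h field_differentiable (at (w - l))"
        using hol_U \<open>open U\<close> by (simp add: holomorphic_on_def at_within_open_NO_MATCH)
      hence "(h \<circ> (\<lambda>z. z - l)) field_differentiable (at w)"
        by (intro field_differentiable_compose) (auto intro!: derivative_intros field_differentiable_diff)
      also have "h \<circ> (\<lambda>z. z - l) = h"
        using hred by (auto simp: fun_eq_iff l_def algebra_simps)
      finally show ?thesis .
    qed
    thus ?thesis by (simp add: holomorphic_on_def)
  qed
  moreover have "bounded (range h)"
  proof -
    define P where "P = (\<lambda>(x, y). of_real x + of_real y * \<tau>) ` ({- 1 / 2..1 / 2 :: real} \<times> {- 1 / 2..1 / 2 :: real})"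
    have "compact P"
      unfolding P_def by (intro compact_continuous_image compact_Times)
        (auto intro!: continuous_intros simp: case_prod_unfold)
    have "continuous_on P h"
      using \<open>h holomorphic_on UNIV\<close> holomorphic_on_imp_continuous_on continuous_on_subset by blast
    with \<open>compact P\<close> have "bounded (h ` P)"
      by (intro compact_imp_bounded compact_continuous_image)
    moreover have "range h \<subseteq> h ` P"
    proof safe
      fix z
      have "h z = h (red z)" unfolding red_def by (rule hred)
      moreover have "red z \<in> P"
        unfolding P_def using st[of "red z"] red[of z] by (intro image_eqI[of _ _ "(t (red z), s (red z))"]) auto
      ultimately show "h z \<in> h ` P" by blast
    qed
    ultimately show ?thesis using bounded_subset by blast
  qed
  ultimately have "h constant_on UNIV" by (rule Liouville_theorem)
  then obtain C where C: "\<And>z. h z = C" by (auto simp: constant_on_def)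
  have "\<psi> z = C * \<phi> z" if "z \<notin> \<Lambda>" for z
    using C[of z] that \<phi>_0_iff[of z] by (auto simp: h_def field_simps)
  moreover have "\<psi> z = 0" if "z \<in> \<Lambda>" for z
  proof -
    from that obtain m n :: int where mn: "z = of_int m + of_int n * \<tau>" by (auto simp: \<Lambda>_def)
    have *: "\<psi> (w + of_int m) = 0 \<longleftrightarrow> \<psi> w = 0" for w m
    proof (induction m rule: int_induct[of _ 0])
      case (step1 i) thus ?case using per1[of "w + of_int i"] by (simp add: add_ac)
    next
      case (step2 i) thus ?case using per1[of "w + of_int (i - 1)"] by (simp add: algebra_simps)
    qed auto
    have **: "\<psi> (of_int n * \<tau>) = 0" for n
    proof (induction n rule: int_induct[of _ 0])
      case (step1 i) thus ?case using per\<tau>[of "of_int i * \<tau>"] by (simp add: algebra_simps)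
    next
      case (step2 i) thus ?case using per\<tau>[of "of_int (i - 1) * \<tau>"] by (simp add: algebra_simps)
    qed (use zero in auto)
    show ?thesis using *[of "of_int n * \<tau>" m] **[of n] by (simp add: mn add_ac)
  qed
  ultimately have "\<psi> z = C * \<phi> z" for z
    using \<phi>_0_iff[of z] by (cases "z \<in> \<Lambda>") auto
  thus ?thesis unfolding \<phi>_def by blast
qed

lemma Im_minus_inverse_pos: "Im \<tau> > 0 \<Longrightarrow> Im (- 1 / \<tau>) > 0"
  by (auto simp: Im_divide power2_eq_square intro!: divide_pos_pos add_nonneg_pos)

text \<open>The constant may still depend on \<tau>, but one constant serves all
  characteristics.\<close>

lemma siegel_inversion_pointwise:
  assumes \<tau>: "Im \<tau> > 0"
  shows "\<exists>C. \<forall>u v. siegel u v (- 1 / \<tau>) = C * siegel v (- u) \<tau>"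
proof -
  note \<tau>' = Im_minus_inverse_pos[OF \<tau>]
  have [simp]: "\<tau> \<noteq> 0" using \<tau> by auto
  \<comment> \<open>In z, the quasi-periods of the theta factor are 1 and \<tau> with interchanged
    roles; the Gaussian factor gives them the multipliers that \<open>jtheta z \<tau>\<close>
    has.\<close>
  define \<psi> where "\<psi> = (\<lambda>z. expi (- z\<^sup>2 / (2 * \<tau>)) * jtheta (z / \<tau>) (- 1 / \<tau>))"
  have "\<exists>C. \<forall>z. \<psi> z = C * jtheta z \<tau>"
  proof (rule quasi_periodic_eq_mult_jtheta[OF \<tau>])
    show "\<psi> holomorphic_on UNIV"
      unfolding \<psi>_def using \<tau>'
      by (intro holomorphic_intros holomorphic_on_jtheta) auto
    show "\<psi> 0 = 0" using \<tau>' by (simp add: \<psi>_def)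
    show "\<psi> (z + 1) = - \<psi> z" for z
    proof -
      have *: "(z + 1) / \<tau> = z / \<tau> - (- 1 / \<tau>)" by (simp add: field_simps)
      have "expi (- (z + 1)\<^sup>2 / (2 * \<tau>)) * expi (z / \<tau> - (- 1 / \<tau>) / 2) = expi (- z\<^sup>2 / (2 * \<tau>))"
        unfolding expi_add [symmetric] by (rule arg_cong[of _ _ expi]) (simp add: field_simps power2_eq_square)
      thus ?thesis unfolding \<psi>_def * jtheta_minus_tau[OF \<tau>'] by simp
    qed
    show "\<psi> (z + \<tau>) = - expi (- z - \<tau> / 2) * \<psi> z" for z
    proof -
      have *: "(z + \<tau>) / \<tau> = z / \<tau> + 1" by (simp add: field_simps)
      have "expi (- (z + \<tau>)\<^sup>2 / (2 * \<tau>)) = expi (- z - \<tau> / 2) * expi (- z\<^sup>2 / (2 * \<tau>))"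
        unfolding expi_add [symmetric] by (rule arg_cong[of _ _ expi]) (simp add: field_simps power2_eq_square)
      thus ?thesis unfolding \<psi>_def * jtheta_plus_1 by simp
    qed
  qed
  then obtain C where C: "\<And>z. \<psi> z = C * jtheta z \<tau>" by blast
  have "siegel u v (- 1 / \<tau>) = C * siegel v (- u) \<tau>" for u v
  proof -
    define z where "z = v * \<tau> + (- u)"
    have z: "u * (- 1 / \<tau>) + v = z / \<tau>" by (simp add: z_def field_simps)
    have "expi (v * z / 2) * expi (- z\<^sup>2 / (2 * \<tau>)) = expi (u * (z / \<tau>) / 2)"
      unfolding expi_add [symmetric]
      by (rule arg_cong[of _ _ expi]) (simp add: z_def field_simps power2_eq_square)
    hence "siegel u v (- 1 / \<tau>) = expi (v * z / 2) * \<psi> z"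
      unfolding siegel_def z \<psi>_def by (simp flip: mult.assoc)
    thus ?thesis by (simp add: siegel_def z_def C)
  qed
  thus ?thesis by blast
qed

text \<open>These are the three Siegel functions of level 2, essentially the squared Weber
  functions, whose product is constant. The identity reduces to Euler's (-q; q) (q; q^2) =
  1.\<close>

lemma siegel_half_periods_prod:
  assumes \<tau>: "Im \<tau> > 0"
  shows "siegel 0 (1 / 2) \<tau> * siegel (1 / 2) 0 \<tau> * siegel (1 / 2) (1 / 2) \<tau> = - 2 * \<i> * expi (- 1 / 8)"
proof -
  define q where "q = expi \<tau>"
  define p where "p = expi (\<tau> / 2)"
  have p2: "p ^ 2 = q" by (simp add: p_def q_def expi_power)
  have q: "norm q < 1" "norm (q ^ 2) < 1"
    using norm_expi_less_1[OF \<tau>] by (auto simp: q_def norm_power power_less_one_iff)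
  have e1: "siegel 0 (1 / 2) \<tau> = expi (\<tau> / 12) * (- 2 * \<i>) * qpoch (- q) q ^ 2"
    by (simp add: siegel_def jtheta_def expi_diff qpoch_unfold[OF q(1), of "-1"] power2_eq_square
        flip: q_def)
  have e2: "siegel (1 / 2) 0 \<tau> = expi (- \<tau> / 24) * qpoch p q ^ 2"
  proof -
    have "expi (\<tau> / 8) * expi (\<tau> / 12 - \<tau> / 4) = expi (- \<tau> / 24)"
      unfolding expi_add [symmetric] by (rule arg_cong[of _ _ expi]) (simp add: field_simps)
    thus ?thesis by (simp add: siegel_def jtheta_def power2_eq_square flip: p_def q_def)
  qed
  have e3: "siegel (1 / 2) (1 / 2) \<tau> = expi (- \<tau> / 24) * expi (- 1 / 8) * qpoch (- p) q ^ 2"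
  proof -
    have a: "expi ((1 / 2) * ((1 / 2) * \<tau> + 1 / 2) / 2) * expi (\<tau> / 12 - ((1 / 2) * \<tau> + 1 / 2) / 2) =
        expi (- \<tau> / 24) * expi (- 1 / 8)"
      unfolding expi_add [symmetric] by (rule arg_cong[of _ _ expi]) (simp add: field_simps)
    have b: "expi ((1 / 2) * \<tau> + 1 / 2) = - p" by (simp add: p_def expi_add)
    have "\<tau> - ((1 / 2) * \<tau> + 1 / 2) = \<tau> / 2 - 1 / 2" by simp
    hence c: "expi (\<tau> - ((1 / 2) * \<tau> + 1 / 2)) = - p" by (simp only: p_def expi_diff expi_half) simp
    show ?thesis unfolding siegel_def jtheta_def b c
      using a by (simp only: q_def [symmetric] power2_eq_square mult.assoc [symmetric])
  qed
  have f1: "qpoch p q * qpoch (- p) q = qpoch q (q ^ 2)"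
    using qpoch_mult_minus[OF q(1), of p] by (simp add: p2)
  have f2: "qpoch (- q) q * qpoch q (q ^ 2) = 1"
  proof -
    have "qpoch q q = qpoch q (q ^ 2) * qpoch (q ^ 2) (q ^ 2)"
      using qpoch_split_even_odd[OF q(1), of q] by (simp add: power2_eq_square)
    moreover have "qpoch q q * qpoch (- q) q = qpoch (q ^ 2) (q ^ 2)"
      by (rule qpoch_mult_minus[OF q(1)])
    moreover have "qpoch q q \<noteq> 0"
      using eta_sq_nonzero[OF \<tau>] by (auto simp: eta_sq_def q_def)
    ultimately show ?thesis by (auto simp: field_simps)
  qed
  have ex: "expi (\<tau> / 12) * expi (- \<tau> / 24) * expi (- \<tau> / 24) = 1"
    unfolding expi_add [symmetric] by simp
  hence "siegel 0 (1 / 2) \<tau> * siegel (1 / 2) 0 \<tau> * siegel (1 / 2) (1 / 2) \<tau> =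
      - 2 * \<i> * expi (- 1 / 8) * (qpoch (- q) q * (qpoch p q * qpoch (- p) q)) ^ 2 * 
      (expi (\<tau> / 12) * expi (- \<tau> / 24) * expi (- \<tau> / 24))"
    unfolding e1 e2 e3 by (simp only: power2_eq_square mult_ac)
  also have "\<dots> = - 2 * \<i> * expi (- 1 / 8)"
    using f1 f2 ex by simp
  finally show ?thesis .
qed

lemma siegel_inversion:
  "\<exists>C. C ^ 12 = 1 \<and> (\<forall>\<tau> u v. Im \<tau> > 0 \<longrightarrow> siegel u v (- 1 / \<tau>) = C * siegel v (- u) \<tau>)"
proof -
  define C where "C = (\<lambda>\<tau>. siegel 0 (1 / 2) (- 1 / \<tau>) / siegel (1 / 2) 0 \<tau>)"
  have C_nz: "siegel (1 / 2) 0 \<tau> \<noteq> 0" if "Im \<tau> > 0" for \<tau>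
    using siegel_half_periods_prod[OF that] by auto
  have C: "siegel u v (- 1 / \<tau>) = C \<tau> * siegel v (- u) \<tau>" if "Im \<tau> > 0" for u v \<tau>
    using siegel_inversion_pointwise[OF that] C_nz[OF that] by (auto simp: C_def)
  \<comment> \<open>Inversion permutes the three functions of level 2 up to a sign and a factor
    \<open>\<i>\<close>, so comparing their constant product at \<tau> and at -1/\<tau> fixes the
    cube of \<open>C \<tau>\<close>.\<close>
  have C3: "C \<tau> ^ 3 = \<i>" if \<tau>: "Im \<tau> > 0" for \<tau>
  proof -
    define K where "K = - 2 * \<i> * expi (- 1 / 8)"
    have "K \<noteq> 0" by (simp add: K_def)
    have "siegel 0 (- (1 / 2)) \<tau> = - siegel 0 (1 / 2) \<tau>"
      using siegel_minus[OF \<tau>, of 0 "1 / 2"] by simp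
    moreover have "siegel (1 / 2) (- (1 / 2)) \<tau> = \<i> * siegel (1 / 2) (1 / 2) \<tau>"
      using siegel_plus_1_right[of "1 / 2" "- (1 / 2)" \<tau>] by simp
    moreover have "siegel 0 (1 / 2) (- 1 / \<tau>) * siegel (1 / 2) 0 (- 1 / \<tau>) * siegel (1 / 2) (1 / 2) (- 1 / \<tau>) = K"
      unfolding K_def by (rule siegel_half_periods_prod[OF Im_minus_inverse_pos[OF \<tau>]])
    ultimately have "C \<tau> ^ 3 * (- \<i>) * (siegel 0 (1 / 2) \<tau> * siegel (1 / 2) 0 \<tau> * siegel (1 / 2) (1 / 2) \<tau>) = K"
      using C[OF \<tau>, of 0 "1 / 2"] C[OF \<tau>, of "1 / 2" 0] C[OF \<tau>, of "1 / 2" "1 / 2"]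
      by (simp add: power3_eq_cube mult_ac)
    hence "C \<tau> ^ 3 * (- \<i>) * K = K"
      by (simp only: siegel_half_periods_prod[OF \<tau>] K_def)
    with \<open>K \<noteq> 0\<close> have "C \<tau> ^ 3 * (- \<i>) = 1" by (metis mult_cancel_right2)
    have "C \<tau> ^ 3 = (C \<tau> ^ 3 * (- \<i>)) * \<i>" by (simp add: mult.assoc)
    also have "\<dots> = \<i>" by (subst \<open>_ = 1\<close>) simp
    finally show ?thesis .
  qed
  \<comment> \<open>A continuous function on a connected set with values among the finitely many
    cube roots of \<open>\<i>\<close> is constant.\<close>
  have "continuous_on {\<tau>. Im \<tau> > 0} C"
  proof -
    have "C holomorphic_on {\<tau>. Im \<tau> > 0}"
      unfolding C_def
      by (intro holomorphic_intros holomorphic_on_siegel)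
         (use C_nz Im_minus_inverse_pos in \<open>auto simp: open_halfspace_Im_gt\<close>)
    thus ?thesis by (rule holomorphic_on_imp_continuous_on)
  qed
  hence "connected (C ` {\<tau>. Im \<tau> > 0})"
    by (intro connected_continuous_image convex_connected convex_halfspace_Im_gt)
  moreover have "finite (C ` {\<tau>. Im \<tau> > 0})"
  proof (rule finite_subset)
    show "C ` {\<tau>. Im \<tau> > 0} \<subseteq> {z. z ^ 3 = \<i>}" using C3 by auto
    show "finite {z::complex. z ^ 3 = \<i>}" by (rule finite_nth_roots) auto
  qed
  moreover have "C \<i> \<in> C ` {\<tau>. Im \<tau> > 0}" by (rule imageI) simp
  ultimately obtain c where "C ` {\<tau>. Im \<tau> > 0} = {c}"
    using connected_finite_iff_sing[of "C ` {\<tau>. Im \<tau> > 0}"] by (metis empty_iff)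
  hence c: "C \<tau> = c" if "Im \<tau> > 0" for \<tau> using that by blast
  have "c ^ 12 = (C \<i> ^ 3) ^ 4" using c[of \<i>] by (simp flip: power_mult)
  also have "\<dots> = 1" by (simp add: C3)
  finally show ?thesis using C c by metis
qed

section \<open>Covariance under the modular group\<close>

lemma Im_moebius_pos:
  fixes a b c d :: int
  assumes "Im \<tau> > 0" "a * d - b * c = 1"
  shows "of_int c * \<tau> + of_int d \<noteq> 0"
        "Im ((of_int a * \<tau> + of_int b) / (of_int c * \<tau> + of_int d)) > 0"
proof -
  show nz: "of_int c * \<tau> + of_int d \<noteq> 0"
    using assms by (auto simp: complex_eq_iff)
  have "Im ((of_int a * \<tau> + of_int b) / (of_int c * \<tau> + of_int d)) =
        of_int (a * d - b * c) * Im \<tau> / norm (of_int c * \<tau> + of_int d) ^ 2"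
    by (simp add: Im_divide cmod_power2 algebra_simps)
  thus "Im ((of_int a * \<tau> + of_int b) / (of_int c * \<tau> + of_int d)) > 0"
    using assms nz by simp
qed

text \<open>The matrix acts on (u, v) as on a row vector, from the right, and \<omega> depends on
  the matrix alone. The entries are separate arguments so that Euclid's algorithm can operate on
  them.\<close>

definition siegel_covariant :: "int \<Rightarrow> int \<Rightarrow> int \<Rightarrow> int \<Rightarrow> bool" where
  "siegel_covariant a b c d \<longleftrightarrow> (\<exists>\<omega>. \<omega> ^ 12 = 1 \<and> (\<forall>u v \<tau>. Im \<tau> > 0 \<longrightarrow>
     siegel u v ((of_int a * \<tau> + of_int b) / (of_int c * \<tau> + of_int d)) =
     \<omega> * siegel (u * of_int a + v * of_int c) (u * of_int b + v * of_int d) \<tau>))"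

lemma siegel_covariant_inversion:
  assumes "siegel_covariant a b c d" "a * d - b * c = 1"
  shows "siegel_covariant (- c) (- d) a b"
proof -
  obtain \<omega> where \<omega>: "\<omega> ^ 12 = 1" "\<And>u v \<tau>. Im \<tau> > 0 \<Longrightarrow>
     siegel u v ((of_int a * \<tau> + of_int b) / (of_int c * \<tau> + of_int d)) =
     \<omega> * siegel (u * of_int a + v * of_int c) (u * of_int b + v * of_int d) \<tau>"
    using assms(1) unfolding siegel_covariant_def by blast
  obtain C where C: "C ^ 12 = 1"
     "\<And>\<tau> u v. Im \<tau> > 0 \<Longrightarrow> siegel u v (- 1 / \<tau>) = C * siegel v (- u) \<tau>"
    using siegel_inversion by blast
  show ?thesis
    unfolding siegel_covariant_def
  proof (intro exI[of _ "C * \<omega>"] conjI allI impI)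
    show "(C * \<omega>) ^ 12 = 1" by (simp add: power_mult_distrib C \<omega>)
  next
    fix u v \<tau> :: complex assume \<tau>: "Im \<tau> > 0"
    have *: "(of_int (- c) * \<tau> + of_int (- d)) / (of_int a * \<tau> + of_int b) =
          - 1 / ((of_int a * \<tau> + of_int b) / (of_int c * \<tau> + of_int d))"
      by simp
    show "siegel u v ((of_int (- c) * \<tau> + of_int (- d)) / (of_int a * \<tau> + of_int b)) =
       C * \<omega> * siegel (u * of_int (- c) + v * of_int a) (u * of_int (- d) + v * of_int b) \<tau>"
      unfolding * C(2)[OF Im_moebius_pos(2)[OF \<tau> assms(2)]] \<omega>(2)[OF \<tau>]
      by (simp add: add_ac)
  qed
qed

lemma siegel_covariant_translation:
  assumes "siegel_covariant a b c d" "a * d - b * c = 1"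
  shows "siegel_covariant (a + n * c) (b + n * d) c d"
proof -
  obtain \<omega> where \<omega>: "\<omega> ^ 12 = 1" "\<And>u v \<tau>. Im \<tau> > 0 \<Longrightarrow>
     siegel u v ((of_int a * \<tau> + of_int b) / (of_int c * \<tau> + of_int d)) =
     \<omega> * siegel (u * of_int a + v * of_int c) (u * of_int b + v * of_int d) \<tau>"
    using assms(1) unfolding siegel_covariant_def by blast
  show ?thesis
    unfolding siegel_covariant_def
  proof (intro exI[of _ "expi (of_int n / 12) * \<omega>"] conjI allI impI)
    show "(expi (of_int n / 12) * \<omega>) ^ 12 = 1" by (simp add: power_mult_distrib \<omega> expi_power)
  next
    fix u v \<tau> :: complex assume \<tau>: "Im \<tau> > 0"
    have *: "(of_int (a + n * c) * \<tau> + of_int (b + n * d)) / (of_int c * \<tau> + of_int d) =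
          (of_int a * \<tau> + of_int b) / (of_int c * \<tau> + of_int d) + of_int n"
      using Im_moebius_pos(1)[OF \<tau> assms(2)] by (simp add: field_simps)
    show "siegel u v ((of_int (a + n * c) * \<tau> + of_int (b + n * d)) / (of_int c * \<tau> + of_int d)) =
       expi (of_int n / 12) * \<omega> * siegel (u * of_int (a + n * c) + v * of_int c) (u * of_int (b + n * d) + v * of_int d) \<tau>"
      unfolding * siegel_plus_of_int \<omega>(2)[OF \<tau>]
      by (simp add: algebra_simps)
  qed
qed

lemma siegel_covariant_id: "siegel_covariant 1 0 0 1" "siegel_covariant (- 1) 0 0 (- 1)"
proof -
  show "siegel_covariant 1 0 0 1" by (auto simp: siegel_covariant_def intro!: exI[of _ 1])
  show "siegel_covariant (- 1) 0 0 (- 1)" 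
    by (auto simp: siegel_covariant_def siegel_minus intro!: exI[of _ "-1"])
qed

lemma siegel_covariant:
  assumes "a * d - b * c = 1"
  shows "siegel_covariant a b c d"
  using assms
proof (induction "nat \<bar>c\<bar>" arbitrary: a b c d rule: less_induct) \<comment> \<open>Euclid's algorithm on the bottom row\<close>
  case less
  show ?case
  proof (cases "c = 0")
    case True
    with less.prems have "a = 1 \<and> d = 1 \<or> a = -1 \<and> d = -1"
      by (auto simp: zmult_eq_1_iff)
    thus ?thesis
      using siegel_covariant_translation[OF siegel_covariant_id(1), of b]
            siegel_covariant_translation[OF siegel_covariant_id(2), of "- b"] True by auto
  next
    case False
    define n where "n = a div c"
    have a: "a = a mod c + n * c" by (simp add: n_def)
    have det: "c * (n * d - b) - d * (- (a mod c)) = 1"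
    proof -
      have "c * (n * d - b) - d * (- (a mod c)) = d * (a mod c + n * c) - b * c" by (simp add: algebra_simps)
      thus ?thesis using less.prems a by (simp add: mult.commute)
    qed
    \<comment> \<open>Inversion turns this matrix into the one with rows
      \<open>a mod c, b - n * d\<close> and \<open>c, d\<close>; translation by \<open>n\<close>
      then restores the top row \<open>a, b\<close>.\<close>
    have "siegel_covariant c d (- (a mod c)) (n * d - b)"
      by (intro less.hyps det) (use False in \<open>simp add: abs_mod_less\<close>)
    from siegel_covariant_inversion[OF this det] 
    have "siegel_covariant (a mod c) (b - n * d) c d" by simp
    moreover have "a mod c * d - (b - n * d) * c = 1"
      using det by (simp add: algebra_simps)
    ultimately have "siegel_covariant (a mod c + n * c) (b - n * d + n * d) c d"
      by (rule siegel_covariant_translation)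
    thus ?thesis using a by simp
  qed
qed

text \<open>Put u = 0 and differentiate in v at 0. The inner derivative produces the factor of
  automorphy, and \<omega> is the same as for the Siegel functions.\<close>

lemma siegel_eta_sq_transform:
  fixes a b c d :: int
  assumes "a * d - b * c = 1"
  obtains \<omega> where "\<omega> ^ 12 = 1"
    "\<And>u v \<tau>. Im \<tau> > 0 \<Longrightarrow> siegel u v ((of_int a * \<tau> + of_int b) / (of_int c * \<tau> + of_int d)) =
       \<omega> * siegel (u * of_int a + v * of_int c) (u * of_int b + v * of_int d) \<tau>"
    "\<And>\<tau>. Im \<tau> > 0 \<Longrightarrow> eta_sq ((of_int a * \<tau> + of_int b) / (of_int c * \<tau> + of_int d)) =
       \<omega> * (of_int c * \<tau> + of_int d) * eta_sq \<tau>"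
proof -
  obtain \<omega> where \<omega>: "\<omega> ^ 12 = 1" "\<And>u v \<tau>. Im \<tau> > 0 \<Longrightarrow>
     siegel u v ((of_int a * \<tau> + of_int b) / (of_int c * \<tau> + of_int d)) =
     \<omega> * siegel (u * of_int a + v * of_int c) (u * of_int b + v * of_int d) \<tau>"
    using siegel_covariant[OF assms] unfolding siegel_covariant_def by blast
  have "eta_sq ((of_int a * \<tau> + of_int b) / (of_int c * \<tau> + of_int d)) =
       \<omega> * (of_int c * \<tau> + of_int d) * eta_sq \<tau>" if \<tau>: "Im \<tau> > 0" for \<tau>
  proof -
    define j where "j = of_int c * \<tau> + of_int d"
    define \<tau>' where "\<tau>' = (of_int a * \<tau> + of_int b) / j"
    have \<tau>': "Im \<tau>' > 0" unfolding \<tau>'_def j_def by (rule Im_moebius_pos[OF \<tau> assms])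
    have eq: "jtheta v \<tau>' = \<omega> * (expi (v * of_int c * (v * j) / 2) * jtheta (v * j) \<tau>)" for v
    proof -
      have "v * of_int c * \<tau> + v * of_int d = v * j" by (simp add: j_def algebra_simps)
      thus ?thesis using \<omega>(2)[OF \<tau>, of 0 v] by (simp add: siegel_def \<tau>'_def j_def)
    qed
    have "((\<lambda>v. jtheta v \<tau>') has_field_derivative (- 2 * of_real pi * \<i> * eta_sq \<tau>')) (at 0)"
      by (rule jtheta_has_field_derivative_0[OF \<tau>'])
    moreover have "((\<lambda>v. \<omega> * (expi (v * of_int c * (v * j) / 2) * jtheta (v * j) \<tau>)) has_field_derivative
        (\<omega> * (- 2 * of_real pi * \<i> * eta_sq \<tau> * j))) (at 0)"
    proof -
      have 1: "((\<lambda>v. jtheta (v * j) \<tau>) has_field_derivative (- 2 * of_real pi * \<i> * eta_sq \<tau> * j)) (at 0)"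
      proof (rule DERIV_chain2[where f = "\<lambda>z. jtheta z \<tau>" and g = "\<lambda>v. v * j"])
        show "((\<lambda>z. jtheta z \<tau>) has_field_derivative (- 2 * of_real pi * \<i> * eta_sq \<tau>)) (at (0 * j))"
          using jtheta_has_field_derivative_0[OF \<tau>] by simp
      qed (auto intro!: derivative_eq_intros)
      show ?thesis unfolding expi_def
        by (rule derivative_eq_intros 1 refl | simp add: \<tau>)+
    qed
    ultimately have "- 2 * of_real pi * \<i> * eta_sq \<tau>' = \<omega> * (- 2 * of_real pi * \<i> * eta_sq \<tau> * j)"
      unfolding eq by (rule DERIV_unique)
    thus ?thesis by (simp add: \<tau>'_def j_def)
  qed
  with \<omega> show ?thesis using that by blast
qed

lemma siegel_plus_of_int_right:
  "siegel u (v + of_int n) \<tau> = (-1) powi n * expi (of_int n * u / 2) * siegel u v \<tau>"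
proof (induction n rule: int_induct[of _ 0])
  case (step1 i)
  have "expi (of_int (i + 1) * u / 2) = expi (u / 2) * expi (of_int i * u / 2)"
    unfolding expi_add [symmetric] by (rule arg_cong[of _ _ expi]) (simp add: field_simps)
  thus ?case using siegel_plus_1_right[of u "v + of_int i" \<tau>] step1.IH
    by (simp add: add_ac power_int_add)
next
  case (step2 i)
  have *: "expi (of_int i * u / 2) = expi (u / 2) * expi (of_int (i - 1) * u / 2)"
    unfolding expi_add [symmetric] by (rule arg_cong[of _ _ expi]) (simp add: field_simps)
  have "siegel u (v + of_int i) \<tau> = - expi (u / 2) * siegel u (v + of_int (i - 1)) \<tau>"
    using siegel_plus_1_right[of u "v + of_int (i - 1)" \<tau>] by (simp add: algebra_simps)
  hence "expi (u / 2) * siegel u (v + of_int (i - 1)) \<tau> =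
      expi (u / 2) * (- ((-1) powi i) * expi (of_int (i - 1) * u / 2) * siegel u v \<tau>)"
    unfolding step2.IH * by algebra
  thus ?case unfolding mult_cancel_left by (simp add: power_int_diff)
qed auto

lemma siegel_plus_of_int_left:
  assumes "Im \<tau> > 0"
  shows "siegel (u + of_int n) v \<tau> = (-1) powi n * expi (- of_int n * v / 2) * siegel u v \<tau>"
proof (induction n rule: int_induct[of _ 0])
  case (step1 i)
  have "expi (- of_int (i + 1) * v / 2) = expi (- v / 2) * expi (- of_int i * v / 2)"
    unfolding expi_add [symmetric] by (rule arg_cong[of _ _ expi]) (simp add: field_simps)
  thus ?case using siegel_plus_1_left[OF assms, of "u + of_int i" v] step1.IH
    by (simp add: add_ac power_int_add)
next
  case (step2 i)
  have *: "expi (- of_int i * v / 2) = expi (- v / 2) * expi (- of_int (i - 1) * v / 2)"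
    unfolding expi_add [symmetric] by (rule arg_cong[of _ _ expi]) (simp add: field_simps)
  have "siegel (u + of_int i) v \<tau> = - expi (- v / 2) * siegel (u + of_int (i - 1)) v \<tau>"
    using siegel_plus_1_left[OF assms, of "u + of_int (i - 1)" v] by (simp add: algebra_simps)
  hence "expi (- v / 2) * siegel (u + of_int (i - 1)) v \<tau> =
      expi (- v / 2) * (- ((-1) powi i) * expi (- of_int (i - 1) * v / 2) * siegel u v \<tau>)"
    unfolding step2.IH * by algebra
  thus ?case unfolding mult_cancel_left by (simp add: power_int_diff)
qed auto

section \<open>Expansions at the cusps\<close>

lemma q_pow_eq_expi: "q_pow r \<tau> = expi (of_real r * \<tau>)"
  by (simp add: q_pow_def expi_def mult_ac)

lemma expi_sum: "expi (\<Sum>i\<in>A. f i) = (\<Prod>i\<in>A. expi (f i))"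
  by (induction A rule: infinite_finite_induct) (auto simp: expi_add)

lemma eta_sq_of_nat_mult:
  "eta_sq (of_nat N * \<tau>) = expi (of_nat N * \<tau> / 12) * qpoch (expi \<tau> ^ N) (expi \<tau> ^ N) ^ 2"
  by (simp add: eta_sq_def expi_power)

text \<open>The exponent of q is N/2 times the Bernoulli polynomial B_2(j/N).\<close>

lemma siegel_of_nat_mult:
  assumes "j \<le> N" "N > 0"
  shows "siegel (of_nat j / of_nat N) 0 (of_nat N * \<tau>) =
    expi ((of_nat N / 12 - of_nat j * (of_nat N - of_nat j) / (2 * of_nat N)) * \<tau>) *
    (qpoch (expi \<tau> ^ j) (expi \<tau> ^ N) * qpoch (expi \<tau> ^ (N - j)) (expi \<tau> ^ N))"
proof -
  have 1: "of_nat j / of_nat N * (of_nat N * \<tau>) + 0 = of_nat j * \<tau>" using assms by simp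
  have 2: "of_nat N * \<tau> - of_nat j * \<tau> = of_nat (N - j) * \<tau>"
    using assms by (simp add: of_nat_diff algebra_simps)
  have 3: "expi (of_nat j / of_nat N * (of_nat j * \<tau>) / 2) * expi (of_nat N * \<tau> / 12 - of_nat j * \<tau> / 2) =
    expi ((of_nat N / 12 - of_nat j * (of_nat N - of_nat j) / (2 * of_nat N)) * \<tau>)"
    unfolding expi_add [symmetric]
    by (rule arg_cong[of _ _ expi]) (use assms in \<open>simp add: field_simps\<close>)
  show ?thesis
    unfolding siegel_def 1 jtheta_def 2 expi_power 3 [symmetric] by (simp only: mult_ac)
qed

text \<open>The prescribed power of q is the sum of the leading exponents of all factors, so nothing
  is left over.\<close>

lemma theta_prod_eq_siegel:
  assumes "N > 0"
  shows "theta_prod N (2 * k) a \<tau> = eta_sq (of_nat N * \<tau>) ^ k *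
    (\<Prod>j=1..N div 2. siegel (of_nat j / of_nat N) 0 (of_nat N * \<tau>) powi a j)"
proof -
  define q where "q = expi \<tau>"
  define M where "M = {1..N div 2}"
  define e where "e = (\<lambda>j::nat. (of_nat N / 12 - of_nat j * (of_nat N - of_nat j) / (2 * of_nat N)) * \<tau>)"
  have q1: "q_pow 1 \<tau> = q" by (simp add: q_pow_eq_expi q_def)
  have "(\<Prod>j\<in>M. siegel (of_nat j / of_nat N) 0 (of_nat N * \<tau>) powi a j) =
    (\<Prod>j\<in>M. expi (of_int (a j) * e j) * (qpoch (q ^ j) (q ^ N) * qpoch (q ^ (N - j)) (q ^ N)) powi a j)"
    by (intro prod.cong refl, subst siegel_of_nat_mult)
       (use assms in \<open>auto simp: M_def e_def q_def power_int_mult_distrib expi_power_int\<close>)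
  also have "\<dots> = expi (\<Sum>j\<in>M. of_int (a j) * e j) * (\<Prod>j\<in>M. (qpoch (q ^ j) (q ^ N) * qpoch (q ^ (N - j)) (q ^ N)) powi a j)"
    by (simp add: prod.distrib expi_sum)
  moreover have eta: "eta_sq (of_nat N * \<tau>) ^ k = expi (of_nat k * (of_nat N * \<tau> / 12)) * qpoch (q ^ N) (q ^ N) ^ (2 * k)"
    by (simp only: eta_sq_of_nat_mult q_def [symmetric] power_mult_distrib expi_power power_mult [symmetric])
  ultimately have 1: "eta_sq (of_nat N * \<tau>) ^ k * (\<Prod>j\<in>M. siegel (of_nat j / of_nat N) 0 (of_nat N * \<tau>) powi a j) =
     (expi (of_nat k * (of_nat N * \<tau> / 12)) * expi (\<Sum>j\<in>M. of_int (a j) * e j)) * qpoch (q ^ N) (q ^ N) ^ (2 * k) *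
     (\<Prod>j\<in>M. (qpoch (q ^ j) (q ^ N) * qpoch (q ^ (N - j)) (q ^ N)) powi a j)"
    by (simp add: eta mult_ac)
  have "of_nat k * (of_nat N * \<tau> / 12) + (\<Sum>j\<in>M. of_int (a j) * e j) =
     of_real (real N / 24 * of_int (S1 N (2 * k) a) - 1 / (2 * real N) * of_int (S2 N a)) * \<tau>"
    using assms unfolding e_def S1_def S2_def M_def [symmetric]
    by (simp add: algebra_simps sum.distrib sum_subtractf sum_distrib_left sum_distrib_right add_divide_distrib diff_divide_distrib)
  hence 2: "expi (of_nat k * (of_nat N * \<tau> / 12)) * expi (\<Sum>j\<in>M. of_int (a j) * e j) =
     q_pow (real N / 24 * of_int (S1 N (2 * k) a) - 1 / (2 * real N) * of_int (S2 N a)) \<tau>"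
    by (simp add: q_pow_eq_expi expi_add [symmetric])
  show ?thesis
    unfolding M_def [symmetric] 1 2 by (simp add: theta_prod_def Let_def q1 M_def)
qed

text \<open>The local parameter is \<open>exp(2\<pi>i\<tau>/N)\<close>, so the order of vanishing of \<open>h\<close> is \<open>N\<rho>\<close>.\<close>

definition cusp_exponent :: "nat \<Rightarrow> real \<Rightarrow> (complex \<Rightarrow> complex) \<Rightarrow> bool" where
  "cusp_exponent N \<rho> h \<longleftrightarrow> (\<exists>G. G holomorphic_on ball 0 1 \<and> (\<forall>x\<in>ball 0 1. G x \<noteq> 0) \<and>
     (\<forall>\<tau>. Im \<tau> > 0 \<longrightarrow> h \<tau> = expi (of_real \<rho> * \<tau>) * G (expi (\<tau> / of_nat N))))"

section \<open>Leading exponents and holomorphy at a cusp\<close>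

lemma cusp_exponent_cong:
  "cusp_exponent N \<rho> h \<Longrightarrow> (\<And>\<tau>. Im \<tau> > 0 \<Longrightarrow> h' \<tau> = h \<tau>) \<Longrightarrow> \<rho> = \<rho>' \<Longrightarrow> cusp_exponent N \<rho>' h'"
  unfolding cusp_exponent_def by auto

lemma cusp_exponent_const: "c \<noteq> 0 \<Longrightarrow> cusp_exponent N 0 (\<lambda>_. c)"
  unfolding cusp_exponent_def by (intro exI[of _ "\<lambda>_. c"]) auto

lemma cusp_exponent_mult:
  assumes "cusp_exponent N \<rho> h" "cusp_exponent N \<rho>' h'"
  shows "cusp_exponent N (\<rho> + \<rho>') (\<lambda>\<tau>. h \<tau> * h' \<tau>)"
proof -
  from assms obtain G G' where
    "G holomorphic_on ball 0 1" "\<forall>x\<in>ball 0 1. G x \<noteq> 0"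
    "\<And>\<tau>. Im \<tau> > 0 \<Longrightarrow> h \<tau> = expi (of_real \<rho> * \<tau>) * G (expi (\<tau> / of_nat N))"
    "G' holomorphic_on ball 0 1" "\<forall>x\<in>ball 0 1. G' x \<noteq> 0"
    "\<And>\<tau>. Im \<tau> > 0 \<Longrightarrow> h' \<tau> = expi (of_real \<rho>' * \<tau>) * G' (expi (\<tau> / of_nat N))"
    unfolding cusp_exponent_def by metis
  thus ?thesis
    unfolding cusp_exponent_def
    by (intro exI[of _ "\<lambda>x. G x * G' x"]) (auto intro!: holomorphic_intros simp: expi_add algebra_simps)
qed

lemma cusp_exponent_prod:
  assumes "finite A" "\<And>j. j \<in> A \<Longrightarrow> cusp_exponent N (\<rho> j) (h j)"
  shows "cusp_exponent N (\<Sum>j\<in>A. \<rho> j) (\<lambda>\<tau>. \<Prod>j\<in>A. h j \<tau>)"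
  using assms
  by (induction A rule: finite_induct) (auto intro!: cusp_exponent_mult cusp_exponent_const)

lemma cusp_exponent_power_int:
  assumes "cusp_exponent N \<rho> h"
  shows "cusp_exponent N (of_int n * \<rho>) (\<lambda>\<tau>. h \<tau> powi n)"
proof -
  from assms obtain G where G:
    "G holomorphic_on ball 0 1" "\<forall>x\<in>ball 0 1. G x \<noteq> 0"
    "\<And>\<tau>. Im \<tau> > 0 \<Longrightarrow> h \<tau> = expi (of_real \<rho> * \<tau>) * G (expi (\<tau> / of_nat N))"
    unfolding cusp_exponent_def by metis
  show ?thesis
    unfolding cusp_exponent_def
    by (intro exI[of _ "\<lambda>x. G x powi n"])
       (use G in \<open>auto intro!: holomorphic_intros simp: power_int_mult_distrib expi_power_int mult_ac\<close>)
qed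

lemma cusp_exponent_power:
  "cusp_exponent N \<rho> h \<Longrightarrow> cusp_exponent N (of_nat n * \<rho>) (\<lambda>\<tau>. h \<tau> ^ n)"
  using cusp_exponent_power_int[of N \<rho> h "int n"] by simp

lemma cusp_exponent_holomorphic:
  assumes "cusp_exponent N \<rho> h" "N > 0"
  shows "h holomorphic_on {\<tau>. Im \<tau> > 0}"
proof -
  from assms obtain G where G:
    "G holomorphic_on ball 0 1"
    "\<And>\<tau>. Im \<tau> > 0 \<Longrightarrow> h \<tau> = expi (of_real \<rho> * \<tau>) * G (expi (\<tau> / of_nat N))"
    unfolding cusp_exponent_def by metis
  have "(G \<circ> (\<lambda>\<tau>. expi (\<tau> / of_nat N))) holomorphic_on {\<tau>. Im \<tau> > 0}"
    by (rule holomorphic_on_compose_gen[OF _ G(1)])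
       (use assms(2) in \<open>auto intro!: holomorphic_intros simp: norm_expi\<close>)
  hence "(\<lambda>\<tau>. expi (of_real \<rho> * \<tau>) * G (expi (\<tau> / of_nat N))) holomorphic_on {\<tau>. Im \<tau> > 0}"
    by (intro holomorphic_intros) (auto simp: o_def)
  thus ?thesis by (rule holomorphic_transform) (use G(2) in auto)
qed

text \<open>Two points suffice: at \<open>\<i>\<close> and \<open>\<i> + of_nat N\<close> the
  function \<open>G\<close> has the same nonzero value, so \<open>expi\<close> of N \<rho> is
  1.\<close>

lemma cusp_exponent_periodic_imp_int:
  assumes "cusp_exponent N \<rho> h" "N > 0" "\<And>\<tau>. Im \<tau> > 0 \<Longrightarrow> h (\<tau> + of_nat N) = h \<tau>"
  shows "\<exists>n::int. of_nat N * \<rho> = of_int n"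
proof -
  from assms(1) obtain G where G:
    "\<forall>x\<in>ball 0 1. G x \<noteq> 0"
    "\<And>\<tau>. Im \<tau> > 0 \<Longrightarrow> h \<tau> = expi (of_real \<rho> * \<tau>) * G (expi (\<tau> / of_nat N))"
    unfolding cusp_exponent_def by metis
  have "expi ((\<i> + of_nat N) / of_nat N) = expi (\<i> / of_nat N)"
    using assms(2) by (simp add: add_divide_distrib expi_add)
  hence "expi (of_real \<rho> * (\<i> + of_nat N)) * G (expi (\<i> / of_nat N)) = expi (of_real \<rho> * \<i>) * G (expi (\<i> / of_nat N))"
    using assms(3)[of \<i>] G(2)[of \<i>] G(2)[of "\<i> + of_nat N"] by simp
  moreover have "G (expi (\<i> / of_nat N)) \<noteq> 0"
    using G(1) assms(2) by (auto simp: norm_expi)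
  ultimately have "expi (of_real \<rho> * of_nat N) = 1"
    by (simp add: ring_distribs expi_add)
  then obtain n :: int where "complex_of_real \<rho> * of_nat N = of_int n"
    by (auto simp: expi_eq_1_iff)
  hence "of_real (of_nat N * \<rho>) = (of_real (of_int n) :: complex)" by (simp add: mult.commute)
  thus ?thesis unfolding of_real_eq_iff by blast
qed

text \<open>Since \<open>G\<close> does not vanish at the origin, N \<rho> is the exact order. A
  negative order would, after multiplication by a power of the local parameter, force
  \<open>G 0 = 0\<close>.\<close>

lemma cusp_exponent_holomorphic_at_cusp_iff:
  assumes "cusp_exponent N \<rho> h" "N > 0"
  shows "(\<exists>F. F holomorphic_on ball 0 1 \<and> (\<forall>\<tau>. Im \<tau> > 0 \<longrightarrow> h \<tau> = F (expi (\<tau> / of_nat N)))) \<longleftrightarrow>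
    (\<exists>n::nat. of_nat N * \<rho> = of_nat n)"
proof -
  from assms(1) obtain G where G:
    "G holomorphic_on ball 0 1" "\<forall>x\<in>ball 0 1. G x \<noteq> 0"
    "\<And>\<tau>. Im \<tau> > 0 \<Longrightarrow> h \<tau> = expi (of_real \<rho> * \<tau>) * G (expi (\<tau> / of_nat N))"
    unfolding cusp_exponent_def by metis
  have expi_\<rho>: "expi (of_real \<rho> * \<tau>) = expi (\<tau> / of_nat N) powi n" if "of_nat N * \<rho> = of_int n" for n :: int and \<tau>
  proof -
    have "complex_of_real (of_nat N * \<rho>) = of_int n" using that by simp
    thus ?thesis
      unfolding expi_power_int using assms(2) by (intro arg_cong[of _ _ expi]) (auto simp: field_simps)
  qed
  show ?thesis
  proof
    assume "\<exists>n::nat. of_nat N * \<rho> = of_nat n"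
    then obtain n :: nat where n: "of_nat N * \<rho> = of_nat n" by blast
    show "\<exists>F. F holomorphic_on ball 0 1 \<and> (\<forall>\<tau>. Im \<tau> > 0 \<longrightarrow> h \<tau> = F (expi (\<tau> / of_nat N)))"
      by (intro exI[of _ "\<lambda>x. x ^ n * G x"])
         (use G expi_\<rho>[of "int n"] n in \<open>auto intro!: holomorphic_intros\<close>)
  next
    assume "\<exists>F. F holomorphic_on ball 0 1 \<and> (\<forall>\<tau>. Im \<tau> > 0 \<longrightarrow> h \<tau> = F (expi (\<tau> / of_nat N)))"
    then obtain F where F: "F holomorphic_on ball 0 1" "\<And>\<tau>. Im \<tau> > 0 \<Longrightarrow> h \<tau> = F (expi (\<tau> / of_nat N))"
      by blast
    have "\<exists>n::int. of_nat N * \<rho> = of_int n"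
      by (rule cusp_exponent_periodic_imp_int[OF assms])
         (use assms(2) in \<open>auto simp: F add_divide_distrib expi_add\<close>)
    then obtain n :: int where n: "of_nat N * \<rho> = of_int n" by blast
    have "n \<ge> 0"
    proof (rule ccontr)
      assume "\<not> n \<ge> 0"
      define m where "m = nat (- n)"
      have m: "m > 0" "n = - int m" using \<open>\<not> n \<ge> 0\<close> by (auto simp: m_def)
      \<comment> \<open>Local parameters of the points \<open>\<i> * of_nat t\<close>; they tend to
        the cusp as t grows.\<close>
      define X where "X = (\<lambda>t::nat. expi (\<i> * of_nat t / of_nat N))"
      have FG: "X t ^ m * F (X t) = G (X t)" if "t > 0" for t
      proof -
        have "X t \<noteq> 0" by (simp add: X_def)
        moreover have "F (X t) = inverse (X t ^ m) * G (X t)"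
          using F(2)[of "\<i> * of_nat t"] G(3)[of "\<i> * of_nat t"] expi_\<rho>[OF n, of "\<i> * of_nat t"] that
          by (simp add: X_def m power_int_minus)
        ultimately show ?thesis by simp
      qed
      have "X = (\<lambda>t. exp (of_real (- 2 * pi / of_nat N)) ^ t)"
        by (auto simp: X_def expi_def fun_eq_iff mult_ac simp flip: exp_of_nat_mult)
      moreover have "norm (exp (complex_of_real (- 2 * pi / of_nat N))) < 1"
        using assms(2) by (simp add: divide_simps)
      ultimately have X0: "X \<longlonglongrightarrow> 0" by (simp add: LIMSEQ_power_zero)
      have "isCont F 0" "isCont G 0"
        using F(1) G(1) by (auto intro!: continuous_on_interior[of "ball 0 1"] holomorphic_on_imp_continuous_on)
      hence lims: "(\<lambda>t. X t ^ m * F (X t)) \<longlonglongrightarrow> 0 ^ m * F 0" "(\<lambda>t. G (X t)) \<longlonglongrightarrow> G 0"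
        using X0 by (auto intro!: tendsto_intros isCont_tendsto_compose[of 0])
      have "eventually (\<lambda>t. X t ^ m * F (X t) = G (X t)) sequentially"
        using eventually_gt_at_top[of 0] by eventually_elim (use FG in auto)
      from Lim_transform_eventually[OF lims(1) this] lims(2) have "G 0 = 0 ^ m * F 0"
        by (rule LIMSEQ_unique [symmetric])
      with bspec[OF G(2), of 0] m(1) show False by simp
    qed
    thus "\<exists>n::nat. of_nat N * \<rho> = of_nat n"
      using n by (intro exI[of _ "nat n"]) auto
  qed
qed

text \<open>Comparing absolute values, a factor can vanish only if m + n i = 0, that is for m = i =
  0, where it is \<open>1 - \<kappa>\<close>. The origin has to be included because it represents
  the cusp.\<close>

lemma qpoch_power_nonzero:
  assumes "norm (\<xi>::complex) = 1" "norm \<kappa> = 1" "m = 0 \<longrightarrow> \<kappa> \<noteq> 1" "n > 0" "x \<in> ball 0 1"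
  shows "qpoch (\<kappa> * x ^ m) (\<xi> * x ^ n) \<noteq> 0"
proof -
  have x: "norm x < 1" using assms(5) by simp
  have q: "norm (\<xi> * x ^ n) < 1"
    using x assms(1,4) by (simp add: norm_mult norm_power power_less_one_iff)
  have "\<kappa> * x ^ m * (\<xi> * x ^ n) ^ i \<noteq> 1" for i
  proof
    assume *: "\<kappa> * x ^ m * (\<xi> * x ^ n) ^ i = 1"
    hence "norm (\<kappa> * x ^ m * (\<xi> * x ^ n) ^ i) = 1" by simp
    hence "norm x ^ (m + n * i) = 1"
      by (simp add: norm_mult norm_power assms(1,2) power_mult_distrib power_add power_mult)
    hence "m + n * i = 0"
      using x power_less_one_iff[of "norm x" "m + n * i"] by force
    with * assms(3,4) show False by auto
  qed
  thus ?thesis by (simp add: qpoch_eq_0_iff[OF q])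
qed

text \<open>The argument is (D \<tau> + y) / w with w D = N, extended by D to exhibit powers of the
  local parameter. The exponent is D^2 / N times half of B_2(r/D). For r = 0 the product contains
  the constant factor \<open>1 - expi v\<close>, hence the condition on \<open>v\<close>.\<close>

lemma cusp_exponent_siegel:
  fixes D N r :: nat and y :: int and v :: real
  assumes "D > 0" "N > 0" "r < D" "r = 0 \<longrightarrow> expi (of_real v) \<noteq> 1"
  shows "cusp_exponent N (real D ^ 2 / real N * ((real r / real D) ^ 2 / 2 - real r / real D / 2 + 1 / 12))
           (\<lambda>\<tau>. siegel (of_nat r / of_nat D) (of_real v) ((of_nat D ^ 2 * \<tau> + of_int y * of_nat D) / of_nat N))"
proof -
  define s :: complex where "s = of_int y * of_nat D / of_nat N"
  define u :: complex where "u = of_nat r / of_nat D"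
  define c where "c = u * (u * s + of_real v) / 2 + s / 12 - (u * s + of_real v) / 2"
  define G where "G = (\<lambda>x. expi c * 
     (qpoch (expi (u * s + of_real v) * x ^ (r * D)) (expi s * x ^ (D ^ 2)) * 
      qpoch (expi (s - (u * s + of_real v)) * x ^ ((D - r) * D)) (expi s * x ^ (D ^ 2))))"
  have reals: "Im s = 0" "Im (u * s) = 0" by (simp_all add: s_def u_def)
  have norms: "norm (expi s) = 1" "norm (expi (u * s + of_real v)) = 1" "norm (expi (s - (u * s + of_real v))) = 1"
    using reals by (simp_all add: norm_expi)
  have "G holomorphic_on ball 0 1"
    unfolding G_def
    by (intro holomorphic_intros holomorphic_on_qpoch)
       (use assms norms in \<open>auto simp: norm_mult norm_power power_less_one_iff\<close>)
  moreover have "G x \<noteq> 0" if "x \<in> ball 0 1" for x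
    unfolding G_def mult_eq_0_iff de_Morgan_disj
    by (intro conjI qpoch_power_nonzero norms that)
       (use assms in \<open>auto simp: u_def\<close>)
  moreover have "siegel u (of_real v) ((of_nat D ^ 2 * \<tau> + of_int y * of_nat D) / of_nat N) =
      expi (of_real (real D ^ 2 / real N * ((real r / real D) ^ 2 / 2 - real r / real D / 2 + 1 / 12)) * \<tau>) *
      G (expi (\<tau> / of_nat N))" for \<tau>
  proof -
    define T where "T = \<tau> / of_nat N"
    define \<sigma> where "\<sigma> = of_nat D ^ 2 * T + s"
    have \<sigma>: "(of_nat D ^ 2 * \<tau> + of_int y * of_nat D) / of_nat N = \<sigma>"
      by (simp add: \<sigma>_def s_def T_def add_divide_distrib)
    have uD: "u * of_nat D = of_nat r" using assms(1) by (simp add: u_def)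
    have 1: "expi \<sigma> = expi s * expi T ^ (D ^ 2)"
      unfolding \<sigma>_def by (simp add: expi_add expi_power)
    have 2: "u * \<sigma> + of_real v = u * s + of_real v + of_nat (r * D) * T"
    proof -
      have "u * \<sigma> = (u * of_nat D) * of_nat D * T + u * s"
        by (simp add: \<sigma>_def algebra_simps power2_eq_square)
      thus ?thesis by (simp add: uD)
    qed
    have 3: "expi (u * \<sigma> + of_real v) = expi (u * s + of_real v) * expi T ^ (r * D)"
      unfolding 2 by (simp add: expi_add expi_power)
    have 4: "expi (\<sigma> - (u * \<sigma> + of_real v)) = expi (s - (u * s + of_real v)) * expi T ^ ((D - r) * D)"
      unfolding expi_power expi_add [symmetric]
      by (rule arg_cong[of _ _ expi])
         (use assms in \<open>simp add: 2 uD of_nat_diff \<sigma>_def algebra_simps power2_eq_square\<close>)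
    have 5: "expi (u * (u * \<sigma> + of_real v) / 2) * expi (\<sigma> / 12 - (u * \<sigma> + of_real v) / 2) =
       expi (of_real (real D ^ 2 / real N * ((real r / real D) ^ 2 / 2 - real r / real D / 2 + 1 / 12)) * \<tau>) * expi c"
      unfolding expi_add [symmetric]
    proof (rule arg_cong[of _ _ expi])
      have e: "of_real (real D ^ 2 / real N * ((real r / real D) ^ 2 / 2 - real r / real D / 2 + 1 / 12)) * \<tau> =
         of_nat D ^ 2 * T * (u ^ 2 / 2 - u / 2 + 1 / 12)"
        by (simp add: T_def u_def)
      show "u * (u * \<sigma> + of_real v) / 2 + (\<sigma> / 12 - (u * \<sigma> + of_real v) / 2) =
         of_real (real D ^ 2 / real N * ((real r / real D) ^ 2 / 2 - real r / real D / 2 + 1 / 12)) * \<tau> + c"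
        unfolding e by (simp add: c_def \<sigma>_def field_simps power2_eq_square)
    qed
    show ?thesis
      unfolding \<sigma> siegel_def jtheta_def G_def T_def [symmetric]
      unfolding 3 [symmetric] 4 [symmetric] 1 [symmetric]
      using 5 by (simp only: mult.assoc [symmetric])
  qed
  ultimately show ?thesis
    unfolding cusp_exponent_def u_def by blast
qed

lemma cusp_exponent_eta_sq:
  fixes D N :: nat and y :: int
  assumes "D > 0" "N > 0"
  shows "cusp_exponent N (real D ^ 2 / real N / 12) (\<lambda>\<tau>. eta_sq ((of_nat D ^ 2 * \<tau> + of_int y * of_nat D) / of_nat N))"
proof -
  define s :: complex where "s = of_int y * of_nat D / of_nat N"
  define G where "G = (\<lambda>x. expi (s / 12) * qpoch (expi s * x ^ (D ^ 2)) (expi s * x ^ (D ^ 2)) ^ 2)"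
  have norms: "norm (expi s) = 1" by (simp add: s_def norm_expi)
  have "G holomorphic_on ball 0 1"
    unfolding G_def
    by (intro holomorphic_intros holomorphic_on_qpoch)
       (use assms norms in \<open>auto simp: norm_mult norm_power power_less_one_iff\<close>)
  moreover have "G x \<noteq> 0" if "x \<in> ball 0 1" for x
    using qpoch_power_nonzero[OF norms norms _ _ that, of "D ^ 2" "D ^ 2"] assms by (simp add: G_def)
  moreover have "eta_sq ((of_nat D ^ 2 * \<tau> + of_int y * of_nat D) / of_nat N) =
      expi (of_real (real D ^ 2 / real N / 12) * \<tau>) * G (expi (\<tau> / of_nat N))" for \<tau>
  proof -
    define T where "T = \<tau> / of_nat N"
    have \<sigma>: "(of_nat D ^ 2 * \<tau> + of_int y * of_nat D) / of_nat N = of_nat D ^ 2 * T + s"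
      by (simp add: s_def T_def add_divide_distrib)
    have 1: "expi (of_nat D ^ 2 * T + s) = expi s * expi T ^ (D ^ 2)"
      by (simp add: expi_add expi_power)
    have 2: "expi ((of_nat D ^ 2 * T + s) / 12) = expi (of_real (real D ^ 2 / real N / 12) * \<tau>) * expi (s / 12)"
      unfolding expi_add [symmetric]
      by (rule arg_cong[of _ _ expi]) (simp add: T_def field_simps)
    show ?thesis
      unfolding \<sigma> eta_sq_def G_def T_def [symmetric] 1 2 by (simp only: mult.assoc)
  qed
  ultimately show ?thesis
    unfolding cusp_exponent_def by blast
qed

text \<open>In matrices: diag(N, 1) A = (p r; s t) (D y; 0 w), a Hermite normal form, so N A \<tau>
  is an SL2 image of (D \<tau> + y) / w. The entry D is the gcd of the first column (N a, c), which
  is gcd(c, N) as a and c are coprime.\<close>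

lemma sl2_decomposition:
  fixes a b c d :: int and N :: nat
  assumes "a * d - b * c = 1" "N > 0"
  defines "D \<equiv> nat (gcd c (int N))"
  obtains p r s t y :: int and w :: nat where
    "p * t - r * s = 1" "c = s * int D" "int N * a = p * int D" "w * D = N"
    "int N * b = p * y + r * int w" "d = s * y + t * int w"
proof -
  have D: "int D = gcd c (int N)" "D > 0" using assms(2) by (auto simp: D_def)
  have "D dvd N" using D(1) by (metis gcd_dvd2 int_dvd_int_iff)
  define w where "w = N div D"
  have w: "w * D = N" using \<open>D dvd N\<close> by (simp add: w_def)
  define s where "s = c div int D"
  have s: "c = s * int D" by (simp add: s_def D)
  define p where "p = int w * a"
  have "coprime s (int w)"
    unfolding s_def w_def using D assms(2) by (simp add: zdiv_int div_gcd_coprime)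
  moreover have "coprime s a"
  proof -
    have "coprime c a"
    proof (rule coprimeI)
      fix e assume "e dvd c" "e dvd a"
      hence "e dvd a * d - b * c" by simp
      thus "is_unit e" using assms(1) by simp
    qed
    thus ?thesis using s by simp
  qed
  ultimately have "coprime p s" by (simp add: p_def coprime_commute)
  then obtain t r' where tr: "p * t + s * r' = 1"
    by (metis bezout_int coprime_imp_gcd_eq_1 mult.commute)
  define r where "r = - r'"
  \<comment> \<open>The inverse of (p r; s t), applied to the second column (N b, d), gives (y,
    w).\<close>
  define y where "y = int N * b * t - r * d"
  have det: "p * t - r * s = 1" using tr by (simp add: r_def mult.commute)
  have w': "int w = p * d - int N * b * s"
  proof -
    have "p * d - int N * b * s = int w * (a * d - b * c)"
      unfolding p_def s w [symmetric] by (simp add: algebra_simps)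
    thus ?thesis using assms(1) by simp
  qed
  show ?thesis
  proof (rule that[OF det s _ w])
    show "int N * a = p * int D" unfolding p_def w [symmetric] by simp
    have "p * y + r * int w = int N * b * (p * t - r * s)"
      unfolding w' y_def by (simp add: algebra_simps)
    thus "int N * b = p * y + r * int w" unfolding det by simp
    have "s * y + t * int w = d * (p * t - r * s)"
      unfolding w' y_def by (simp add: algebra_simps)
    thus "d = s * y + t * int w" unfolding det by simp
  qed
qed

text \<open>One \<omega> serves all weights and exponents. The factors of automorphy from
  \<open>eta_sq\<close> cancel the denominator of the slash operator up to w^k, and every factor
  contributes the same \<omega>.\<close>

lemma slash_theta_prod:
  fixes A :: "int ^ 2 ^ 2" and p r s t y :: int and D w N :: nat
  assumes N: "N > 0" and det: "p * t - r * s = 1"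
    and A: "A $ 2 $ 1 = s * int D" "int N * A $ 1 $ 1 = p * int D" "w * D = N"
           "int N * A $ 1 $ 2 = p * y + r * int w" "A $ 2 $ 2 = s * y + t * int w"
  shows "\<exists>\<omega>. \<omega> ^ 12 = 1 \<and>
    (\<forall>k a \<tau>. Im \<tau> > 0 \<longrightarrow> slash k (theta_prod N (2 * k) a) A \<tau> =
       \<omega> powi (int k + (\<Sum>j=1..N div 2. a j)) * inverse (of_nat w ^ k) *
       (eta_sq ((of_nat D ^ 2 * \<tau> + of_int y * of_nat D) / of_nat N) ^ k *
        (\<Prod>j=1..N div 2. siegel (of_int (int j * A $ 1 $ 1) / of_nat D) (of_int (int j * r) / of_nat N)
          ((of_nat D ^ 2 * \<tau> + of_int y * of_nat D) / of_nat N) powi a j)))"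
proof -
  obtain \<omega> where \<omega>: "\<omega> ^ 12 = 1"
    "\<And>u v \<tau>. Im \<tau> > 0 \<Longrightarrow> siegel u v ((of_int p * \<tau> + of_int r) / (of_int s * \<tau> + of_int t)) =
       \<omega> * siegel (u * of_int p + v * of_int s) (u * of_int r + v * of_int t) \<tau>"
    "\<And>\<tau>. Im \<tau> > 0 \<Longrightarrow> eta_sq ((of_int p * \<tau> + of_int r) / (of_int s * \<tau> + of_int t)) =
       \<omega> * (of_int s * \<tau> + of_int t) * eta_sq \<tau>"
    using siegel_eta_sq_transform[OF det] by metis
  have wD: "w > 0" "D > 0" using A(3) N by (auto intro: gr0I)
  have \<omega>0: "\<omega> \<noteq> 0" using \<omega>(1) by auto
  show ?thesis
  proof (intro exI[of _ \<omega>] conjI allI impI \<omega>(1))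
    fix k :: nat and a :: "nat \<Rightarrow> int" and \<tau> :: complex
    assume \<tau>: "Im \<tau> > 0"
    define M where "M = {1..N div 2}"
    define \<sigma> where "\<sigma> = (of_nat D ^ 2 * \<tau> + of_int y * of_nat D) / of_nat N"
    have \<sigma>_eq: "of_nat w * \<sigma> = of_nat D * \<tau> + of_int y"
      using wD unfolding \<sigma>_def A(3) [symmetric] by (simp add: field_simps power2_eq_square)
    have "Im \<sigma> = real D ^ 2 * Im \<tau> / real N" by (simp add: \<sigma>_def)
    hence \<sigma>: "Im \<sigma> > 0" using \<tau> wD N by simp
    define J where "J = of_int s * \<sigma> + of_int t"
    have J0: "J \<noteq> 0" unfolding J_def by (rule Im_moebius_pos[OF \<sigma> det])
    have A': "of_nat N * complex_of_int (A $ 1 $ 1) = of_int p * of_nat D"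
       "of_nat N * complex_of_int (A $ 1 $ 2) = of_int p * of_int y + of_int r * of_nat w"
      using arg_cong[OF A(2), of complex_of_int] arg_cong[OF A(4), of complex_of_int] by simp_all
    have den: "of_int (A $ 2 $ 1) * \<tau> + of_int (A $ 2 $ 2) = of_nat w * J"
    proof -
      have "of_nat w * J = of_int s * (of_nat w * \<sigma>) + of_int t * of_nat w" by (simp add: J_def algebra_simps)
      thus ?thesis unfolding \<sigma>_eq A(1,5) by (simp add: algebra_simps)
    qed
    have num: "of_nat N * (of_int (A $ 1 $ 1) * \<tau> + of_int (A $ 1 $ 2)) = of_nat w * (of_int p * \<sigma> + of_int r)"
    proof -
      have "of_nat w * (of_int p * \<sigma> + of_int r) = of_int p * (of_nat w * \<sigma>) + of_int r * of_nat w"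
          by (simp add: algebra_simps)
      also have "\<dots> = (of_nat N * of_int (A $ 1 $ 1)) * \<tau> + of_nat N * of_int (A $ 1 $ 2)"
        unfolding \<sigma>_eq A' by (simp add: algebra_simps)
      finally show ?thesis by (simp add: algebra_simps)
    qed
    have moeb: "of_nat N * moebius A \<tau> = (of_int p * \<sigma> + of_int r) / J"
      using num wD J0 unfolding moebius_def den by (simp add: field_simps)
    have sieg: "siegel (of_nat j / of_nat N) 0 (of_nat N * moebius A \<tau>) =
        \<omega> * siegel (of_int (int j * A $ 1 $ 1) / of_nat D) (of_int (int j * r) / of_nat N) \<sigma>" for j :: nat
    proof -
      have "of_nat j / of_nat N * complex_of_int p = of_int (int j * A $ 1 $ 1) / of_nat D"
        using A'(1) N wD by (simp add: field_simps)
      thus ?thesis unfolding moeb J_def \<omega>(2)[OF \<sigma>] by simp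
    qed
    have "slash k (theta_prod N (2 * k) a) A \<tau> =
       (\<omega> * J * eta_sq \<sigma>) ^ k * (\<Prod>j\<in>M. (\<omega> * siegel (of_int (int j * A $ 1 $ 1) / of_nat D) (of_int (int j * r) / of_nat N) \<sigma>) powi a j)
        / (of_nat w * J) ^ k"
      unfolding slash_def theta_prod_eq_siegel[OF N] sieg M_def [symmetric] den
      unfolding moeb J_def \<omega>(3)[OF \<sigma>] ..
    also have "\<dots> = (\<omega> ^ k * (\<Prod>j\<in>M. \<omega> powi a j)) * inverse (of_nat w ^ k) *
       (eta_sq \<sigma> ^ k * (\<Prod>j\<in>M. siegel (of_int (int j * A $ 1 $ 1) / of_nat D) (of_int (int j * r) / of_nat N) \<sigma> powi a j))"
      using J0 wD by (simp add: power_mult_distrib power_int_mult_distrib prod.distrib field_simps)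
    also have "(\<Prod>j\<in>M. \<omega> powi a j) = \<omega> powi (\<Sum>j\<in>M. a j)"
      by (induction M rule: infinite_finite_induct) (auto simp: power_int_add \<omega>0)
    also have "\<omega> ^ k * \<omega> powi (\<Sum>j\<in>M. a j) = \<omega> powi (int k + (\<Sum>j\<in>M. a j))"
      by (simp add: power_int_add \<omega>0)
    finally show "slash k (theta_prod N (2 * k) a) A \<tau> =
       \<omega> powi (int k + (\<Sum>j=1..N div 2. a j)) * inverse (of_nat w ^ k) *
       (eta_sq ((of_nat D ^ 2 * \<tau> + of_int y * of_nat D) / of_nat N) ^ k *
        (\<Prod>j=1..N div 2. siegel (of_int (int j * A $ 1 $ 1) / of_nat D) (of_int (int j * r) / of_nat N)
          ((of_nat D ^ 2 * \<tau> + of_int y * of_nat D) / of_nat N) powi a j))"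
      unfolding M_def \<sigma>_def .
  qed
qed

text \<open>
  With \<open>D = gcd c N\<close>, the order of \<open>theta_prod N (2 * k) a\<close> at the cusp \<open>b/c\<close>, measured in the local
  parameter of \<open>\<Gamma>\<^sub>1(N)\<close> of width \<open>N/D\<close>, is \<open>D * cusp_order k N a D b\<close>.
\<close>

definition cusp_order :: "nat \<Rightarrow> nat \<Rightarrow> (nat \<Rightarrow> int) \<Rightarrow> nat \<Rightarrow> int \<Rightarrow> real" where
  "cusp_order k N a D c = real k / 12 + (\<Sum>j=1..N div 2. real_of_int (a j) *
     ((real (nat (int j * c mod int D)) / real D)\<^sup>2 / 2 - real (nat (int j * c mod int D)) / real D / 2 + 1 / 12))"

lemma cusp_exponent_slash_theta_prod:
  fixes A :: "int ^ 2 ^ 2"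
  assumes "N > 0" "A \<in> SL2Z"
  defines "D \<equiv> nat (gcd (A $ 2 $ 1) (int N))"
  shows "cusp_exponent N (real D ^ 2 / real N * cusp_order k N a D (A $ 1 $ 1)) (slash k (theta_prod N (2 * k) a) A)"
proof -
  have detA: "A $ 1 $ 1 * A $ 2 $ 2 - A $ 1 $ 2 * A $ 2 $ 1 = 1"
    using assms(2) by (simp add: SL2Z_def det_2)
  obtain p r s t y :: int and w :: nat where *:
    "p * t - r * s = 1" "A $ 2 $ 1 = s * int D" "int N * A $ 1 $ 1 = p * int D" "w * D = N"
    "int N * A $ 1 $ 2 = p * y + r * int w" "A $ 2 $ 2 = s * y + t * int w"
    using sl2_decomposition[OF detA assms(1)] unfolding D_def by metis
  obtain \<omega> :: complex where \<omega>: "\<omega> ^ 12 = 1"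
    "\<And>k a \<tau>. Im \<tau> > 0 \<Longrightarrow> slash k (theta_prod N (2 * k) a) A \<tau> =
       \<omega> powi (int k + (\<Sum>j=1..N div 2. a j)) * inverse (of_nat w ^ k) *
       (eta_sq ((of_nat D ^ 2 * \<tau> + of_int y * of_nat D) / of_nat N) ^ k *
        (\<Prod>j=1..N div 2. siegel (of_int (int j * A $ 1 $ 1) / of_nat D) (of_int (int j * r) / of_nat N)
          ((of_nat D ^ 2 * \<tau> + of_int y * of_nat D) / of_nat N) powi a j))"
    using slash_theta_prod[OF assms(1) *] by blast
  have \<omega>0: "\<omega> \<noteq> 0" using \<omega>(1) by auto
  have wD: "w > 0" "D > 0" using *(4) assms(1) by (auto intro: gr0I)
  define \<sigma> where "\<sigma> = (\<lambda>\<tau>. (of_nat D ^ 2 * \<tau> + of_int y * of_nat D) / of_nat N :: complex)"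
  define R where "R = (\<lambda>j. nat (int j * A $ 1 $ 1 mod int D))"
  define \<beta> where "\<beta> = (\<lambda>j. (real (R j) / real D)\<^sup>2 / 2 - real (R j) / real D / 2 + 1 / 12)"
  have sieg: "cusp_exponent N (real D ^ 2 / real N * \<beta> j)
      (\<lambda>\<tau>. siegel (of_int (int j * A $ 1 $ 1) / of_nat D) (of_int (int j * r) / of_nat N) (\<sigma> \<tau>))"
    if j: "j \<in> {1..N div 2}" for j
  proof -
    define v where "v = real_of_int (int j * r) / real N"
    define n where "n = int j * A $ 1 $ 1 div int D"
    have Rj: "int (R j) = int j * A $ 1 $ 1 mod int D" "R j < D"
      using wD by (auto simp: R_def nat_less_iff)
    have "int j * A $ 1 $ 1 = int (R j) + n * int D"
      unfolding Rj n_def by simp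
    hence "complex_of_int (int j * A $ 1 $ 1) = of_nat (R j) + of_int n * of_nat D"
      by (metis of_int_add of_int_mult of_int_of_nat_eq)
    hence u: "complex_of_int (int j * A $ 1 $ 1) / of_nat D = of_nat (R j) / of_nat D + of_int n"
      using wD by (simp add: field_simps)
    have v: "complex_of_int (int j * r) / of_nat N = of_real v" by (simp add: v_def)
    \<comment> \<open>An integral characteristic would make the Siegel function vanish identically.
      It would force N to divide j p and j r, hence also j = j (p t - r s), which 1 <= j <= N/2
      excludes.\<close>
    have "R j = 0 \<longrightarrow> expi (of_real v) \<noteq> 1"
    proof safe
      assume "R j = 0" "expi (of_real v) = 1"
      then obtain m :: int where "complex_of_real v = of_int m" by (auto simp: expi_eq_1_iff)
      hence "v = of_int m" by (metis of_real_of_int_eq of_real_eq_iff)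
      hence "real_of_int (int j * r) = of_int (m * int N)" using assms(1) by (simp add: v_def field_simps)
      hence 1: "int N dvd int j * r" unfolding of_int_eq_iff by simp
      have "int D dvd int j * A $ 1 $ 1" using Rj \<open>R j = 0\<close> by (simp add: mod_eq_0_iff_dvd)
      then obtain q where "int j * A $ 1 $ 1 = int D * q" by blast
      hence "int D * (int N * q) = int D * (int j * p)" using *(3) by (metis mult.assoc mult.commute mult.left_commute)
      hence "int N * q = int j * p" using wD by simp
      hence 2: "int N dvd int j * p" by (metis dvd_triv_left)
      have "int N dvd int j * p * t - int j * r * s" by (rule dvd_diff[OF dvd_mult2[OF 2] dvd_mult2[OF 1]])
      also have "int j * p * t - int j * r * s = int j * (p * t - r * s)" by (simp add: algebra_simps)
      finally have "int N dvd int j" by (simp add: *(1))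
      hence "N dvd j" by simp
      with j show False using dvd_imp_le[of N j] by auto
    qed
    from cusp_exponent_siegel[OF wD(2) assms(1) Rj(2) this, of y]
    have 1: "cusp_exponent N (real D ^ 2 / real N * \<beta> j) (\<lambda>\<tau>. siegel (of_nat (R j) / of_nat D) (of_real v) (\<sigma> \<tau>))"
      unfolding \<beta>_def \<sigma>_def .
    define c where "c = (-1) powi n * expi (- of_int n * of_real v / 2)"
    have "cusp_exponent N (0 + real D ^ 2 / real N * \<beta> j) (\<lambda>\<tau>. c * siegel (of_nat (R j) / of_nat D) (of_real v) (\<sigma> \<tau>))"
      by (rule cusp_exponent_mult[OF cusp_exponent_const 1]) (simp add: c_def)
    thus ?thesis
    proof (rule cusp_exponent_cong)
      fix \<tau> :: complex assume "Im \<tau> > 0"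
      have "Im (\<sigma> \<tau>) = real D ^ 2 * Im \<tau> / real N" by (simp add: \<sigma>_def)
      hence "Im (\<sigma> \<tau>) > 0" using \<open>Im \<tau> > 0\<close> wD assms(1) by simp
      thus "siegel (of_int (int j * A $ 1 $ 1) / of_nat D) (of_int (int j * r) / of_nat N) (\<sigma> \<tau>) =
          c * siegel (of_nat (R j) / of_nat D) (of_real v) (\<sigma> \<tau>)"
        unfolding u v by (simp only: siegel_plus_of_int_left c_def)
    qed simp
  qed
  have "cusp_exponent N (0 + (of_nat k * (real D ^ 2 / real N / 12) +
      (\<Sum>j=1..N div 2. of_int (a j) * (real D ^ 2 / real N * \<beta> j))))
     (\<lambda>\<tau>. (\<omega> powi (int k + (\<Sum>j=1..N div 2. a j)) * inverse (of_nat w ^ k)) *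
       (eta_sq (\<sigma> \<tau>) ^ k *
        (\<Prod>j=1..N div 2. siegel (of_int (int j * A $ 1 $ 1) / of_nat D) (of_int (int j * r) / of_nat N) (\<sigma> \<tau>) powi a j)))"
    using wD cusp_exponent_eta_sq[OF wD(2) assms(1), of y] 
    by (intro cusp_exponent_mult cusp_exponent_const cusp_exponent_prod cusp_exponent_power cusp_exponent_power_int sieg)
       (auto simp: \<omega>0 \<sigma>_def)
  note exponent = this
  have order: "cusp_order k N a D (A $ 1 $ 1) = real k / 12 + (\<Sum>j=1..N div 2. real_of_int (a j) * \<beta> j)"
    by (simp add: cusp_order_def \<beta>_def R_def)
  from exponent show ?thesis
  proof (rule cusp_exponent_cong)
    show "0 + (of_nat k * (real D ^ 2 / real N / 12) +
      (\<Sum>j=1..N div 2. of_int (a j) * (real D ^ 2 / real N * \<beta> j))) =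
      real D ^ 2 / real N * cusp_order k N a D (A $ 1 $ 1)"
      unfolding order by (simp add: distrib_left sum_distrib_left mult_ac)
  qed (simp add: \<omega>(2) \<sigma>_def)
qed

text \<open>At infinity the expansion is in q itself, so that period 1 can be exploited; this gives
  a sharper integrality than period N.\<close>

lemma cusp_exponent_1_theta_prod:
  assumes "N > 0"
  shows "cusp_exponent 1 (real N / 24 * of_int (S1 N a0 a) - 1 / (2 * real N) * of_int (S2 N a)) (theta_prod N a0 a)"
proof -
  define \<rho> where "\<rho> = real N / 24 * of_int (S1 N a0 a) - 1 / (2 * real N) * of_int (S2 N a)"
  have lat_count_parity: "cusp_exponent 1 0 (\<lambda>\<tau>. qpoch (expi \<tau> ^ m) (expi \<tau> ^ n))" if "m > 0" "n > 0" for m n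
    unfolding cusp_exponent_def
  proof (intro exI[of _ "\<lambda>x. qpoch (x ^ m) (x ^ n)"] conjI ballI)
    show "(\<lambda>x. qpoch (x ^ m) (x ^ n)) holomorphic_on ball 0 1"
      using that by (intro holomorphic_intros holomorphic_on_qpoch) (auto simp: norm_power power_less_one_iff)
    show "qpoch (x ^ m) (x ^ n) \<noteq> 0" if "x \<in> ball 0 1" for x :: complex
      using qpoch_power_nonzero[of 1 1 m n x] that \<open>m > 0\<close> \<open>n > 0\<close> by simp
  qed auto
  have "cusp_exponent 1 \<rho> (\<lambda>\<tau>. expi (of_real \<rho> * \<tau>))"
    unfolding cusp_exponent_def by (intro exI[of _ "\<lambda>_. 1"]) auto
  hence "cusp_exponent 1 (\<rho> + of_nat a0 * 0 + (\<Sum>j=1..N div 2. of_int (a j) * (0 + 0))) (\<lambda>\<tau>. expi (of_real \<rho> * \<tau>) *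
      qpoch (expi \<tau> ^ N) (expi \<tau> ^ N) ^ a0 *
      (\<Prod>j=1..N div 2. (qpoch (expi \<tau> ^ j) (expi \<tau> ^ N) * qpoch (expi \<tau> ^ (N - j)) (expi \<tau> ^ N)) powi a j))"
    using assms
    by (intro cusp_exponent_mult cusp_exponent_prod cusp_exponent_power cusp_exponent_power_int lat_count_parity) auto
  thus ?thesis
    by (rule cusp_exponent_cong) (simp_all add: theta_prod_def q_pow_eq_expi \<rho>_def Let_def)
qed

section \<open>Modularity for level 16\<close>

lemma sum_Suc_0_8:
  "(\<Sum>j=Suc 0..8. f j) = f 1 + f 2 + f 3 + f 4 + f 5 + f 6 + f 7 + f 8"
proof -
  have "{Suc 0..8} = {1, 2, 3, 4, 5, 6, 7, 8}" by auto
  thus ?thesis by (simp add: add.assoc)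
qed

text \<open>The numbers j (16 - j) and j have the same parity.\<close>

lemma S2_16_dvd_imp_even:
  assumes "32 dvd S2 16 a"
  shows "even (\<Sum>j=1..8. int j * a j)"
proof -
  from assms obtain v where "S2 16 a = 32 * v" by blast
  hence "15 * a 1 + 28 * a 2 + 39 * a 3 + 48 * a 4 + 55 * a 5 + 60 * a 6 + 63 * a 7 + 64 * a 8 = 32 * v"
    by (simp add: S2_def sum_Suc_0_8)
  hence "(\<Sum>j=1..8. int j * a j) = 2 * (16 * v - 7 * a 1 - 13 * a 2 - 18 * a 3 - 22 * a 4 - 25 * a 5
      - 27 * a 6 - 28 * a 7 - 28 * a 8)"
    by (simp add: sum_Suc_0_8)
  thus ?thesis by simp
qed

lemma dvd_16_cases:
  assumes "D dvd (16::nat)"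
  shows "D \<in> {1, 2, 4, 8, 16}"
proof -
  have "D dvd 2 ^ 4" using assms by simp
  then obtain i where "i \<le> 4" "D = 2 ^ i" using divides_primepow_nat[OF two_is_prime_nat] by blast
  moreover from this have "i \<in> {0, 1, 2, 3, 4}" by auto
  ultimately show ?thesis by auto
qed

text \<open>With R_j the residue of j c modulo D, the number is D^2 / 12 times k + sum a_j, minus
  half of sum R_j (D - R_j) a_j. The first part is integral by the congruence modulo 12. For even D
  and odd c, R_j (D - R_j) has the parity of j, and sum j a_j is even.\<close>

lemma cusp_order_integral:
  assumes "12 dvd int k + (\<Sum>j=1..8. a j)" "32 dvd S2 16 a" "D dvd 16" "odd c \<or> D = 1"
  shows "\<exists>n::int. real D ^ 2 * cusp_order k 16 a D c = of_int n"
proof -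
  have "D > 0" using assms(3) by (auto intro!: gr0I)
  define R where "R = (\<lambda>j::nat. int j * c mod int D)"
  have Rr: "real (nat (R j)) = real_of_int (R j)" for j using \<open>D > 0\<close> by (simp add: R_def)
  obtain z where z: "int k + (\<Sum>j=1..8. a j) = 12 * z" using assms(1) by blast
  note odd_sum = S2_16_dvd_imp_even[OF assms(2)]
  have "even (\<Sum>j=1..8. R j * (int D - R j) * a j)"
  proof (cases "D = 1")
    case True thus ?thesis by (simp add: R_def)
  next
    case False
    have "even D" using dvd_16_cases[OF assms(3)] False by auto
    have "even (R j * (int D - R j) * a j) \<longleftrightarrow> even (int j * a j)" for j
    proof -
      have "even (R j) \<longleftrightarrow> even (int j * c)"
        unfolding R_def using \<open>even D\<close> by (simp add: dvd_mod_iff)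
      thus ?thesis using \<open>even D\<close> assms(4) False by auto
    qed
    hence "(\<Sum>j=1..8. R j * (int D - R j) * a j) mod 2 = (\<Sum>j=1..8. int j * a j) mod 2"
      by (subst (1 2) mod_sum_eq [symmetric]) (simp add: mod2_eq_if)
    thus ?thesis using odd_sum by (simp add: even_iff_mod_2_eq_zero)
  qed
  then obtain m where m: "(\<Sum>j=1..8. R j * (int D - R j) * a j) = 2 * m" by blast
  have summand: "real D ^ 2 * (real_of_int (a j) * ((real (nat (R j)) / real D)\<^sup>2 / 2
      - real (nat (R j)) / real D / 2 + 1 / 12)) =
      real D ^ 2 / 12 * of_int (a j) - of_int (R j * (int D - R j) * a j) / 2" for j
    using \<open>D > 0\<close> unfolding Rr by (simp add: field_simps power2_eq_square)
  have order: "cusp_order k 16 a D c = real k / 12 + (\<Sum>j=1..8. real_of_int (a j) *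
      ((real (nat (R j)) / real D)\<^sup>2 / 2 - real (nat (R j)) / real D / 2 + 1 / 12))"
    by (simp add: cusp_order_def R_def)
  have "real D ^ 2 * cusp_order k 16 a D c =
      real D ^ 2 * (real k / 12) + (\<Sum>j=1..8. real D ^ 2 / 12 * of_int (a j) - of_int (R j * (int D - R j) * a j) / 2)"
    by (simp only: order distrib_left[of "real D ^ 2" "real k / 12"] sum_distrib_left summand)
  also have "\<dots> = real D ^ 2 / 12 * of_int (int k + (\<Sum>j=1..8. a j)) - of_int (\<Sum>j=1..8. R j * (int D - R j) * a j) / 2"
    by (simp add: sum_subtractf sum_divide_distrib sum_distrib_left distrib_left del: of_int_mult of_int_diff)
  also have "\<dots> = of_int (int (D ^ 2) * z - m)"
    unfolding z m by simp
  finally show ?thesis by blast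
qed

text \<open>Here D = 16, w = 1 and y = 0, so the triangular part is just \<tau> to 16 \<tau>. The
  characteristics return to (j/16, 0) under integral shifts, whose exponentials have to cancel in
  the product.\<close>

lemma theta_prod_16_Gamma1:
  assumes "12 dvd int k + (\<Sum>j=1..8. a j)" "32 dvd S2 16 a" "A \<in> Gamma1 16" "Im \<tau> > 0"
  shows "slash k (theta_prod 16 (2 * k) a) A \<tau> = theta_prod 16 (2 * k) a \<tau>"
proof -
  have mem: "A $ 1 $ 1 * A $ 2 $ 2 - A $ 1 $ 2 * A $ 2 $ 1 = 1" "A $ 2 $ 1 mod 16 = 0" "A $ 1 $ 1 mod 16 = 1"
    using assms(3) unfolding Gamma1_def SL2Z_def det_2 cong_def by simp_all
  have c: "A $ 2 $ 1 = A $ 2 $ 1 div 16 * int 16" and a11: "A $ 1 $ 1 = 1 + 16 * (A $ 1 $ 1 div 16)"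
    using mem(2,3) by presburger+
  define b where "b = A $ 1 $ 2"
  have detA: "A $ 1 $ 1 * A $ 2 $ 2 - 16 * b * (A $ 2 $ 1 div 16) = 1"
    unfolding b_def using mem(1) by (subst (asm) c) (simp add: mult_ac)
  define m where "m = A $ 1 $ 1 div 16"
  have "\<exists>\<omega>. \<omega> ^ 12 = 1 \<and>
    (\<forall>k a \<tau>. Im \<tau> > 0 \<longrightarrow> slash k (theta_prod 16 (2 * k) a) A \<tau> =
       \<omega> powi (int k + (\<Sum>j=1..16 div 2. a j)) * inverse (of_nat 1 ^ k) *
       (eta_sq ((of_nat 16 ^ 2 * \<tau> + of_int 0 * of_nat 16) / of_nat 16) ^ k *
        (\<Prod>j=1..16 div 2. siegel (of_int (int j * A $ 1 $ 1) / of_nat 16) (of_int (int j * (16 * b)) / of_nat 16)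
          ((of_nat 16 ^ 2 * \<tau> + of_int 0 * of_nat 16) / of_nat 16) powi a j)))"
    by (rule slash_theta_prod[OF _ detA c]) (simp_all add: b_def)
  then obtain \<omega> :: complex where \<omega>: "\<omega> ^ 12 = 1"
     "slash k (theta_prod 16 (2 * k) a) A \<tau> =
       \<omega> powi (int k + (\<Sum>j=1..8. a j)) *
       (eta_sq (16 * \<tau>) ^ k *
        (\<Prod>j=1..8. siegel (of_int (int j * A $ 1 $ 1) / 16) (of_int (int j * b)) (16 * \<tau>) powi a j))"
    using assms(4) by auto
  obtain z where z: "int k + (\<Sum>j=1..8. a j) = 12 * z" using assms(1) by blast
  have \<omega>1: "\<omega> powi (int k + (\<Sum>j=1..8. a j)) = 1"
  proof -
    have "\<omega> powi (12 * z) = (\<omega> powi 12) powi z" by (rule power_int_mult)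
    thus ?thesis unfolding z using \<omega>(1) by simp
  qed
  \<comment> \<open>Exponent collected when j b is removed from the second coordinate and j m from
    the first; signs are written as \<open>expi\<close> of half-integers.\<close>
  define E where "E = (\<lambda>j::nat. complex_of_int (int j * (m + b)) / 2 - of_int (int j ^ 2 * m * b) / 2
      + of_int (int j ^ 2 * b) / 32)"
  have pm: "(-1) powi n = expi (of_int n / 2)" for n :: int
    using expi_power_int[of "1 / 2" n] by simp
  have Im: "Im (16 * \<tau>) > 0" using assms(4) by simp
  have sieg: "siegel (of_int (int j * A $ 1 $ 1) / 16) (of_int (int j * b)) (16 * \<tau>) =
      expi (E j) * siegel (of_nat j / 16) 0 (16 * \<tau>)" for j :: nat
  proof -
    have 1: "complex_of_int (int j * A $ 1 $ 1) / 16 = of_nat j / 16 + of_int (int j * m)"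
      unfolding m_def by (subst a11) (simp add: field_simps)
    have 2: "siegel (of_nat j / 16) (of_int (int j * b)) (16 * \<tau>) =
       (-1) powi (int j * b) * expi (of_int (int j * b) * (of_nat j / 16) / 2) * siegel (of_nat j / 16) 0 (16 * \<tau>)"
      using siegel_plus_of_int_right[of "of_nat j / 16" 0 "int j * b" "16 * \<tau>"] by simp
    have "siegel (of_int (int j * A $ 1 $ 1) / 16) (of_int (int j * b)) (16 * \<tau>) =
      (-1) powi (int j * m) * expi (- of_int (int j * m) * of_int (int j * b) / 2) *
      ((-1) powi (int j * b) * expi (of_int (int j * b) * (of_nat j / 16) / 2)) * siegel (of_nat j / 16) 0 (16 * \<tau>)"
      unfolding 1 siegel_plus_of_int_left[OF Im] 2 by (simp only: mult.assoc)
    also have "(-1) powi (int j * m) * expi (- of_int (int j * m) * of_int (int j * b) / 2) *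
      ((-1) powi (int j * b) * expi (of_int (int j * b) * (of_nat j / 16) / 2)) = expi (E j)"
      unfolding pm expi_add [symmetric] E_def
      by (rule arg_cong[of _ _ expi]) (simp add: field_simps power2_eq_square)
    finally show ?thesis .
  qed
  have "(\<Prod>j=1..8. expi (E j) powi a j) = expi (\<Sum>j=1..8. of_int (a j) * E j)"
    by (simp add: expi_power_int expi_sum)
  also have "\<dots> = 1"
  proof -
    from assms(2) obtain v where v: "S2 16 a = 32 * v" by blast
    \<comment> \<open>\<open>S2 16 a\<close> is 16 P - Q, and P is even, so divisibility by 32
      passes to Q; the term Q b / 32 needs precisely this.\<close>
    define P Q where "P = (\<Sum>j=1..8. int j * a j)" and "Q = (\<Sum>j=1..8. int j ^ 2 * a j)"
    have "even P" unfolding P_def by (rule S2_16_dvd_imp_even[OF assms(2)])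
    then obtain P' where P': "P = 2 * P'" by blast
    have "S2 16 a = 16 * P - Q"
      by (simp add: S2_def P_def Q_def sum_distrib_left sum_subtractf [symmetric] algebra_simps power2_eq_square)
    hence Q: "Q = 32 * (P' - v)" using P' v by simp
    have "(\<Sum>j=1..8. complex_of_int (a j) * E j) =
      of_int P * of_int (m + b) / 2 - of_int Q * of_int (m * b) / 2 + of_int Q * of_int b / 32"
    proof -
      have "complex_of_int (a j) * E j = of_int (int j * a j) * of_int (m + b) / 2 -
          of_int (int j ^ 2 * a j) * of_int (m * b) / 2 + of_int (int j ^ 2 * a j) * of_int b / 32" for j
        by (simp add: E_def field_simps)
      thus ?thesis
        by (simp only: sum.distrib sum_subtractf sum_divide_distrib [symmetric] sum_distrib_right [symmetric]
              of_int_sum [symmetric] P_def Q_def)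
    qed
    also have "\<dots> = of_int (P' * (m + b) - 16 * (P' - v) * m * b + (P' - v) * b)"
      unfolding P' Q by (simp add: field_simps)
    finally show ?thesis by (simp only: expi_of_int)
  qed
  finally have "(\<Prod>j=1..8. expi (E j) powi a j) = 1" .
  thus ?thesis
    unfolding \<omega>(2) \<omega>1 theta_prod_eq_siegel[of 16 k a \<tau>, simplified] sieg
    by (simp add: power_int_mult_distrib prod.distrib)
qed

text \<open>For each D dividing 16, c runs through the units modulo D up to sign, on which alone the
  order depends.\<close>

definition admissible :: "nat \<Rightarrow> (nat \<Rightarrow> int) \<Rightarrow> bool" where
  "admissible k a \<longleftrightarrow> 12 dvd int k + (\<Sum>j=1..8. a j) \<and> 32 dvd S2 16 a \<and>
     (\<forall>(D, c) \<in> {(1, 1), (2, 1), (4, 1), (8, 1), (8, 3), (16, 1), (16, 3), (16, 5), (16, 7)}.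
        cusp_order k 16 a D c \<ge> 0)"

lemma cusp_order_mod: "cusp_order k N a D (c mod int D) = cusp_order k N a D c"
  by (simp add: cusp_order_def mod_mult_right_eq)

text \<open>This is the symmetry B_2(1 - x) = B_2(x).\<close>

lemma cusp_order_minus:
  assumes "D > 0"
  shows "cusp_order k N a D (- c) = cusp_order k N a D c"
proof -
  have "(real (nat (int j * - c mod int D)) / real D)\<^sup>2 / 2 - real (nat (int j * - c mod int D)) / real D / 2 =
        (real (nat (int j * c mod int D)) / real D)\<^sup>2 / 2 - real (nat (int j * c mod int D)) / real D / 2" for j :: nat
  proof (cases "int j * c mod int D = 0")
    case False
    define r where "r = int j * c mod int D"
    have r: "0 \<le> r" "r < int D" using assms by (simp_all add: r_def)
    have m: "int j * - c mod int D = int D - r"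
      using False by (simp add: zmod_zminus1_eq_if r_def)
    have n: "real (nat (int D - r)) = real D - real_of_int r" "real (nat r) = real_of_int r" using r by simp_all
    show ?thesis using assms unfolding m r_def [symmetric] n by (simp add: field_simps power2_eq_square)
  qed (simp add: zmod_zminus1_eq_if)
  thus ?thesis by (simp add: cusp_order_def)
qed

lemma cusp_order_cong_minus:
  assumes "D > 0" "(c + c') mod int D = 0"
  shows "cusp_order k N a D c' = cusp_order k N a D c"
proof -
  have "c' mod int D = - c mod int D"
    using assms(2) by (simp add: mod_eq_dvd_iff mod_eq_0_iff_dvd add.commute)
  hence "cusp_order k N a D c' = cusp_order k N a D (- c)"
    by (metis cusp_order_mod)
  thus ?thesis using cusp_order_minus[OF assms(1)] by simp
qed

lemma admissible_imp_cusp_order_nonneg: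
  assumes "admissible k a" "D dvd 16" "odd c \<or> D = 1"
  shows "cusp_order k 16 a D c \<ge> 0"
proof -
  have cusp: "cusp_order k 16 a D c \<ge> 0" 
    if "(D, c) \<in> {(1, 1), (2, 1), (4, 1), (8, 1), (8, 3), (16, 1), (16, 3), (16, 5), (16, 7)}" for D c
    using bspec[OF conjunct2[OF conjunct2[OF assms(1)[unfolded admissible_def]]] that] by simp
  have sym: "cusp_order k 16 a D c' \<ge> 0"
    if "(D, c', c) \<in> {(1, 0, 1), (4, 3, 1), (8, 7, 1), (8, 5, 3), (16, 15, 1), (16, 13, 3), (16, 11, 5), (16, 9, 7)}" for D :: nat and c c' :: int
  proof -
    have "D > 0" "(c + c') mod int D = 0 \<or> D = 1"
        "(D, c) \<in> {(1, 1), (2, 1), (4, 1), (8, 1), (8, 3), (16, 1), (16, 3), (16, 5), (16, 7)}"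
      using that by auto
    thus ?thesis using cusp[of D c] cusp_order_cong_minus[of D c c' k 16 a] by auto
  qed
  have D: "D \<in> {1, 2, 4, 8, 16}" by (rule dvd_16_cases[OF assms(2)])
  have c2: "c mod 2 = 1" if "D \<noteq> 1" using assms(3) that by presburger
  have all: "cusp_order k 16 a D c \<ge> 0"
    if "(D, c) \<in> {(1, 0), (2, 1), (4, 1), (4, 3), (8, 1), (8, 3), (8, 5), (8, 7), (16, 1), (16, 3), (16, 5), (16, 7),
      (16, 9), (16, 11), (16, 13), (16, 15)}" for D :: nat and c :: int
    using that cusp[of D c] sym[of D c 1] sym[of D c 3] sym[of D c 5] sym[of D c 7] by auto
  have key: "cusp_order k 16 a D c \<ge> 0" if "c mod int D = c0" "cusp_order k 16 a D c0 \<ge> 0" for c0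
    using that cusp_order_mod by metis
  have "(D = 1 \<and> c mod int D = 0) \<or> (D = 2 \<and> c mod int D = 1) \<or> (D = 4 \<and> (c mod int D = 1 \<or> c mod int D = 3)) \<or>
     (D = 8 \<and> (c mod int D = 1 \<or> c mod int D = 3 \<or> c mod int D = 5 \<or> c mod int D = 7)) \<or>
     (D = 16 \<and> (c mod int D = 1 \<or> c mod int D = 3 \<or> c mod int D = 5 \<or> c mod int D = 7 \<or>
         c mod int D = 9 \<or> c mod int D = 11 \<or> c mod int D = 13 \<or> c mod int D = 15))"
      using D
    proof (elim insertE)
      assume "D = 1" thus ?thesis by simp
    next
      assume "D = 2" thus ?thesis using c2 by simp
    next
      assume "D = 4" 
      moreover have "c mod 4 = 1 \<or> c mod 4 = 3" using c2 \<open>D = 4\<close> by simp presburger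
      ultimately show ?thesis by simp
    next
      assume "D = 8" 
      moreover have "c mod 8 = 1 \<or> c mod 8 = 3 \<or> c mod 8 = 5 \<or> c mod 8 = 7" using c2 \<open>D = 8\<close> by simp presburger
      ultimately show ?thesis by simp
    next
      assume "D = 16" 
      moreover have "c mod 16 = 1 \<or> c mod 16 = 3 \<or> c mod 16 = 5 \<or> c mod 16 = 7 \<or>
         c mod 16 = 9 \<or> c mod 16 = 11 \<or> c mod 16 = 13 \<or> c mod 16 = 15" using c2 \<open>D = 16\<close> by simp presburger
      ultimately show ?thesis by simp
    qed simp
  note cases = this
  show ?thesis
    by (insert cases, elim disjE conjE; (rule key, assumption, rule all, simp))
qed

lemma expi_eq_exp_divide: "exp (2 * of_real pi * \<i> * \<tau> / of_nat N) = expi (\<tau> / of_nat N)"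
  by (simp add: expi_def)

lemma theta_prod_16_modular_iff:
  "theta_prod 16 (2 * k) a \<in> modular_forms_Gamma1 k 16 \<longleftrightarrow> admissible k a"
proof
  define f where "f = theta_prod 16 (2 * k) a"
  have hol_cusps: "holomorphic_at_cusps k 16 f \<longleftrightarrow> (\<forall>A\<in>SL2Z. \<exists>n::nat.
      real (nat (gcd (A $ 2 $ 1) 16)) ^ 2 * cusp_order k 16 a (nat (gcd (A $ 2 $ 1) 16)) (A $ 1 $ 1) = of_nat n)"
    unfolding holomorphic_at_cusps_def upper_half_plane_def
  proof (intro ball_cong refl)
    fix A :: "int ^ 2 ^ 2" assume "A \<in> SL2Z"
    define D where "D = nat (gcd (A $ 2 $ 1) 16)"
    have "cusp_exponent 16 (real D ^ 2 / real 16 * cusp_order k 16 a D (A $ 1 $ 1)) (slash k f A)"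
      using cusp_exponent_slash_theta_prod[OF _ \<open>A \<in> SL2Z\<close>, of 16 k a] by (simp add: D_def f_def)
    from cusp_exponent_holomorphic_at_cusp_iff[OF this]
    have "(\<exists>F. F holomorphic_on ball 0 1 \<and> (\<forall>\<tau>. Im \<tau> > 0 \<longrightarrow> slash k f A \<tau> = F (expi (\<tau> / of_nat 16)))) \<longleftrightarrow>
       (\<exists>n::nat. real D ^ 2 * cusp_order k 16 a D (A $ 1 $ 1) = of_nat n)"
      by simp
    thus "(\<exists>F. F holomorphic_on ball 0 1 \<and>
          (\<forall>\<tau>\<in>{\<tau>. 0 < Im \<tau>}. slash k f A \<tau> = F (exp (2 * complex_of_real pi * \<i> * \<tau> / of_nat 16)))) \<longleftrightarrow>
       (\<exists>n::nat. real (nat (gcd (A $ 2 $ 1) 16)) ^ 2 * cusp_order k 16 a (nat (gcd (A $ 2 $ 1) 16)) (A $ 1 $ 1) = of_nat n)"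
      unfolding expi_eq_exp_divide D_def [symmetric] Ball_Collect [symmetric] by simp
  qed
  {
    assume "theta_prod 16 (2 * k) a \<in> modular_forms_Gamma1 k 16"
    hence mod: "\<And>A \<tau>. A \<in> Gamma1 16 \<Longrightarrow> Im \<tau> > 0 \<Longrightarrow> slash k f A \<tau> = f \<tau>" "holomorphic_at_cusps k 16 f"
      unfolding modular_forms_Gamma1_def f_def upper_half_plane_def by auto
    have cusp: "\<exists>n::nat. real D ^ 2 * cusp_order k 16 a D p = of_nat n"
      if "p * s - q * r = 1" "nat (gcd r 16) = D" for p q r s :: int and D
    proof -
      define A :: "int ^ 2 ^ 2" where "A = vector [vector [p, q], vector [r, s]]"
      have "A \<in> SL2Z" using that by (simp add: SL2Z_def A_def det_2)
      with mod(2) have "\<exists>n::nat. real (nat (gcd (A $ 2 $ 1) 16)) ^ 2 * cusp_order k 16 a (nat (gcd (A $ 2 $ 1) 16)) (A $ 1 $ 1) = of_nat n"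
        unfolding hol_cusps by blast
      thus ?thesis using that(2) by (simp add: A_def)
    qed
    have nonneg: "cusp_order k 16 a D p \<ge> 0" 
      if "p * s - q * r = 1" "nat (gcd r 16) = D" "D > 0" for p q r s :: int and D
    proof -
      from cusp[OF that(1,2)] obtain n :: nat where "real D ^ 2 * cusp_order k 16 a D p = of_nat n" by blast
      hence "real D ^ 2 * cusp_order k 16 a D p \<ge> 0" by simp
      thus ?thesis using that(3) by (simp add: zero_le_mult_iff)
    qed
    \<comment> \<open>For D = 1 all residues are 0, so the order is (k + sum a_j) / 12, and
      holomorphy at the cusp makes it an integer.\<close>
    have "12 dvd int k + (\<Sum>j=1..8. a j)"
    proof -
      obtain n :: nat where n: "real 1 ^ 2 * cusp_order k 16 a 1 1 = of_nat n"
        using cusp[of 1 1 0 1 1] by auto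
      have "cusp_order k 16 a 1 1 = real_of_int (int k + (\<Sum>j=1..8. a j)) / 12"
        by (simp add: cusp_order_def add_divide_distrib sum_divide_distrib)
      hence "real_of_int (int k + (\<Sum>j=1..8. a j)) = of_int (12 * int n)" using n by simp
      thus ?thesis unfolding of_int_eq_iff by (metis dvd_triv_left)
    qed
    \<comment> \<open>Translation by 1 lies in Gamma_1(16), so the leading exponent in q is an
      integer.\<close>
    moreover have "32 dvd S2 16 a"
    proof -
      define A :: "int ^ 2 ^ 2" where "A = vector [vector [1, 1], vector [0, 1]]"
      have "A \<in> Gamma1 16" by (simp add: Gamma1_def SL2Z_def A_def det_2)
      hence "f (\<tau> + 1) = f \<tau>" if "Im \<tau> > 0" for \<tau>
        using mod(1)[of A \<tau>] that by (simp add: slash_def moebius_def A_def)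
      hence "\<exists>n::int. of_nat 1 * (real 16 / 24 * of_int (S1 16 (2 * k) a)
          - 1 / (2 * real 16) * of_int (S2 16 a)) = of_int n"
        unfolding f_def by (intro cusp_exponent_periodic_imp_int[OF cusp_exponent_1_theta_prod]) auto
      then obtain n :: int where "2 / 3 * real_of_int (S1 16 (2 * k) a) - 1 / 32 * of_int (S2 16 a) = of_int n" by auto
      hence "real_of_int (64 * S1 16 (2 * k) a - 3 * S2 16 a) = of_int (96 * n)" by (simp add: field_simps)
      hence "64 * S1 16 (2 * k) a - 3 * S2 16 a = 96 * n" unfolding of_int_eq_iff .
      \<comment> \<open>11 inverts 3 modulo 32: the relation gives 33 S2 = 32 * 11 (2 S1 - 3
        n).\<close>
      hence "S2 16 a = 32 * (11 * (2 * S1 16 (2 * k) a - 3 * n) - S2 16 a)" by algebra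
      thus ?thesis by (rule dvdI)
    qed
    \<comment> \<open>In each case the numbers complete the column (c, D) to a matrix of determinant
      1.\<close>
    moreover have "cusp_order k 16 a 1 1 \<ge> 0" by (rule nonneg[of 1 1 0 1]) auto
    moreover have "cusp_order k 16 a 2 1 \<ge> 0" by (rule nonneg[of 1 1 0 2]) auto
    moreover have "cusp_order k 16 a 4 1 \<ge> 0" by (rule nonneg[of 1 1 0 4]) auto
    moreover have "cusp_order k 16 a 8 1 \<ge> 0" by (rule nonneg[of 1 1 0 8]) auto
    moreover have "cusp_order k 16 a 8 3 \<ge> 0" by (rule nonneg[of 3 3 1 8]) auto
    moreover have "cusp_order k 16 a 16 1 \<ge> 0" by (rule nonneg[of 1 1 0 16]) auto
    moreover have "cusp_order k 16 a 16 3 \<ge> 0" by (rule nonneg[of 3 11 2 16]) auto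
    moreover have "cusp_order k 16 a 16 5 \<ge> 0" by (rule nonneg[of 5 13 4 16]) auto
    moreover have "cusp_order k 16 a 16 7 \<ge> 0" by (rule nonneg[of 7 7 3 16]) auto
    ultimately show "admissible k a" unfolding admissible_def by auto
  }
  assume adm: "admissible k a"
  hence int: "12 dvd int k + (\<Sum>j=1..8. a j)" "32 dvd S2 16 a" by (auto simp: admissible_def)
  have "f holomorphic_on upper_half_plane"
    unfolding upper_half_plane_def f_def
    by (rule cusp_exponent_holomorphic[OF cusp_exponent_1_theta_prod]) auto
  moreover have "\<forall>A\<in>Gamma1 16. \<forall>\<tau>\<in>upper_half_plane. slash k f A \<tau> = f \<tau>"
    using theta_prod_16_Gamma1[OF int] by (auto simp: f_def upper_half_plane_def)
  moreover have "holomorphic_at_cusps k 16 f"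
    unfolding hol_cusps
  proof
    fix A :: "int ^ 2 ^ 2" assume "A \<in> SL2Z"
    define D where "D = nat (gcd (A $ 2 $ 1) 16)"
    have D: "D dvd 16" using gcd_dvd2[of "A $ 2 $ 1" 16] by (simp add: D_def nat_dvd_iff)
    \<comment> \<open>The entries of the first column are coprime: if the upper one is even, the
      lower one is odd and hence prime to 16.\<close>
    have "odd (A $ 1 $ 1) \<or> D = 1"
    proof (rule ccontr)
      assume "\<not> ?thesis"
      hence "even (A $ 1 $ 1)" "D \<noteq> 1" by auto
      moreover have "A $ 1 $ 1 * A $ 2 $ 2 - A $ 1 $ 2 * A $ 2 $ 1 = 1"
        using \<open>A \<in> SL2Z\<close> by (simp add: SL2Z_def det_2)
      ultimately have "odd (A $ 2 $ 1)" by (metis dvd_diff dvd_mult dvd_mult2 odd_one)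
      hence "coprime (A $ 2 $ 1) (2 ^ 4)" by (subst coprime_power_right_iff) auto
      hence "D = 1" by (simp add: D_def)
      with \<open>D \<noteq> 1\<close> show False by simp
    qed
    then obtain n :: int where n: "real D ^ 2 * cusp_order k 16 a D (A $ 1 $ 1) = of_int n"
      using cusp_order_integral[OF int D] by blast
    have "cusp_order k 16 a D (A $ 1 $ 1) \<ge> 0"
      by (rule admissible_imp_cusp_order_nonneg[OF adm D]) fact
    hence "real_of_int n \<ge> 0" unfolding n [symmetric] by simp
    thus "\<exists>n::nat. real (nat (gcd (A $ 2 $ 1) 16)) ^ 2 * cusp_order k 16 a (nat (gcd (A $ 2 $ 1) 16)) (A $ 1 $ 1) = of_nat n"
      using n unfolding D_def by (intro exI[of _ "nat n"]) simp
  qed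
  ultimately show "theta_prod 16 (2 * k) a \<in> modular_forms_Gamma1 k 16"
    by (simp add: modular_forms_Gamma1_def f_def)
qed

section \<open>Counting divisors\<close>

text \<open>An element of degree c + 1 either satisfies \<open>Q\<close> or is the image of a unique
  element of degree c. For generating functions this is a factor 1 / (1 - x).\<close>

lemma card_peel:
  fixes S :: "nat \<Rightarrow> 'a set"
  assumes fin: "\<And>c. finite (S c)" and inj: "inj \<phi>"
    and shift: "\<And>c t. t \<in> S c \<Longrightarrow> \<phi> t \<in> S (Suc c) \<and> \<not> Q (\<phi> t)"
    and unshift: "\<And>c t. t \<in> S c \<Longrightarrow> \<not> Q t \<Longrightarrow> \<exists>c' t'. c = Suc c' \<and> t' \<in> S c' \<and> t = \<phi> t'"
  shows "card (S c) = (\<Sum>j\<le>c. card {t \<in> S j. Q t})"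
proof (induction c)
  case 0
  have "S 0 = {t \<in> S 0. Q t}" using unshift[of _ 0] by auto
  thus ?case by simp
next
  case (Suc c)
  have "S (Suc c) = {t \<in> S (Suc c). Q t} \<union> \<phi> ` S c"
    using shift unshift[of _ "Suc c"] by blast
  moreover have "{t \<in> S (Suc c). Q t} \<inter> \<phi> ` S c = {}" using shift by blast
  ultimately have "card (S (Suc c)) = card {t \<in> S (Suc c). Q t} + card (\<phi> ` S c)"
    using fin by (metis card_Un_disjoint finite_Un)
  also have "card (\<phi> ` S c) = card (S c)" using inj by (simp add: card_image inj_on_subset)
  finally show ?case using Suc by simp
qed

text \<open>
  \<open>x\<^sub>b\<close> stands for the order at the cusp \<open>b/16\<close>, \<open>y\<^sub>b\<close> for the order at \<open>b/8\<close>, and \<open>z\<^sub>D\<close> for the order at \<open>1/D\<close>.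
\<close>

type_synonym orders = "nat \<times> nat \<times> nat \<times> nat \<times> nat \<times> nat \<times> nat \<times> nat \<times> nat"

lemma orders_cases:
  fixes t :: orders
  obtains x1 x3 x5 x7 y1 y3 z4 z2 z1 where "t = (x1, x3, x5, x7, y1, y3, z4, z2, z1)"
proof (cases t rule: prod_cases7)
  case (fields a b c d e f g)
  thus ?thesis using that by (cases g) auto
qed

text \<open>With c = 2k the equation is the valence formula in weight k: 8k zeros, where 2, 2, 4 are
  the numbers of cusps of Gamma_1(16) sharing the order z4, z2, z1. The congruences express that the
  exponents solved from the orders are integers.\<close>

definition sols :: "nat \<Rightarrow> orders set" where
  "sols c = {(x1, x3, x5, x7, y1, y3, z4, z2, z1).
     x1 + x3 + x5 + x7 + y1 + y3 + 2 * z4 + 2 * z2 + 4 * z1 = 4 * c \<and>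
     even (x3 + x5 + y1 + z4) \<and> even (x3 + x5 + y3 + z2) \<and> 5 dvd 3 * x1 + x3 + 4 * x5 + 2 * x7}"

lemma finite_sols: "finite (sols c)"
proof (rule finite_subset)
  show "sols c \<subseteq> {..4*c} \<times> {..4*c} \<times> {..4*c} \<times> {..4*c} \<times> {..4*c} \<times> {..4*c} \<times> {..4*c} \<times> {..4*c} \<times> {..4*c}"
    by (auto simp: sols_def)
qed auto

text \<open>The seven conditions say that the respective vector in \<open>card_sols_eq_psum\<close>
  cannot be subtracted without leaving the nonnegative vectors.\<close>

definition red1 :: "orders \<Rightarrow> bool" where "red1 = (\<lambda>(x1, x3, x5, x7, y1, y3, z4, z2, z1). z1 = 0)"
definition red2 :: "orders \<Rightarrow> bool" where "red2 = (\<lambda>(x1, x3, x5, x7, y1, y3, z4, z2, z1). z2 < 2)"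
definition red3 :: "orders \<Rightarrow> bool" where "red3 = (\<lambda>(x1, x3, x5, x7, y1, y3, z4, z2, z1). z4 < 2)"
definition red4 :: "orders \<Rightarrow> bool" where "red4 = (\<lambda>(x1, x3, x5, x7, y1, y3, z4, z2, z1). y1 < 4)"
definition red5 :: "orders \<Rightarrow> bool" where "red5 = (\<lambda>(x1, x3, x5, x7, y1, y3, z4, z2, z1). y3 < 4)"
definition red6 :: "orders \<Rightarrow> bool" where "red6 = (\<lambda>(x1, x3, x5, x7, y1, y3, z4, z2, z1). min x1 x7 < 2)"
definition red7 :: "orders \<Rightarrow> bool" where "red7 = (\<lambda>(x1, x3, x5, x7, y1, y3, z4, z2, z1). min x3 x5 < 2)"

lemmas red_defs = red1_def red2_def red3_def red4_def red5_def red6_def red7_def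

fun shift :: "orders \<Rightarrow> orders \<Rightarrow> orders" where
  "shift (u1, u3, u5, u7, v1, v3, w4, w2, w1) (x1, x3, x5, x7, y1, y3, z4, z2, z1) =
     (x1 + u1, x3 + u3, x5 + u5, x7 + u7, y1 + v1, y3 + v3, z4 + w4, z2 + w2, z1 + w1)"

lemma inj_shift: "inj (shift u)"
  by (cases u) (auto simp: inj_def)

fun unshift :: "orders \<Rightarrow> orders \<Rightarrow> orders" where
  "unshift (u1, u3, u5, u7, v1, v3, w4, w2, w1) (x1, x3, x5, x7, y1, y3, z4, z2, z1) =
     (x1 - u1, x3 - u3, x5 - u5, x7 - u7, y1 - v1, y3 - v3, z4 - w4, z2 - w2, z1 - w1)"

text \<open>\<open>P\<close> stands for the conditions left by earlier vectors; its invariance means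
  that \<open>u\<close> does not affect what they test. Subtracting \<open>u\<close> lowers c by
  exactly 1 and preserves the congruences.\<close>

lemma card_sols_peel:
  assumes "u \<in> sols 1"
    and Q: "\<And>t. \<not> Q (shift u t)" "\<And>t. \<not> Q t \<Longrightarrow> shift u (unshift u t) = t"
    and P: "\<And>t. P (shift u t) \<longleftrightarrow> P t"
  shows "card {t \<in> sols c. P t} = (\<Sum>j\<le>c. card {t \<in> sols j. P t \<and> Q t})"
proof -
  have sh: "shift u t \<in> sols (Suc c) \<longleftrightarrow> t \<in> sols c" for t c
  proof -
    obtain u1 u3 u5 u7 v1 v3 w4 w2 w1 where u: "u = (u1, u3, u5, u7, v1, v3, w4, w2, w1)" by (rule orders_cases)
    obtain x1 x3 x5 x7 y1 y3 z4 z2 z1 where t: "t = (x1, x3, x5, x7, y1, y3, z4, z2, z1)" by (rule orders_cases)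
    have us: "u1 + u3 + u5 + u7 + v1 + v3 + 2 * w4 + 2 * w2 + 4 * w1 = 4"
      "even (u3 + u5 + v1 + w4)" "even (u3 + u5 + v3 + w2)" "5 dvd 3 * u1 + u3 + 4 * u5 + 2 * u7"
      using assms(1) by (auto simp: u sols_def)
    have "3 * (x1 + u1) + (x3 + u3) + 4 * (x5 + u5) + 2 * (x7 + u7) =
      (3 * x1 + x3 + 4 * x5 + 2 * x7) + (3 * u1 + u3 + 4 * u5 + 2 * u7)" by simp
    hence "5 dvd 3 * (x1 + u1) + (x3 + u3) + 4 * (x5 + u5) + 2 * (x7 + u7) \<longleftrightarrow> 5 dvd 3 * x1 + x3 + 4 * x5 + 2 * x7"
      using us(4) by (simp only: dvd_add_left_iff)
    moreover have "even (x3 + u3 + (x5 + u5) + (y1 + v1) + (z4 + w4)) \<longleftrightarrow> even (x3 + x5 + y1 + z4)"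
      "even (x3 + u3 + (x5 + u5) + (y3 + v3) + (z2 + w2)) \<longleftrightarrow> even (x3 + x5 + y3 + z2)"
      using us(2,3) by auto
    moreover have "x1 + u1 + (x3 + u3) + (x5 + u5) + (x7 + u7) + (y1 + v1) + (y3 + v3) + 2 * (z4 + w4) + 2 * (z2 + w2) +
       4 * (z1 + w1) = 4 * Suc c \<longleftrightarrow> x1 + x3 + x5 + x7 + y1 + y3 + 2 * z4 + 2 * z2 + 4 * z1 = 4 * c"
    proof -
      have e: "x1 + u1 + (x3 + u3) + (x5 + u5) + (x7 + u7) + (y1 + v1) + (y3 + v3) + 2 * (z4 + w4) + 2 * (z2
          + w2) + 4 * (z1 + w1) =
        (x1 + x3 + x5 + x7 + y1 + y3 + 2 * z4 + 2 * z2 + 4 * z1) + (u1 + u3 + u5 + u7 + v1 + v3 + 2 * w4 + 2 * w2 + 4 * w1)"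
        by simp
      show ?thesis unfolding e us(1) by (simp add: add.assoc)
    qed
    ultimately show ?thesis unfolding u t sols_def by (simp only: shift.simps mem_Collect_eq prod.case)
  qed
  have "card {t \<in> sols c. P t} = (\<Sum>j\<le>c. card {t \<in> {t \<in> sols j. P t}. Q t})"
  proof (rule card_peel[where \<phi> = "shift u"])
    fix c t assume t: "t \<in> {t \<in> sols c. P t}" "\<not> Q t"
    have eq: "shift u (unshift u t) = t" by (rule Q(2)[OF t(2)])
    \<comment> \<open>In degree 0 there is only the zero vector, and \<open>u\<close> is not
      zero.\<close>
    have "c \<noteq> 0"
    proof
      assume "c = 0"
      hence "t = (0, 0, 0, 0, 0, 0, 0, 0, 0)" using t by (auto simp: sols_def)
      hence "shift u (unshift u t) \<noteq> t" using assms(1) by (cases u rule: orders_cases) (auto simp: sols_def)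
      with eq show False by contradiction
    qed
    then obtain c' where c': "c = Suc c'" by (cases c) auto
    have "unshift u t \<in> sols c'" "P (unshift u t)"
      using sh[of "unshift u t" c'] P[of "unshift u t"] t(1) eq c' by simp_all
    thus "\<exists>c' t'. c = Suc c' \<and> t' \<in> {t \<in> sols c'. P t} \<and> t = shift u t'"
      using eq c' by (intro exI[of _ c'] exI[of _ "unshift u t"]) simp
  qed (auto simp: sh P Q inj_shift finite_sols)
  also have "\<dots> = (\<Sum>j\<le>c. card {t \<in> sols j. P t \<and> Q t})"
    by (intro sum.cong refl arg_cong[of _ _ card]) auto
  finally show ?thesis .
qed

definition psum :: "(nat \<Rightarrow> 'a::comm_monoid_add) \<Rightarrow> nat \<Rightarrow> 'a" where
  "psum f c = (\<Sum>j\<le>c. f j)"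

definition reduced :: "nat \<Rightarrow> orders set" where
  "reduced c = {t \<in> sols c. red1 t \<and> red2 t \<and> red3 t \<and> red4 t \<and> red5 t \<and> red6 t \<and> red7 t}"

lemma card_sols_eq_psum: "(\<lambda>c. card (sols c)) = (psum ^^ 7) (\<lambda>c. card (reduced c))"
proof -
  \<comment> \<open>Their supports are disjoint and exhaust the nine coordinates. Only x1 - x7 and
    x3 - x5 then remain unbounded as c grows, which leaves a plane counting problem.\<close>
  have u: "(0,0,0,0,0,0,0,0,1) \<in> sols 1" "(0,0,0,0,0,0,0,2,0) \<in> sols 1" "(0,0,0,0,0,0,2,0,0) \<in> sols 1"
    "(0,0,0,0,4,0,0,0,0) \<in> sols 1" "(0,0,0,0,0,4,0,0,0) \<in> sols 1" "(2,0,0,2,0,0,0,0,0) \<in> sols 1"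
    "(0,2,2,0,0,0,0,0,0) \<in> sols 1"
    by (simp_all add: sols_def)
  define S where "S = (\<lambda>P c. card {t \<in> sols c. P t})"
  have peel: "S P = psum (S (\<lambda>t. P t \<and> Q t))"
    if "u \<in> sols 1" "\<And>t. \<not> Q (shift u t)" "\<And>t. \<not> Q t \<Longrightarrow> shift u (unshift u t) = t" "\<And>t. P (shift u t) \<longleftrightarrow> P t"
    for P Q u
    unfolding S_def psum_def by (intro ext card_sols_peel[of u Q P, OF that])
  have "(\<lambda>c. card (sols c)) = S (\<lambda>_. True)" by (simp add: S_def)
  also have "\<dots> = psum (S (\<lambda>t. True \<and> red1 t))"
    by (rule peel[OF u(1)]; rename_tac t, case_tac t rule: orders_cases, auto simp: red_defs)
  also have "S (\<lambda>t. True \<and> red1 t) = psum (S (\<lambda>t. (True \<and> red1 t) \<and> red2 t))"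
    by (rule peel[OF u(2)]; rename_tac t, case_tac t rule: orders_cases, auto simp: red_defs)
  also have "S (\<lambda>t. (True \<and> red1 t) \<and> red2 t) = psum (S (\<lambda>t. ((True \<and> red1 t) \<and> red2 t) \<and> red3 t))"
    by (rule peel[OF u(3)]; rename_tac t, case_tac t rule: orders_cases, auto simp: red_defs)
  also have "S (\<lambda>t. ((True \<and> red1 t) \<and> red2 t) \<and> red3 t) = psum (S (\<lambda>t. (((True \<and> red1 t) \<and> red2 t) \<and> red3 t) \<and> red4 t))"
    by (rule peel[OF u(4)]; rename_tac t, case_tac t rule: orders_cases, auto simp: red_defs)
  also have "S (\<lambda>t. (((True \<and> red1 t) \<and> red2 t) \<and> red3 t) \<and> red4 t) =
      psum (S (\<lambda>t. ((((True \<and> red1 t) \<and> red2 t) \<and> red3 t) \<and> red4 t) \<and> red5 t))"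
    by (rule peel[OF u(5)]; rename_tac t, case_tac t rule: orders_cases, auto simp: red_defs)
  also have "S (\<lambda>t. ((((True \<and> red1 t) \<and> red2 t) \<and> red3 t) \<and> red4 t) \<and> red5 t) =
      psum (S (\<lambda>t. (((((True \<and> red1 t) \<and> red2 t) \<and> red3 t) \<and> red4 t) \<and> red5 t) \<and> red6 t))"
    by (rule peel[OF u(6)]; rename_tac t, case_tac t rule: orders_cases, auto simp: red_defs)
  also have "S (\<lambda>t. (((((True \<and> red1 t) \<and> red2 t) \<and> red3 t) \<and> red4 t) \<and> red5 t) \<and> red6 t) =
      psum (S (\<lambda>t. ((((((True \<and> red1 t) \<and> red2 t) \<and> red3 t) \<and> red4 t) \<and> red5 t) \<and> red6 t) \<and> red7 t))"
    by (rule peel[OF u(7)]; rename_tac t, case_tac t rule: orders_cases, auto simp: red_defs)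
  also have "S (\<lambda>t. ((((((True \<and> red1 t) \<and> red2 t) \<and> red3 t) \<and> red4 t) \<and> red5 t) \<and> red6 t) \<and> red7 t)
      = (\<lambda>c. card (reduced c))"
    by (simp add: S_def reduced_def)
  finally show ?thesis by (simp add: numeral_eq_Suc)
qed

section \<open>Points of a plane lattice with given |d| + |e|\<close>

text \<open>The condition modulo 5 in \<open>sols\<close>, for d = x1 - x7 and e = x3 - x5. It
  describes the ideal generated by 1 + 2i in the Gaussian integers d + e i.\<close>

definition lat :: "int \<Rightarrow> (int \<times> int) set" where
  "lat n = {(d, e). \<bar>d\<bar> + \<bar>e\<bar> = n \<and> 5 dvd e - 2 * d}"

lemma finite_lat: "finite (lat n)"
  by (rule finite_subset[of _ "{-n..n} \<times> {-n..n}"]) (auto simp: lat_def)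

text \<open>Even e and even |d| + |e| make d even, and halving respects the congruence because 2 is
  invertible modulo 5.\<close>

lemma card_lat_even: "card {(d, e) \<in> lat (2 * h). even e} = card (lat h)"
proof -
  have "{(d, e) \<in> lat (2 * h). even e} = (\<lambda>(d, e). (2 * d, 2 * e)) ` lat h"
  proof (intro equalityI subsetI)
    fix p assume "p \<in> {(d, e) \<in> lat (2 * h). even e}"
    then obtain d e where p: "p = (d, e)" "\<bar>d\<bar> + \<bar>e\<bar> = 2 * h" "5 dvd e - 2 * d" "even e"
      by (auto simp: lat_def)
    have "even d" using p(2,4) by presburger
    then obtain d' e' where "d = 2 * d'" "e = 2 * e'" using p(4) by blast
    with p show "p \<in> (\<lambda>(d, e). (2 * d, 2 * e)) ` lat h"
      by (intro image_eqI[of _ _ "(d', e')"]) (auto simp: lat_def, presburger)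
  next
    fix p assume "p \<in> (\<lambda>(d, e). (2 * d, 2 * e)) ` lat h"
    then obtain d e where p: "p = (2 * d, 2 * e)" "\<bar>d\<bar> + \<bar>e\<bar> = h" "5 dvd e - 2 * d"
      by (auto simp: lat_def)
    have "5 dvd 2 * (e - 2 * d)" using p(3) by (rule dvd_mult)
    thus "p \<in> {(d, e) \<in> lat (2 * h). even e}" using p by (auto simp: lat_def algebra_simps)
  qed
  moreover have "inj_on (\<lambda>(d, e). (2 * d, 2 * e :: int)) (lat h)" by (auto simp: inj_on_def)
  ultimately show ?thesis by (simp add: card_image)
qed

text \<open>
  The rotation by a right angle preserves the lattice \<open>e \<equiv> 2d\<close> modulo 5, so all four quadrants contain the
  same number of points.
\<close>

lemma card_lat_pos:
  assumes "n > 0"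
  shows "int (card (lat n)) = 4 * ((n + 2) div 5)"
proof -
  \<comment> \<open>A half-open quadrant, so that its four rotations cover the plane without the
    origin exactly once.\<close>
  define Q where "Q = {(d, e). d > 0 \<and> e \<ge> 0 \<and> d + e = n \<and> 5 dvd e - 2 * d}"
  define r where "r = (\<lambda>(d :: int, e :: int). (- e, d))"
  \<comment> \<open>With d = n - e the congruence becomes 5 | n + e, and m is the quotient. The
    conditions e >= 0 and d > 0 are its two bounds, the strict one giving the - 1.\<close>
  have "Q = (\<lambda>m. (2 * n - 5 * m, 5 * m - n)) ` {(n + 4) div 5..(2 * n - 1) div 5}"
  proof (intro equalityI subsetI)
    fix p assume "p \<in> Q"
    then obtain d e where p: "p = (d, e)" "d > 0" "e \<ge> 0" "d + e = n" "5 dvd e - 2 * d"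
      by (auto simp: Q_def)
    have "5 dvd n + e"
      using p(4,5) by presburger
    then obtain m where m: "n + e = 5 * m" by blast
    have "m \<in> {(n + 4) div 5..(2 * n - 1) div 5}"
      using m p by auto
    moreover have "p = (2 * n - 5 * m, 5 * m - n)" using m p by auto
    ultimately show "p \<in> (\<lambda>m. (2 * n - 5 * m, 5 * m - n)) ` {(n + 4) div 5..(2 * n - 1) div 5}" by blast
  next
    fix p assume "p \<in> (\<lambda>m. (2 * n - 5 * m, 5 * m - n)) ` {(n + 4) div 5..(2 * n - 1) div 5}"
    then obtain m where m: "m \<ge> (n + 4) div 5" "m \<le> (2 * n - 1) div 5" "p = (2 * n - 5 * m, 5 * m - n)" by auto
    have "5 * m - n - 2 * (2 * n - 5 * m) = 5 * (3 * m - n)" by simp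
    hence "5 dvd 5 * m - n - 2 * (2 * n - 5 * m)" by (metis dvd_triv_left)
    moreover have "2 * n - 5 * m > 0" "5 * m - n \<ge> 0" using m(1,2) by presburger+
    ultimately show "p \<in> Q" unfolding Q_def m(3) by simp
  qed
  hence "card Q = card {(n + 4) div 5..(2 * n - 1) div 5}"
    by (simp add: card_image inj_on_def)
  also have "int \<dots> = (n + 2) div 5"
  proof -
    define e f where "e = n div 5" and "f = n mod 5"
    have n: "n = f + e * 5" by (simp add: e_def f_def)
    have e: "e \<ge> 0" using assms by (simp add: e_def pos_imp_zdiv_nonneg_iff)
    have "0 \<le> f" "f < 5" by (simp_all add: f_def)
    have "(2 * n - 1) div 5 = (2 * f - 1 + 2 * e * 5) div 5" "(n + 4) div 5 = (f + 4 + e * 5) div 5"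
      "(n + 2) div 5 = (f + 2 + e * 5) div 5"
      by (simp_all add: n algebra_simps)
    hence divs: "(2 * n - 1) div 5 = 2 * e + (2 * f - 1) div 5" "(n + 4) div 5 = e + (f + 4) div 5"
      "(n + 2) div 5 = e + (f + 2) div 5"
      by (simp_all only: div_mult_self1 zero_neq_numeral [symmetric] not_False_eq_True)
    consider "f = 0" | "f = 1" | "f = 2" | "f = 3" | "f = 4" using \<open>0 \<le> f\<close> \<open>f < 5\<close> by linarith
    thus ?thesis unfolding divs by cases (use e assms n in simp_all)
  qed
  finally have Q: "int (card Q) = (n + 2) div 5" .
  have finQ: "finite Q"
    by (rule finite_subset[of _ "{0..n} \<times> {0..n}"]) (auto simp: Q_def)
  have inj: "inj r" by (auto simp: r_def inj_def)
  have dvd: "5 dvd - e - 2 * - d \<longleftrightarrow> 5 dvd e - 2 * d" "5 dvd d - 2 * - e \<longleftrightarrow> 5 dvd e - 2 * d"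
     "5 dvd - d - 2 * e \<longleftrightarrow> 5 dvd e - 2 * d" for d e :: int
    by presburger+
  have "lat n = Q \<union> r ` Q \<union> r ` r ` Q \<union> r ` r ` r ` Q"
  proof (intro equalityI subsetI)
    fix p assume "p \<in> lat n"
    then obtain d e where p: "p = (d, e)" "\<bar>d\<bar> + \<bar>e\<bar> = n" "5 dvd e - 2 * d" by (auto simp: lat_def)
    consider "d > 0" "e \<ge> 0" | "d \<le> 0" "e > 0" | "d < 0" "e \<le> 0" | "d \<ge> 0" "e < 0"
      using assms p(2) by linarith
    thus "p \<in> Q \<union> r ` Q \<union> r ` r ` Q \<union> r ` r ` r ` Q"
    proof cases
      case 1
      thus ?thesis using p by (auto simp: Q_def)
    next
      case 2
      hence "(e, - d) \<in> Q" using p dvd(3)[of e d] dvd(2)[of e "- d"] by (auto simp: Q_def)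
      moreover have "p = r (e, - d)" by (simp add: p r_def)
      ultimately show ?thesis by blast
    next
      case 3
      hence "(- d, - e) \<in> Q" using p dvd(1)[of e d] by (auto simp: Q_def)
      moreover have "p = r (r (- d, - e))" by (simp add: p r_def)
      ultimately show ?thesis by blast
    next
      case 4
      hence "(- e, d) \<in> Q" using p dvd(2)[of d e] by (auto simp: Q_def)
      moreover have "p = r (r (r (- e, d)))" by (simp add: p r_def)
      ultimately show ?thesis by blast
    qed
  next
    have rlat: "r p \<in> lat n" if "p \<in> lat n" for p
      using that dvd(2) by (auto simp: r_def lat_def)
    have "Q \<subseteq> lat n" by (auto simp: Q_def lat_def)
    hence "r ` Q \<subseteq> lat n" "r ` r ` Q \<subseteq> lat n" "r ` r ` r ` Q \<subseteq> lat n"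
      using rlat by blast+
    thus "p \<in> lat n" if "p \<in> Q \<union> r ` Q \<union> r ` r ` Q \<union> r ` r ` r ` Q" for p
      using that \<open>Q \<subseteq> lat n\<close> by blast
  qed
  moreover have "(Q \<union> r ` Q \<union> r ` r ` Q) \<inter> r ` r ` r ` Q = {}" "(Q \<union> r ` Q) \<inter> r ` r ` Q = {}" "Q \<inter> r ` Q = {}"
    by (auto simp: Q_def r_def)
  ultimately have "card (lat n) = card Q + card (r ` Q) + card (r ` r ` Q) + card (r ` r ` r ` Q)"
    using finQ by (simp add: card_Un_disjoint)
  moreover have "card (r ` X) = card X" for X using inj by (simp add: card_image inj_on_subset)
  ultimately show ?thesis using Q by simp
qed

definition lat_count :: "int \<Rightarrow> int" where
  "lat_count n = int (card (lat n))"

lemma lat_count_eq: "lat_count n = (if n < 0 then 0 else if n = 0 then 1 else 4 * ((n + 2) div 5))"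
proof -
  consider "n < 0" | "n = 0" | "n > 0" by linarith
  thus ?thesis
  proof cases
    case 1
    hence "lat n = {}" by (auto simp: lat_def)
    thus ?thesis using 1 by (simp add: lat_count_def)
  next
    case 2
    hence "lat n = {(0, 0)}" by (auto simp: lat_def)
    thus ?thesis using 2 by (simp add: lat_count_def)
  qed (use card_lat_pos[of n] in \<open>simp add: lat_count_def\<close>)
qed

definition lat_count_parity :: "bool \<Rightarrow> int \<Rightarrow> int" where
  "lat_count_parity b n = int (card {(d, e) \<in> lat n. odd e \<longleftrightarrow> b})"

lemma lat_count_odd: "lat_count_parity True n = lat_count n - lat_count_parity False n"
proof -
  define A where "A = (\<lambda>b. {(d, e) \<in> lat n. odd e \<longleftrightarrow> b})"
  have fin: "finite (A b)" for b
    by (rule finite_subset[OF _ finite_lat[of n]]) (auto simp: A_def)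
  have "lat n = A True \<union> A False" "A True \<inter> A False = {}" by (auto simp: A_def)
  with card_Un_disjoint[OF fin fin this(2)] have "card (lat n) = card (A True) + card (A False)" by simp
  thus ?thesis unfolding lat_count_def lat_count_parity_def A_def by simp
qed

lemma lat_count_even: "lat_count_parity False (2 * h) = lat_count h"
  using card_lat_even[of h] by (simp add: lat_count_parity_def lat_count_def)

text \<open>
  A reduced point is determined by the minima \<open>i = min x\<^sub>1 x\<^sub>7\<close> and \<open>i' = min x\<^sub>3 x\<^sub>5\<close>, the parity \<open>b\<close> of
  \<open>x\<^sub>3 + x\<^sub>5\<close>, \<open>y\<^sub>1\<close>, \<open>y\<^sub>3\<close>, and the differences \<open>d = x\<^sub>1 - x\<^sub>7\<close> and \<open>e = x\<^sub>3 - x\<^sub>5\<close>; \<open>slack\<close> is the part of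
  its degree that does not come from \<open>|d| + |e|\<close>.
\<close>

definition slack :: "bool \<Rightarrow> nat \<Rightarrow> nat \<Rightarrow> nat \<Rightarrow> nat \<Rightarrow> nat" where
  "slack b i i' y1 y3 = 2 * i + 2 * i' + y1 + y3 + 2 * ((of_bool b + y1) mod 2) + 2 * ((of_bool b + y3) mod 2)"

text \<open>The sum runs over the fibres of the parameters. On a fibre z1 = 0 and parity determines
  z4, z2 < 2, so only the lattice point (d, e) is left; e has the parity of x3 + x5.\<close>

lemma card_reduced:
  "int (card (reduced c)) = (\<Sum>b\<in>UNIV. \<Sum>i<2. \<Sum>i'<2. \<Sum>y1<4. \<Sum>y3<4. lat_count_parity b (4 * int c - int (slack b i i' y1 y3)))"
proof -
  define par :: "orders \<Rightarrow> bool \<times> nat \<times> nat \<times> nat \<times> nat" where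
    "par = (\<lambda>(x1, x3, x5, x7, y1, y3, z4, z2, z1). (odd (x3 + x5), min x1 x7, min x3 x5, y1, y3))"
  define P :: "(bool \<times> nat \<times> nat \<times> nat \<times> nat) set" where "P = UNIV \<times> {..<2} \<times> {..<2} \<times> {..<4} \<times> {..<4}"
  have "card (reduced c) = (\<Sum>p\<in>P. card {t \<in> reduced c. par t = p})"
  proof -
    have "par ` reduced c \<subseteq> P"
      by (auto simp: par_def P_def reduced_def red_defs)
    hence "(\<Sum>p\<in>P. \<Sum>t\<in>{t \<in> reduced c. par t = p}. 1) = (\<Sum>t\<in>reduced c. (1::nat))"
      by (intro sum.group) (auto simp: P_def reduced_def finite_sols)
    thus ?thesis by simp
  qed
  also have "int \<dots> = (\<Sum>(b, i, i', y1, y3)\<in>P. lat_count_parity b (4 * int c - int (slack b i i' y1 y3)))"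
    unfolding of_nat_sum
  proof (rule sum.cong)
    fix p assume "p \<in> P"
    then obtain b i i' y1 y3 where p: "p = (b, i, i', y1, y3)" and lt: "i < 2" "i' < 2" "y1 < 4" "y3 < 4"
      by (auto simp: P_def)
    define n where "n = 4 * int c - int (slack b i i' y1 y3)"
    define g :: "orders \<Rightarrow> int \<times> int" where
      "g = (\<lambda>(x1, x3, x5, x7, y1, y3, z4, z2, z1). (int x1 - int x7, int x3 - int x5))"
    define g' :: "int \<times> int \<Rightarrow> orders" where
      "g' = (\<lambda>(d, e). (i + nat d, i' + nat e, i' + nat (- e), i + nat (- d), y1, y3, (of_bool b
          + y1) mod 2, (of_bool b + y3) mod 2, 0))"
    have dvd5: "5 dvd 3 * x1 + x3 + 4 * x5 + 2 * x7 \<longleftrightarrow> 5 dvd (int x3 - int x5) - 2 * (int x1 - int x7)" for x1 x3 x5 x7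
    proof -
      have "5 dvd 3 * x1 + x3 + 4 * x5 + 2 * x7 \<longleftrightarrow> int 5 dvd int (3 * x1 + x3 + 4 * x5 + 2 * x7)"
        by (simp only: int_dvd_int_iff)
      also have "int (3 * x1 + x3 + 4 * x5 + 2 * x7) = (int x3 - int x5) - 2 * (int x1 - int x7)
          + int 5 * (int x1 + int x5)"
        by simp
      also have "int 5 dvd \<dots> \<longleftrightarrow> int 5 dvd (int x3 - int x5) - 2 * (int x1 - int x7)"
        by (rule dvd_add_left_iff) simp
      finally show ?thesis by simp
    qed
    have z: "z = (of_bool (odd u) + y) mod 2" if "even (u + y + z)" "z < 2" for u y z :: nat
      using that by (cases "odd u") (auto simp: less_2_cases_iff mod2_eq_if)
    have "bij_betw g {t \<in> reduced c. par t = p} {(d, e) \<in> lat n. odd e \<longleftrightarrow> b}"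
    proof (rule bij_betw_byWitness[where f' = g'])
      show "\<forall>t\<in>{t \<in> reduced c. par t = p}. g' (g t) = t"
      proof
        fix t assume t: "t \<in> {t \<in> reduced c. par t = p}"
        obtain x1 x3 x5 x7 y1' y3' z4 z2 z1 where te: "t = (x1, x3, x5, x7, y1', y3', z4, z2, z1)" by (rule orders_cases)
        have *: "even (x3 + x5 + y1' + z4)" "even (x3 + x5 + y3' + z2)" "z4 < 2" "z2 < 2" "z1 = 0"
          "b = odd (x3 + x5)" "min x1 x7 = i" "min x3 x5 = i'" "y1' = y1" "y3' = y3"
          using t by (auto simp: te reduced_def red_defs sols_def par_def p)
        have "z4 = (of_bool b + y1) mod 2" "z2 = (of_bool b + y3) mod 2"
          using z[OF *(1,3)] z[OF *(2,4)] unfolding *(6,9,10) by simp_all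
        with * show "g' (g t) = t" by (auto simp: te g_def g'_def)
      qed
    next
      show "\<forall>t\<in>{(d, e) \<in> lat n. odd e \<longleftrightarrow> b}. g (g' t) = t"
        by (auto simp: g_def g'_def)
    next
      show "g ` {t \<in> reduced c. par t = p} \<subseteq> {(d, e) \<in> lat n. odd e \<longleftrightarrow> b}"
      proof (intro image_subsetI)
        fix t assume t: "t \<in> {t \<in> reduced c. par t = p}"
        obtain x1 x3 x5 x7 y1' y3' z4 z2 z1 where te: "t = (x1, x3, x5, x7, y1', y3', z4, z2, z1)" by (rule orders_cases)
        have *: "even (x3 + x5 + y1' + z4)" "even (x3 + x5 + y3' + z2)" "z4 < 2" "z2 < 2" "z1 = 0"
          "b = odd (x3 + x5)" "min x1 x7 = i" "min x3 x5 = i'" "y1' = y1" "y3' = y3"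
          "x1 + x3 + x5 + x7 + y1 + y3 + 2 * z4 + 2 * z2 = 4 * c" "5 dvd 3 * x1 + x3 + 4 * x5 + 2 * x7"
          using t by (auto simp: te reduced_def red_defs sols_def par_def p)
        have z': "z4 = (of_bool b + y1) mod 2" "z2 = (of_bool b + y3) mod 2"
          using z[OF *(1,3)] z[OF *(2,4)] unfolding *(6,9,10) by simp_all
        have "\<bar>int x1 - int x7\<bar> = int x1 + int x7 - 2 * int i" "\<bar>int x3 - int x5\<bar> = int x3 + int x5 - 2 * int i'"
          using *(7,8) by linarith+
        hence "\<bar>int x1 - int x7\<bar> + \<bar>int x3 - int x5\<bar> = n"
          using arg_cong[OF *(11), of int] unfolding n_def slack_def z' [symmetric] by simp
        moreover have "odd (int x3 - int x5) \<longleftrightarrow> b" using *(6) by simp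
        ultimately show "g t \<in> {(d, e) \<in> lat n. odd e \<longleftrightarrow> b}"
          using *(12) unfolding dvd5 by (simp add: te g_def lat_def)
      qed
    next
      show "g' ` {(d, e) \<in> lat n. odd e \<longleftrightarrow> b} \<subseteq> {t \<in> reduced c. par t = p}"
      proof (intro image_subsetI)
        fix q assume "q \<in> {(d, e) \<in> lat n. odd e \<longleftrightarrow> b}"
        then obtain d e where q: "q = (d, e)" "\<bar>d\<bar> + \<bar>e\<bar> = n" "5 dvd e - 2 * d" "odd e \<longleftrightarrow> b"
          by (auto simp: lat_def)
        define x1 x3 x5 x7 z4 z2 where "x1 = i + nat d" and "x3 = i' + nat e" and "x5 = i' + nat (- e)"
          and "x7 = i + nat (- d)" and "z4 = (of_bool b + y1) mod 2" and "z2 = (of_bool b + y3) mod 2"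
        have x: "int x1 + int x7 = 2 * int i + \<bar>d\<bar>" "int x3 + int x5 = 2 * int i' + \<bar>e\<bar>"
          "int x1 - int x7 = d" "int x3 - int x5 = e" "min x1 x7 = i" "min x3 x5 = i'"
          by (auto simp: x1_def x3_def x5_def x7_def)
        have o: "odd (x3 + x5) \<longleftrightarrow> b"
        proof -
          have "odd (int x3 - int x5) \<longleftrightarrow> b" using x q by simp
          thus ?thesis by simp
        qed
        have "int (x1 + x3 + x5 + x7 + y1 + y3 + 2 * z4 + 2 * z2) = int (4 * c)"
          using x(1,2) q(2) unfolding n_def slack_def z4_def [symmetric] z2_def [symmetric] by simp
        hence "x1 + x3 + x5 + x7 + y1 + y3 + 2 * z4 + 2 * z2 = 4 * c" unfolding of_nat_eq_iff .
        moreover have "even (x3 + x5 + y1 + z4)" "even (x3 + x5 + y3 + z2)"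
          using o by (auto simp: z4_def z2_def)
        moreover have "5 dvd 3 * x1 + x3 + 4 * x5 + 2 * x7" unfolding dvd5 x using q(3) .
        ultimately show "g' q \<in> {t \<in> reduced c. par t = p}"
          using o x(5,6) lt
          by (simp add: q g'_def x1_def [symmetric] x3_def [symmetric] x5_def [symmetric] x7_def [symmetric]
               z4_def [symmetric] z2_def [symmetric] reduced_def sols_def red_defs par_def p)
             (simp add: z4_def z2_def)
      qed
    qed
    hence "card {t \<in> reduced c. par t = p} = card {(d, e) \<in> lat n. odd e \<longleftrightarrow> b}"
      by (rule bij_betw_same_card)
    thus "int (card {t \<in> reduced c. par t = p}) = (case p of (b, i, i', y1, y3) \<Rightarrow> lat_count_parity b (4 * int c
        - int (slack b i i' y1 y3)))"
      by (simp add: p lat_count_parity_def n_def)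
  qed simp
  also have "\<dots> = (\<Sum>b\<in>UNIV. \<Sum>i<2. \<Sum>i'<2. \<Sum>y1<4. \<Sum>y3<4. lat_count_parity b (4 * int c - int (slack b i i' y1 y3)))"
    by (simp add: P_def sum.cartesian_product)
  finally show ?thesis .
qed

text \<open>Points with odd e are counted as all points minus those with even e. For odd n the even
  counts cancel between the two values of b; for even n they are counts at n / 2, with the
  differences of the multiplicities as coefficients.\<close>

lemma card_reduced_eq_lat_count:
  "int (card (reduced c)) =
     lat_count (4 * int c - 2) + 2 * lat_count (4 * int c - 3) + 5 * lat_count (4 * int c - 4) + 8 * lat_count (4 * int c - 5) +
     10 * lat_count (4 * int c - 6) + 12 * lat_count (4 * int c - 7) + 10 * lat_count (4 * int c - 8) + 8 * lat_count (4 * int c - 9) +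
     5 * lat_count (4 * int c - 10) + 2 * lat_count (4 * int c - 11) + lat_count (4 * int c - 12) +
     lat_count (2 * int c) + 3 * lat_count (2 * int c - 1) + lat_count (2 * int c - 2) - 5 * lat_count (2 * int c - 3)
     - 5 * lat_count (2 * int c - 4) + lat_count (2 * int c - 5) + 3 * lat_count (2 * int c - 6) + lat_count (2 * int c - 7)"
proof -
  have ev: "lat_count_parity False (4 * int c) = lat_count (2 * int c)"
       "lat_count_parity False (4 * int c - 2) = lat_count (2 * int c - 1)" "lat_count_parity False (4 * int c - 4) = lat_count (2 * int c - 2)"
       "lat_count_parity False (4 * int c - 6) = lat_count (2 * int c - 3)" "lat_count_parity False (4 * int c - 8) = lat_count (2 * int c - 4)"
       "lat_count_parity False (4 * int c - 10) = lat_count (2 * int c - 5)" "lat_count_parity False (4 * int c - 12) = lat_count (2 * int c - 6)"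
       "lat_count_parity False (4 * int c - 14) = lat_count (2 * int c - 7)"
    using lat_count_even[of "2 * int c"] lat_count_even[of "2 * int c - 1"] lat_count_even[of "2 * int c - 2"] lat_count_even[of "2 * int c - 3"]
      lat_count_even[of "2 * int c - 4"] lat_count_even[of "2 * int c - 5"] lat_count_even[of "2 * int c - 6"] lat_count_even[of "2 * int c - 7"]
    by (simp_all add: algebra_simps)
  have lt: "{..<2::nat} = {0, 1}" "{..<4::nat} = {0, 1, 2, 3}" by auto
  show ?thesis
    unfolding card_reduced slack_def lt UNIV_bool by (simp add: lat_count_odd ev)
qed

section \<open>Verification of the closed formula by seventh differences\<close>

text \<open>The convention f(-1) = 0 makes the difference undo \<open>psum\<close> also at
  0.\<close>

definition nabla :: "(nat \<Rightarrow> real) \<Rightarrow> nat \<Rightarrow> real" where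
  "nabla f c = f c - (if c = 0 then 0 else f (c - 1))"

lemma psum_nabla: "psum (nabla f) = f"
proof
  show "psum (nabla f) c = f c" for c
    by (induction c) (simp_all add: psum_def nabla_def)
qed

lemma psum_nabla_funpow: "(psum ^^ n) ((nabla ^^ n) f) = f"
proof (induction n arbitrary: f)
  case (Suc n)
  have "(psum ^^ Suc n) ((nabla ^^ Suc n) f) = psum ((psum ^^ n) ((nabla ^^ n) (nabla f)))"
    by (simp add: funpow_swap1)
  thus ?case by (simp add: Suc.IH psum_nabla)
qed simp

lemma of_nat_psum_funpow: "(\<lambda>c. real ((psum ^^ n) f c)) = (psum ^^ n) (\<lambda>c. real (f c))"
proof (induction n)
  case (Suc n)
  have "(\<lambda>c. real ((psum ^^ Suc n) f c)) = psum (\<lambda>c. real ((psum ^^ n) f c))"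
    by (simp add: psum_def fun_eq_iff)
  thus ?case by (simp add: Suc.IH)
qed simp

lemma nabla_7_shift:
  "(nabla ^^ 7) f (m + 7) = f (m + 7) - 7 * f (m + 6) + 21 * f (m + 5) - 35 * f (m + 4) + 35 * f (m + 3)
     - 21 * f (m + 2) + 7 * f (m + 1) - f m"
proof -
  have *: "nabla g (Suc j) = g (Suc j) - g j" for g j by (simp add: nabla_def)
  show ?thesis by (simp add: numeral_eq_Suc *)
qed

lemma nabla_7_small:
  "(nabla ^^ 7) f 0 = f 0" 
  "(nabla ^^ 7) f 1 = f 1 - 7 * f 0"
  "(nabla ^^ 7) f 2 = f 2 - 7 * f 1 + 21 * f 0"
  "(nabla ^^ 7) f 3 = f 3 - 7 * f 2 + 21 * f 1 - 35 * f 0"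
  "(nabla ^^ 7) f 4 = f 4 - 7 * f 3 + 21 * f 2 - 35 * f 1 + 35 * f 0"
  "(nabla ^^ 7) f 5 = f 5 - 7 * f 4 + 21 * f 3 - 35 * f 2 + 35 * f 1 - 21 * f 0"
  "(nabla ^^ 7) f 6 = f 6 - 7 * f 5 + 21 * f 4 - 35 * f 3 + 35 * f 2 - 21 * f 1 + 7 * f 0"
proof -
  have *: "nabla g (Suc j) = g (Suc j) - g j" "nabla g 0 = g 0" for g j by (simp_all add: nabla_def)
  show "(nabla ^^ 7) f 0 = f 0" 
    "(nabla ^^ 7) f 1 = f 1 - 7 * f 0"
    "(nabla ^^ 7) f 2 = f 2 - 7 * f 1 + 21 * f 0"
    "(nabla ^^ 7) f 3 = f 3 - 7 * f 2 + 21 * f 1 - 35 * f 0"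
    "(nabla ^^ 7) f 4 = f 4 - 7 * f 3 + 21 * f 2 - 35 * f 1 + 35 * f 0"
    "(nabla ^^ 7) f 5 = f 5 - 7 * f 4 + 21 * f 3 - 35 * f 2 + 35 * f 1 - 21 * f 0"
    "(nabla ^^ 7) f 6 = f 6 - 7 * f 5 + 21 * f 4 - 35 * f 3 + 35 * f 2 - 21 * f 1 + 7 * f 0"
    by (simp_all add: numeral_eq_Suc *)
qed

text \<open>These are \<open>T16\<close> and \<open>E16\<close> at \<open>c/2\<close>, where \<open>c\<close> is also allowed to be odd.\<close>

definition count_poly :: "real \<Rightarrow> real" where
  "count_poly x = 8 / 1575 * x ^ 8 + 16 / 225 * x ^ 7 + 31 / 75 * x ^ 6 + 581 / 450 * x ^ 5 + 479 / 200 * x ^ 4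
     + 2569 / 900 * x ^ 3 + 33851 / 12600 * x\<^sup>2 + 137 / 60 * x + 109 / 125"

definition count_formula :: "nat \<Rightarrow> real" where
  "count_formula c = count_poly (real c) + (if c mod 5 = 2 then - 64 / 125 else 16 / 125)"

text \<open>The degree drops from 8 to 1; the slope is 8! times the leading coefficient
  8/1575.\<close>

lemma count_poly_difference_7:
  "count_poly (x + 7) - 7 * count_poly (x + 6) + 21 * count_poly (x + 5) - 35 * count_poly (x + 4)
     + 35 * count_poly (x + 3) - 21 * count_poly (x + 2) + 7 * count_poly (x + 1) - count_poly x = 5376 / 5 + 1024 / 5 * x"
  unfolding count_poly_def by algebra

text \<open>The bound on d keeps 4 d - 12 and 2 d - 7 positive, away from the exceptional values in
  \<open>lat_count_eq\<close>.\<close>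

lemma lat_count_progression:
  assumes "d \<ge> 4"
  shows "0 \<le> w \<Longrightarrow> w \<le> 12 \<Longrightarrow> lat_count (4 * int (5 * e + d) - w) = 16 * int e + 4 * ((4 * int d - w + 2) div 5)"
    and "0 \<le> w \<Longrightarrow> w \<le> 7 \<Longrightarrow> lat_count (2 * int (5 * e + d) - w) = 8 * int e + 4 * ((2 * int d - w + 2) div 5)"
proof -
  have "lat_count (4 * int (5 * e + d) - w) = 4 * ((4 * int d - w + 2 + 4 * int e * 5) div 5)" if "0 \<le> w" "w \<le> 12"
    using that assms by (subst lat_count_eq) (simp add: algebra_simps)
  thus "0 \<le> w \<Longrightarrow> w \<le> 12 \<Longrightarrow> lat_count (4 * int (5 * e + d) - w) = 16 * int e + 4 * ((4 * int d - w + 2) div 5)"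
    by (subst (asm) div_mult_self1) auto
  have "lat_count (2 * int (5 * e + d) - w) = 4 * ((2 * int d - w + 2 + 2 * int e * 5) div 5)" if "0 \<le> w" "w \<le> 7"
    using that assms by (subst lat_count_eq) (simp add: algebra_simps)
  thus "0 \<le> w \<Longrightarrow> w \<le> 7 \<Longrightarrow> lat_count (2 * int (5 * e + d) - w) = 8 * int e + 4 * ((2 * int d - w + 2) div 5)"
    by (subst (asm) div_mult_self1) auto
qed

text \<open>For c >= 7 both sides are linear on each residue class modulo 5. Below 7 the differences
  reach past 0 and exceptional values of \<open>lat_count\<close> can occur, so these cases are
  evaluated singly.\<close>

lemma nabla_7_count_formula: "(nabla ^^ 7) count_formula c = real (card (reduced c))"
proof -
  have real_card: "real (card (reduced c)) = of_int (int (card (reduced c)))" for c by simp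
  show ?thesis
  proof (cases "c < 7")
    case True
    then consider "c = 0" | "c = 1" | "c = 2" | "c = 3" | "c = 4" | "c = 5" | "c = 6" by linarith
    thus ?thesis
      unfolding real_card card_reduced_eq_lat_count
      by cases (simp_all only: nabla_7_small, simp_all add: count_formula_def count_poly_def lat_count_eq)
  next
    case False
    define e f where "e = (c - 7) div 5" and "f = (c - 7) mod 5"
    have c: "c = 5 * e + f + 7" using False by (simp add: e_def f_def)
    have card: "int (card (reduced (5 * e + d))) =
       (16 * int e + 4 * ((4 * int d - 2 + 2) div 5)) + 2 * (16 * int e + 4 * ((4 * int d - 3 + 2) div 5)) + 
       5 * (16 * int e + 4 * ((4 * int d - 4 + 2) div 5)) + 8 * (16 * int e + 4 * ((4 * int d - 5 + 2) div 5)) +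
       10 * (16 * int e + 4 * ((4 * int d - 6 + 2) div 5)) + 12 * (16 * int e + 4 * ((4 * int d - 7 + 2) div 5)) +
       10 * (16 * int e + 4 * ((4 * int d - 8 + 2) div 5)) + 8 * (16 * int e + 4 * ((4 * int d - 9 + 2) div 5)) +
       5 * (16 * int e + 4 * ((4 * int d - 10 + 2) div 5)) + 2 * (16 * int e + 4 * ((4 * int d - 11 + 2) div 5)) +
       (16 * int e + 4 * ((4 * int d - 12 + 2) div 5)) +
       (8 * int e + 4 * ((2 * int d + 2) div 5)) + 3 * (8 * int e + 4 * ((2 * int d - 1 + 2) div 5)) +
       (8 * int e + 4 * ((2 * int d - 2 + 2) div 5)) - 5 * (8 * int e + 4 * ((2 * int d - 3 + 2) div 5)) -
       5 * (8 * int e + 4 * ((2 * int d - 4 + 2) div 5)) + (8 * int e + 4 * ((2 * int d - 5 + 2) div 5)) +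
       3 * (8 * int e + 4 * ((2 * int d - 6 + 2) div 5)) + (8 * int e + 4 * ((2 * int d - 7 + 2) div 5))"
      if "d \<ge> 4" for d
    proof -
      have "lat_count (2 * int (5 * e + d)) = 8 * int e + 4 * ((2 * int d + 2) div 5)"
        by (rule lat_count_progression(2)[OF that, where w = 0, unfolded diff_zero]) simp_all
      thus ?thesis
        unfolding card_reduced_eq_lat_count by (simp only: lat_count_progression[OF that])
    qed
    define x where "x = real (5 * e + f)"
    \<comment> \<open>The periodic part depends on the residue \<open>f\<close> only, so its seventh
      difference is a constant on each class.\<close>
    define \<epsilon> where "\<epsilon> = (\<lambda>n::nat. if n mod 5 = 2 then - 64 / 125 else 16 / 125 :: real)"
    have cf: "count_formula (5 * e + f + i) = count_poly (x + real i) + \<epsilon> (f + i)" for i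
    proof -
      have "(5 * e + f + i) mod 5 = (f + i) mod 5" by (simp add: add.assoc)
      thus ?thesis by (simp add: count_formula_def x_def \<epsilon>_def)
    qed
    have nab: "(nabla ^^ 7) count_formula c = 5376 / 5 + 1024 / 5 * x + (\<epsilon> (f + 7) - 7 * \<epsilon> (f + 6) + 21 * \<epsilon> (f + 5)
        - 35 * \<epsilon> (f + 4) + 35 * \<epsilon> (f + 3) - 21 * \<epsilon> (f + 2) + 7 * \<epsilon> (f + 1) - \<epsilon> f)"
    proof -
      have "count_formula (5 * e + f) = count_poly x + \<epsilon> f" using cf[of 0] by simp
      thus ?thesis
        unfolding c nabla_7_shift cf of_nat_numeral of_nat_1 using count_poly_difference_7[of x] by algebra
    qed
    have "f < 5" by (simp add: f_def)
    then consider "f = 0" | "f = 1" | "f = 2" | "f = 3" | "f = 4" by linarith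
    thus ?thesis
      unfolding nab unfolding real_card c add.assoc card[of "f + 7", simplified]
      by cases (simp_all add: x_def \<epsilon>_def add_divide_distrib)
  qed
qed

lemma card_sols: "real (card (sols c)) = count_formula c"
proof -
  have "(\<lambda>c. real (card (sols c))) = (psum ^^ 7) (\<lambda>c. real (card (reduced c)))"
    using of_nat_psum_funpow[of 7 "\<lambda>c. card (reduced c)"] unfolding card_sols_eq_psum [symmetric] .
  also have "\<dots> = (psum ^^ 7) ((nabla ^^ 7) count_formula)"
    using nabla_7_count_formula by presburger
  also have "\<dots> = count_formula" by (rule psum_nabla_funpow)
  finally show ?thesis by (rule fun_cong)
qed

section \<open>Exponents and divisors\<close>

text \<open>The system of the nine orders, solved for \<open>k\<close> and the exponents.\<close>

definition order_relation :: "nat \<Rightarrow> orders \<Rightarrow> (nat \<Rightarrow> int) \<Rightarrow> bool" where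
  "order_relation k t a \<longleftrightarrow> (case t of (x1, x3, x5, x7, y1, y3, z4, z2, z1) \<Rightarrow>
     8 * int k = int x1 + int x3 + int x5 + int x7 + int y1 + int y3 + 2 * int z4 + 2 * int z2 + 4 * int z1 \<and>
     10 * a 1 = 3 * int x1 + int x3 - int x5 - 3 * int x7 + 5 * int y1 - 5 * int y3 - 10 * int z2 + 20 * int z1 \<and>
     4 * a 2 = int x1 - int x3 - int x5 + int x7 - int y1 + int y3 - 4 * int z4 + 6 * int z2 + 4 * int z1 \<and>
     10 * a 3 = int x1 - 3 * int x3 + 3 * int x5 - int x7 - 5 * int y1 + 5 * int y3 - 10 * int z2 + 20 * int z1 \<and>
     2 * a 4 = - int y1 - int y3 + 3 * int z4 + int z2 + 2 * int z1 \<and>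
     10 * a 5 = - int x1 + 3 * int x3 - 3 * int x5 + int x7 - 5 * int y1 + 5 * int y3 - 10 * int z2 + 20 * int z1 \<and>
     4 * a 6 = - int x1 + int x3 + int x5 - int x7 + int y1 - int y3 - 4 * int z4 + 6 * int z2 + 4 * int z1 \<and>
     10 * a 7 = - 3 * int x1 - int x3 + int x5 + 3 * int x7 + 5 * int y1 - 5 * int y3 - 10 * int z2 + 20 * int z1 \<and>
     8 * a 8 = - int x1 - int x3 - int x5 - int x7 + 3 * int y1 + 3 * int y3 + 2 * int z4 + 2 * int z2 + 4 * int z1)"

lemma order_relation_restrict: "order_relation k t (restrict a {1..8}) \<longleftrightarrow> order_relation k t a"
  by (cases t rule: orders_cases) (simp add: order_relation_def)

text \<open>For the order at b/D the coefficient of k is 8 D, and that of a_j is 48 D B_2(x), where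
  x is the fractional part of j b / D; the factor 96 clears denominators.\<close>

lemma order_relation_orders:
  assumes "order_relation k (x1, x3, x5, x7, y1, y3, z4, z2, z1) a"
  shows "96 * int x1 = 128 * int k + 83 * a 1 + 44 * a 2 + 11 * a 3 - 16 * a 4 - 37 * a 5 - 52 * a 6 - 61 * a 7 - 64 * a 8"
    and "96 * int x3 = 128 * int k + 11 * a 1 - 52 * a 2 - 61 * a 3 - 16 * a 4 + 83 * a 5 + 44 * a 6 - 37 * a 7 - 64 * a 8"
    and "96 * int x5 = 128 * int k - 37 * a 1 - 52 * a 2 + 83 * a 3 - 16 * a 4 - 61 * a 5 + 44 * a 6 + 11 * a 7 - 64 * a 8"
    and "96 * int x7 = 128 * int k - 61 * a 1 + 44 * a 2 - 37 * a 3 - 16 * a 4 + 11 * a 5 - 52 * a 6 + 83 * a 7 - 64 * a 8"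
    and "96 * int y1 = 64 * int k + 22 * a 1 - 8 * a 2 - 26 * a 3 - 32 * a 4 - 26 * a 5 - 8 * a 6 + 22 * a 7 + 64 * a 8"
    and "96 * int y3 = 64 * int k - 26 * a 1 - 8 * a 2 + 22 * a 3 - 32 * a 4 + 22 * a 5 - 8 * a 6 - 26 * a 7 + 64 * a 8"
    and "96 * int z4 = 32 * int k - 4 * a 1 - 16 * a 2 - 4 * a 3 + 32 * a 4 - 4 * a 5 - 16 * a 6 - 4 * a 7 + 32 * a 8"
    and "96 * int z2 = 16 * int k - 8 * a 1 + 16 * a 2 - 8 * a 3 + 16 * a 4 - 8 * a 5 + 16 * a 6 - 8 * a 7 + 16 * a 8"
    and "96 * int z1 = 8 * int k + 8 * a 1 + 8 * a 2 + 8 * a 3 + 8 * a 4 + 8 * a 5 + 8 * a 6 + 8 * a 7 + 8 * a 8"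
  by (insert assms, unfold order_relation_def prod.case, elim conjE) algebra+

lemma cusp_order_16_eqs:
  shows "real 16 * cusp_order k 16 a 16 1 = (128 * real k + 83 * real_of_int (a 1) + 44 * real_of_int (a 2)
      + 11 * real_of_int (a 3) - 16 * real_of_int (a 4) - 37 * real_of_int (a 5) - 52 * real_of_int (a 6)
      - 61 * real_of_int (a 7) - 64 * real_of_int (a 8)) / 96"
    and "real 16 * cusp_order k 16 a 16 3 = (128 * real k + 11 * real_of_int (a 1) - 52 * real_of_int (a 2)
        - 61 * real_of_int (a 3) - 16 * real_of_int (a 4) + 83 * real_of_int (a 5) + 44 * real_of_int (a 6)
        - 37 * real_of_int (a 7) - 64 * real_of_int (a 8)) / 96"
    and "real 16 * cusp_order k 16 a 16 5 = (128 * real k - 37 * real_of_int (a 1) - 52 * real_of_int (a 2)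
        + 83 * real_of_int (a 3) - 16 * real_of_int (a 4) - 61 * real_of_int (a 5) + 44 * real_of_int (a 6)
        + 11 * real_of_int (a 7) - 64 * real_of_int (a 8)) / 96"
    and "real 16 * cusp_order k 16 a 16 7 = (128 * real k - 61 * real_of_int (a 1) + 44 * real_of_int (a 2)
        - 37 * real_of_int (a 3) - 16 * real_of_int (a 4) + 11 * real_of_int (a 5) - 52 * real_of_int (a 6)
        + 83 * real_of_int (a 7) - 64 * real_of_int (a 8)) / 96"
    and "real 8 * cusp_order k 16 a 8 1 = (64 * real k + 22 * real_of_int (a 1) - 8 * real_of_int (a 2)
        - 26 * real_of_int (a 3) - 32 * real_of_int (a 4) - 26 * real_of_int (a 5) - 8 * real_of_int (a 6)
        + 22 * real_of_int (a 7) + 64 * real_of_int (a 8)) / 96"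
    and "real 8 * cusp_order k 16 a 8 3 = (64 * real k - 26 * real_of_int (a 1) - 8 * real_of_int (a 2)
        + 22 * real_of_int (a 3) - 32 * real_of_int (a 4) + 22 * real_of_int (a 5) - 8 * real_of_int (a 6)
        - 26 * real_of_int (a 7) + 64 * real_of_int (a 8)) / 96"
    and "real 4 * cusp_order k 16 a 4 1 = (32 * real k - 4 * real_of_int (a 1) - 16 * real_of_int (a 2)
        - 4 * real_of_int (a 3) + 32 * real_of_int (a 4) - 4 * real_of_int (a 5) - 16 * real_of_int (a 6)
        - 4 * real_of_int (a 7) + 32 * real_of_int (a 8)) / 96"
    and "real 2 * cusp_order k 16 a 2 1 = (16 * real k - 8 * real_of_int (a 1) + 16 * real_of_int (a 2)
        - 8 * real_of_int (a 3) + 16 * real_of_int (a 4) - 8 * real_of_int (a 5) + 16 * real_of_int (a 6)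
        - 8 * real_of_int (a 7) + 16 * real_of_int (a 8)) / 96"
    and "real 1 * cusp_order k 16 a 1 1 = (8 * real k + 8 * real_of_int (a 1) + 8 * real_of_int (a 2)
        + 8 * real_of_int (a 3) + 8 * real_of_int (a 4) + 8 * real_of_int (a 5) + 8 * real_of_int (a 6)
        + 8 * real_of_int (a 7) + 8 * real_of_int (a 8)) / 96"
  by (simp_all add: cusp_order_def sum_Suc_0_8 field_simps)

lemma S2_16: "S2 16 a = 15 * a 1 + 28 * a 2 + 39 * a 3 + 48 * a 4 + 55 * a 5 + 60 * a 6 + 63 * a 7 + 64 * a 8"
  by (simp add: S2_def sum_Suc_0_8)

lemma sum_1_8: "(\<Sum>j=1..8::nat. a j) = a 1 + a 2 + a 3 + a 4 + a 5 + a 6 + a 7 + (a 8 :: int)"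
  by (simp add: sum_Suc_0_8)

lemma order_relation_imp_admissible:
  assumes "order_relation k t a"
  shows "admissible k a"
proof -
  obtain x1 x3 x5 x7 y1 y3 z4 z2 z1 where t: "t = (x1, x3, x5, x7, y1, y3, z4, z2, z1)" by (rule orders_cases)
  note eqs = order_relation_orders[OF assms[unfolded t]]
  have "int k + (\<Sum>j=1..8. a j) = 12 * int z1"
    unfolding sum_1_8 using eqs(9) by simp
  hence "12 dvd int k + (\<Sum>j=1..8. a j)" by simp
  \<comment> \<open>The order at infinity is x1 = 2/3 S1 - S2/32, where S1 = 24 z1.\<close>
  moreover have "S2 16 a = 32 * (16 * int z1 - int x1)"
    unfolding S2_16 using eqs(1,9) by simp
  hence "32 dvd S2 16 a" by simp
  moreover have "real 16 * cusp_order k 16 a 16 1 = real x1"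
    using arg_cong[OF eqs(1), of real_of_int] unfolding cusp_order_16_eqs by simp
  hence "cusp_order k 16 a 16 1 \<ge> 0"
    using of_nat_0_le_iff[of x1, where 'a = real] by (simp add: zero_le_mult_iff)
  moreover have "real 16 * cusp_order k 16 a 16 3 = real x3"
    using arg_cong[OF eqs(2), of real_of_int] unfolding cusp_order_16_eqs by simp
  hence "cusp_order k 16 a 16 3 \<ge> 0"
    using of_nat_0_le_iff[of x3, where 'a = real] by (simp add: zero_le_mult_iff)
  moreover have "real 16 * cusp_order k 16 a 16 5 = real x5"
    using arg_cong[OF eqs(3), of real_of_int] unfolding cusp_order_16_eqs by simp
  hence "cusp_order k 16 a 16 5 \<ge> 0"
    using of_nat_0_le_iff[of x5, where 'a = real] by (simp add: zero_le_mult_iff)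
  moreover have "real 16 * cusp_order k 16 a 16 7 = real x7"
    using arg_cong[OF eqs(4), of real_of_int] unfolding cusp_order_16_eqs by simp
  hence "cusp_order k 16 a 16 7 \<ge> 0"
    using of_nat_0_le_iff[of x7, where 'a = real] by (simp add: zero_le_mult_iff)
  moreover have "real 8 * cusp_order k 16 a 8 1 = real y1"
    using arg_cong[OF eqs(5), of real_of_int] unfolding cusp_order_16_eqs by simp
  hence "cusp_order k 16 a 8 1 \<ge> 0"
    using of_nat_0_le_iff[of y1, where 'a = real] by (simp add: zero_le_mult_iff)
  moreover have "real 8 * cusp_order k 16 a 8 3 = real y3"
    using arg_cong[OF eqs(6), of real_of_int] unfolding cusp_order_16_eqs by simp
  hence "cusp_order k 16 a 8 3 \<ge> 0"
    using of_nat_0_le_iff[of y3, where 'a = real] by (simp add: zero_le_mult_iff)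
  moreover have "real 4 * cusp_order k 16 a 4 1 = real z4"
    using arg_cong[OF eqs(7), of real_of_int] unfolding cusp_order_16_eqs by simp
  hence "cusp_order k 16 a 4 1 \<ge> 0"
    using of_nat_0_le_iff[of z4, where 'a = real] by (simp add: zero_le_mult_iff)
  moreover have "real 2 * cusp_order k 16 a 2 1 = real z2"
    using arg_cong[OF eqs(8), of real_of_int] unfolding cusp_order_16_eqs by simp
  hence "cusp_order k 16 a 2 1 \<ge> 0"
    using of_nat_0_le_iff[of z2, where 'a = real] by (simp add: zero_le_mult_iff)
  moreover have "real 1 * cusp_order k 16 a 1 1 = real z1"
    using arg_cong[OF eqs(9), of real_of_int] unfolding cusp_order_16_eqs by simp
  hence "cusp_order k 16 a 1 1 \<ge> 0"
    using of_nat_0_le_iff[of z1, where 'a = real] by (simp add: zero_le_mult_iff)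
  ultimately show ?thesis unfolding admissible_def by auto
qed

lemma order_relation_imp_sols:
  assumes "order_relation k t a"
  shows "t \<in> sols (2 * k)"
proof -
  obtain x1 x3 x5 x7 y1 y3 z4 z2 z1 where t: "t = (x1, x3, x5, x7, y1, y3, z4, z2, z1)" by (rule orders_cases)
  note rel = assms[unfolded t order_relation_def prod.case]
  have "int (x1 + x3 + x5 + x7 + y1 + y3 + 2 * z4 + 2 * z2 + 4 * z1) = int (4 * (2 * k))"
    using rel by simp
  hence "x1 + x3 + x5 + x7 + y1 + y3 + 2 * z4 + 2 * z2 + 4 * z1 = 4 * (2 * k)" unfolding of_nat_eq_iff .
  \<comment> \<open>Integrality of \<open>a 2\<close>, then of \<open>a 2\<close> and
    \<open>a 4\<close>, then of \<open>a 3\<close> yields the three congruences.\<close>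
  moreover have "int (x3 + x5 + y1 + z4) = 2 * (2 * int k - int z4 + int z2 - a 2)"
    using rel by simp
  hence "even (int (x3 + x5 + y1 + z4))" by (rule dvdI)
  moreover have "int (x3 + x5 + y3 + z2) = 2 * (a 2 - a 4 - 2 * int k + int x3 + int x5 + 3 * int z4 + int z1)"
    using rel by simp
  hence "even (int (x3 + x5 + y3 + z2))" by (rule dvdI)
  moreover have "int (3 * x1 + x3 + 4 * x5 + 2 * x7) = 5 * (a 3 + 4 * int k - int z4 - 4 * int z1 - int y3)"
    using rel by simp
  hence "5 dvd int (3 * x1 + x3 + 4 * x5 + 2 * x7)" by (rule dvdI)
  hence "int 5 dvd int (3 * x1 + x3 + 4 * x5 + 2 * x7)" by (simp only: of_nat_numeral)
  ultimately show ?thesis unfolding t sols_def by (simp only: mem_Collect_eq prod.case int_dvd_int_iff even_of_nat)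
qed

lemma sols_imp_order_relation:
  assumes "t \<in> sols (2 * k)"
  shows "\<exists>a. order_relation k t a"
proof -
  obtain x1 x3 x5 x7 y1 y3 z4 z2 z1 where t: "t = (x1, x3, x5, x7, y1, y3, z4, z2, z1)" by (rule orders_cases)
  have sum: "x1 + x3 + x5 + x7 + y1 + y3 + 2 * z4 + 2 * z2 + 4 * z1 = 8 * k"
    and dvd: "even (x3 + x5 + y1 + z4)" "even (x3 + x5 + y3 + z2)" "5 dvd 3 * x1 + x3 + 4 * x5 + 2 * x7"
    using assms by (simp_all add: t sols_def)
  obtain u where u: "x3 + x5 + y1 + z4 = 2 * u" using dvd(1) by (rule dvdE)
  obtain v where v: "x3 + x5 + y3 + z2 = 2 * v" using dvd(2) by (rule dvdE)
  obtain m where m: "3 * x1 + x3 + 4 * x5 + 2 * x7 = 5 * m" using dvd(3) by (rule dvdE)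
  note eqs = sum[THEN arg_cong[of _ _ int]] u[THEN arg_cong[of _ _ int]] v[THEN arg_cong[of _ _ int]] m[THEN arg_cong[of _ _ int]]
  note eqs = eqs[unfolded of_nat_add of_nat_mult of_nat_numeral]
  \<comment> \<open>The fractions of the solved system disappear once u, v and m stand for the
    halves and the fifth of the divisible sums.\<close>
  define f1 f2 f3 f4 f5 f6 f7 f8 where
    "f1 = 4 * int k - int z4 - 2 * int z2 + int x1 + int x5 - int y3 - 2 * int m"
    and "f2 = 2 * int k - int u - int z4 + int z2"
    and "f3 = int m - 4 * int k + int z4 + 4 * int z1 + int y3"
    and "f4 = - int u - int v + int x3 + int x5 + 2 * int z4 + int z2 + int z1"
    and "f5 = - int m + 4 * int k - int z4 - 2 * int z2 - int y1"
    and "f6 = - 2 * int k + int u - int z4 + 2 * int z2 + 2 * int z1"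
    and "f7 = - 4 * int k + int z4 + 4 * int z1 - int x1 - int x5 + int y1 + 2 * int m"
    and "f8 = - int k + int u + int v - int x3 - int x5 + int z1"
  define a where "a = ((\<lambda>_. 0)(1 := f1, 2 := f2, 3 := f3, 4 := f4, 5 := f5, 6 := f6, 7 := f7, 8 := f8 :: int) :: nat \<Rightarrow> int)"
  have "a 1 = f1" "a 2 = f2" "a 3 = f3" "a 4 = f4" "a 5 = f5" "a 6 = f6" "a 7 = f7" "a 8 = f8"
    by (simp_all add: a_def)
  note a = this[unfolded f1_def f2_def f3_def f4_def f5_def f6_def f7_def f8_def]
  have "order_relation k t a"
    unfolding order_relation_def t prod.case a by (insert eqs) (intro conjI; algebra)
  thus ?thesis by blast
qed

lemma admissible_imp_order_relation:
  assumes "admissible k a"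
  shows "\<exists>t. order_relation k t a"
proof -
  obtain s v where s: "int k + (a 1 + a 2 + a 3 + a 4 + a 5 + a 6 + a 7 + a 8) = 12 * s"
    and v: "15 * a 1 + 28 * a 2 + 39 * a 3 + 48 * a 4 + 55 * a 5 + 60 * a 6 + 63 * a 7 + 64 * a 8 = 32 * v"
    using assms unfolding admissible_def S2_16 sum_1_8 by (elim conjE dvdE)
  \<comment> \<open>The order formulas divided by 96, made visibly integral by eliminating k through
    s and adding multiples of the relation that defines v.\<close>
  define ix1 ix3 ix5 ix7 iy1 iy3 iz4 iz2 iz1 where
    "ix1 = 16 * s - v"
    and "ix3 = 16 * s - 9 * v + 3 * a 1 + 6 * a 2 + 9 * a 3 + 12 * a 4 + 15 * a 5 + 16 * a 6 + 16 * a 7 + 16 * a 8"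
    and "ix5 = 16 * s - 25 * v + 10 * a 1 + 20 * a 2 + 30 * a 3 + 36 * a 4 + 41 * a 5 + 46 * a 6 + 48 * a 7 + 48 * a 8"
    and "ix7 = 16 * s - 17 * v + 6 * a 1 + 14 * a 2 + 19 * a 3 + 24 * a 4 + 28 * a 5 + 30 * a 6 + 33 * a 7 + 32 * a 8"
    and "iy1 = 8 * s - 18 * v + 8 * a 1 + 15 * a 2 + 21 * a 3 + 26 * a 4 + 30 * a 5 + 33 * a 6 + 35 * a 7 + 36 * a 8"
    and "iy3 = 8 * s - 2 * v + a 2 + 2 * a 3 + 2 * a 4 + 3 * a 5 + 3 * a 6 + 3 * a 7 + 4 * a 8"
    and "iz4 = 4 * s - 20 * v + 9 * a 1 + 17 * a 2 + 24 * a 3 + 30 * a 4 + 34 * a 5 + 37 * a 6 + 39 * a 7 + 40 * a 8"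
    and "iz2 = 2 * s - 24 * v + 11 * a 1 + 21 * a 2 + 29 * a 3 + 36 * a 4 + 41 * a 5 + 45 * a 6 + 47 * a 7 + 48 * a 8"
    and "iz1 = s"
  note defs = ix1_def ix3_def ix5_def ix7_def iy1_def iy3_def iz4_def iz2_def iz1_def
  have "96 * ix1 = 128 * int k + 83 * a 1 + 44 * a 2 + 11 * a 3 - 16 * a 4 - 37 * a 5 - 52 * a 6 - 61 * a 7
      - 64 * a 8" using s v unfolding defs by simp
  hence "real 16 * cusp_order k 16 a 16 1 = of_int ix1"
    unfolding cusp_order_16_eqs by (simp flip: of_int_eq_iff[where 'a = real])
  moreover have "cusp_order k 16 a 16 1 \<ge> 0" using assms unfolding admissible_def by simp
  ultimately have x1: "ix1 \<ge> 0" by (metis mult_nonneg_nonneg of_int_0_le_iff of_nat_0_le_iff)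
  have "96 * ix3 = 128 * int k + 11 * a 1 - 52 * a 2 - 61 * a 3 - 16 * a 4 + 83 * a 5 + 44 * a 6 - 37 * a 7
      - 64 * a 8" using s v unfolding defs by simp
  hence "real 16 * cusp_order k 16 a 16 3 = of_int ix3"
    unfolding cusp_order_16_eqs by (simp flip: of_int_eq_iff[where 'a = real])
  moreover have "cusp_order k 16 a 16 3 \<ge> 0" using assms unfolding admissible_def by simp
  ultimately have x3: "ix3 \<ge> 0" by (metis mult_nonneg_nonneg of_int_0_le_iff of_nat_0_le_iff)
  have "96 * ix5 = 128 * int k - 37 * a 1 - 52 * a 2 + 83 * a 3 - 16 * a 4 - 61 * a 5 + 44 * a 6 + 11 * a 7
      - 64 * a 8" using s v unfolding defs by simp
  hence "real 16 * cusp_order k 16 a 16 5 = of_int ix5"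
    unfolding cusp_order_16_eqs by (simp flip: of_int_eq_iff[where 'a = real])
  moreover have "cusp_order k 16 a 16 5 \<ge> 0" using assms unfolding admissible_def by simp
  ultimately have x5: "ix5 \<ge> 0" by (metis mult_nonneg_nonneg of_int_0_le_iff of_nat_0_le_iff)
  have "96 * ix7 = 128 * int k - 61 * a 1 + 44 * a 2 - 37 * a 3 - 16 * a 4 + 11 * a 5 - 52 * a 6 + 83 * a 7
      - 64 * a 8" using s v unfolding defs by simp
  hence "real 16 * cusp_order k 16 a 16 7 = of_int ix7"
    unfolding cusp_order_16_eqs by (simp flip: of_int_eq_iff[where 'a = real])
  moreover have "cusp_order k 16 a 16 7 \<ge> 0" using assms unfolding admissible_def by simp
  ultimately have x7: "ix7 \<ge> 0" by (metis mult_nonneg_nonneg of_int_0_le_iff of_nat_0_le_iff)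
  have "96 * iy1 = 64 * int k + 22 * a 1 - 8 * a 2 - 26 * a 3 - 32 * a 4 - 26 * a 5 - 8 * a 6 + 22 * a 7
      + 64 * a 8" using s v unfolding defs by simp
  hence "real 8 * cusp_order k 16 a 8 1 = of_int iy1"
    unfolding cusp_order_16_eqs by (simp flip: of_int_eq_iff[where 'a = real])
  moreover have "cusp_order k 16 a 8 1 \<ge> 0" using assms unfolding admissible_def by simp
  ultimately have y1: "iy1 \<ge> 0" by (metis mult_nonneg_nonneg of_int_0_le_iff of_nat_0_le_iff)
  have "96 * iy3 = 64 * int k - 26 * a 1 - 8 * a 2 + 22 * a 3 - 32 * a 4 + 22 * a 5 - 8 * a 6 - 26 * a 7
      + 64 * a 8" using s v unfolding defs by simp
  hence "real 8 * cusp_order k 16 a 8 3 = of_int iy3"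
    unfolding cusp_order_16_eqs by (simp flip: of_int_eq_iff[where 'a = real])
  moreover have "cusp_order k 16 a 8 3 \<ge> 0" using assms unfolding admissible_def by simp
  ultimately have y3: "iy3 \<ge> 0" by (metis mult_nonneg_nonneg of_int_0_le_iff of_nat_0_le_iff)
  have "96 * iz4 = 32 * int k - 4 * a 1 - 16 * a 2 - 4 * a 3 + 32 * a 4 - 4 * a 5 - 16 * a 6 - 4 * a 7
      + 32 * a 8" using s v unfolding defs by simp
  hence "real 4 * cusp_order k 16 a 4 1 = of_int iz4"
    unfolding cusp_order_16_eqs by (simp flip: of_int_eq_iff[where 'a = real])
  moreover have "cusp_order k 16 a 4 1 \<ge> 0" using assms unfolding admissible_def by simp
  ultimately have z4: "iz4 \<ge> 0" by (metis mult_nonneg_nonneg of_int_0_le_iff of_nat_0_le_iff)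
  have "96 * iz2 = 16 * int k - 8 * a 1 + 16 * a 2 - 8 * a 3 + 16 * a 4 - 8 * a 5 + 16 * a 6 - 8 * a 7
      + 16 * a 8" using s v unfolding defs by simp
  hence "real 2 * cusp_order k 16 a 2 1 = of_int iz2"
    unfolding cusp_order_16_eqs by (simp flip: of_int_eq_iff[where 'a = real])
  moreover have "cusp_order k 16 a 2 1 \<ge> 0" using assms unfolding admissible_def by simp
  ultimately have z2: "iz2 \<ge> 0" by (metis mult_nonneg_nonneg of_int_0_le_iff of_nat_0_le_iff)
  have "96 * iz1 = 8 * int k + 8 * a 1 + 8 * a 2 + 8 * a 3 + 8 * a 4 + 8 * a 5 + 8 * a 6 + 8 * a 7 + 8 * a 8"
      using s v unfolding defs by simp
  hence "real 1 * cusp_order k 16 a 1 1 = of_int iz1"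
    unfolding cusp_order_16_eqs by (simp flip: of_int_eq_iff[where 'a = real])
  moreover have "cusp_order k 16 a 1 1 \<ge> 0" using assms unfolding admissible_def by simp
  ultimately have z1: "iz1 \<ge> 0" by (metis mult_nonneg_nonneg of_int_0_le_iff of_nat_0_le_iff)
  note nonneg = x1 x3 x5 x7 y1 y3 z4 z2 z1
  have "order_relation k (nat ix1, nat ix3, nat ix5, nat ix7, nat iy1, nat iy3, nat iz4, nat iz2, nat iz1) a"
    unfolding order_relation_def prod.case nonneg[THEN nat_0_le] unfolding defs by (insert s v) (intro conjI; algebra)
  thus ?thesis by blast
qed

lemma order_relation_unique_left:
  assumes "order_relation k t a" "order_relation k t' a"
  shows "t = t'"
proof -
  obtain x1 x3 x5 x7 y1 y3 z4 z2 z1 where t: "t = (x1, x3, x5, x7, y1, y3, z4, z2, z1)" by (rule orders_cases)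
  obtain x1' x3' x5' x7' y1' y3' z4' z2' z1' where t': "t' = (x1', x3', x5', x7', y1', y3', z4', z2', z1')"
      by (rule orders_cases)
  note eqs = order_relation_orders[OF assms(1)[unfolded t]] and eqs' = order_relation_orders[OF assms(2)[unfolded t']]
  have "96 * int x1 = 96 * int x1' \<and> 96 * int x3 = 96 * int x3' \<and> 96 * int x5 = 96 * int x5' \<and> 96 * int x7
      = 96 * int x7' \<and> 96 * int y1 = 96 * int y1' \<and> 96 * int y3 = 96 * int y3' \<and> 96 * int z4 = 96 * int z4'
      \<and> 96 * int z2 = 96 * int z2' \<and> 96 * int z1 = 96 * int z1'"
    by (simp only: eqs eqs')
  thus ?thesis unfolding t t' by simp
qed

lemma order_relation_unique_right:
  assumes "order_relation k t a" "order_relation k t a'" "j \<in> {1..8}"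
  shows "a j = a' j"
proof -
  obtain x1 x3 x5 x7 y1 y3 z4 z2 z1 where t: "t = (x1, x3, x5, x7, y1, y3, z4, z2, z1)" by (rule orders_cases)
  have *: "{1..8::nat} = {1, 2, 3, 4, 5, 6, 7, 8}" by auto
  have j: "j \<in> {1, 2, 3, 4, 5, 6, 7, 8}" using assms(3) unfolding * .
  note r = assms(1)[unfolded t order_relation_def prod.case] and r' = assms(2)[unfolded t order_relation_def prod.case]
  have "10 * a 1 = 10 * a' 1 \<and> 4 * a 2 = 4 * a' 2 \<and> 10 * a 3 = 10 * a' 3 \<and> 2 * a 4 = 2 * a' 4 \<and> 10 * a 5
      = 10 * a' 5 \<and> 4 * a 6 = 4 * a' 6 \<and> 10 * a 7 = 10 * a' 7 \<and> 8 * a 8 = 8 * a' 8"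
    by (simp only: r r')
  hence "a 1 = a' 1" "a 2 = a' 2" "a 3 = a' 3" "a 4 = a' 4" "a 5 = a' 5" "a 6 = a' 6" "a 7 = a' 7" "a 8 = a' 8"
    by simp_all
  with j show ?thesis by (elim insertE emptyE) simp_all
qed

lemma card_L_16: "card (L 16 k) = card (sols (2 * k))"
proof -
  have L: "L 16 k = {a \<in> {1..8} \<rightarrow>\<^sub>E UNIV. admissible k a}"
    by (simp add: L_def theta_prod_16_modular_iff)
  have ex: "\<exists>a\<in>L 16 k. order_relation k t a" if t: "t \<in> sols (2 * k)" for t
  proof -
    obtain a where "order_relation k t a" using sols_imp_order_relation[OF t] by blast
    \<comment> \<open>Members of \<open>L\<close> are \<open>undefined\<close> outside {1..8}, so
      the witness has to be cut down.\<close>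
    hence rel: "order_relation k t (restrict a {1..8})" unfolding order_relation_restrict .
    hence "restrict a {1..8} \<in> L 16 k"
      unfolding L using order_relation_imp_admissible by auto
    with rel show ?thesis by blast
  qed
  from ex have "\<forall>t\<in>sols (2 * k). \<exists>a. a \<in> L 16 k \<and> order_relation k t a" by blast
  from bchoice[OF this] obtain F where F': "\<forall>t\<in>sols (2 * k). F t \<in> L 16 k \<and> order_relation k t (F t)" by (rule exE)
  have F: "F t \<in> L 16 k" "order_relation k t (F t)" if "t \<in> sols (2 * k)" for t
    using F' that by simp_all
  have "bij_betw F (sols (2 * k)) (L 16 k)"
  proof (rule bij_betwI')
    show "F t = F t' \<longleftrightarrow> t = t'" if "t \<in> sols (2 * k)" "t' \<in> sols (2 * k)" for t t'
    proof
      assume eq: "F t = F t'"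
      show "t = t'"
        by (rule order_relation_unique_left[OF F(2)[OF that(1)] F(2)[OF that(2), folded eq]])
    qed simp
    show "F t \<in> L 16 k" if "t \<in> sols (2 * k)" for t by (rule F(1)[OF that])
    show "\<exists>t\<in>sols (2 * k). a = F t" if a: "a \<in> L 16 k" for a
    proof -
      obtain t where t: "order_relation k t a" using admissible_imp_order_relation[of k a] a unfolding L by auto
      have t': "t \<in> sols (2 * k)" by (rule order_relation_imp_sols[OF t])
      have "a = F t"
      proof (rule PiE_ext)
        show "a \<in> {1..8} \<rightarrow>\<^sub>E UNIV" "F t \<in> {1..8} \<rightarrow>\<^sub>E UNIV" using a F(1)[OF t'] unfolding L by auto
        show "a j = F t j" if "j \<in> {1..8}" for j
          by (rule order_relation_unique_right[OF t F(2)[OF t'] that])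
      qed
      with t' show ?thesis by blast
    qed
  qed
  thus ?thesis by (simp add: bij_betw_same_card)
qed

text \<open>Doubling is invertible modulo 5, so the exceptional class 2 of c = 2k is the class 1 of
  k.\<close>

lemma count_formula_even: "count_formula (2 * k) = T16 k + E16 k"
proof -
  have "[k = 1] (mod 5) \<longleftrightarrow> 2 * k mod 5 = 2"
  proof -
    have *: "2 * k mod 5 = 2 * (k mod 5) mod 5" by (simp add: mod_mult_right_eq)
    have "k mod 5 < 5" by simp
    then consider "k mod 5 = 0" | "k mod 5 = 1" | "k mod 5 = 2" | "k mod 5 = 3" | "k mod 5 = 4" by linarith
    thus ?thesis by cases (simp_all add: cong_def *)
  qed
  thus ?thesis by (simp add: count_formula_def count_poly_def T16_def E16_def power_mult_distrib)
qed

theorem theorem5p5: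
  fixes k :: nat
  shows "real (card (L 16 k)) = T16 k + E16 k"
  unfolding card_L_16 card_sols count_formula_even ..

end
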